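(* Consider the RKCDG method (described in the context) for the linear advection equation with an $r$th-order, $s$-stage explicit Runge--Kutta method, on a quasi-uniform 1D mesh or a uniform 2D Cartesian mesh with periodic boundary conditions, and fix an integer $m\ge1$. Let $\zeta$ be the termination index, $\rho$ the contribution index and $a^{(\zeta)}_{\zeta\zeta}$ the diagonal entry defined in the context via the matrix transferring process, and let $\lambda=\tau/h$. Then: (1) If $\rho=\zeta$ and $a^{(\zeta)}_{\zeta\zeta}<0$, the method is monotonically stable: there is a constant $C>0$ such that $\|\boldsymbol u_h^{n+m}\|\le\|\boldsymbol u_h^n\|$ whenever $\tau\le Ch$. (2) If $\rho=\zeta$ and $a^{(\zeta)}_{\zeta\zeta}>0$, the method is weak$(2\zeta)$ stable: for sufficiently small $\lambda$ there is a constant $C>0$ such that $\|\boldsymbol u_h^{n+m}\|^2\le(1+C\tau)\|\boldsymbol u_h^n\|^2$ when $\tau\le h^{1+\frac1{2\zeta-1}}$. (3) If $\rho<\zeta$, the method is weak$(2\rho+1)$ stable: for sufficiently small $\lambda$ there is a constant $C>0$ such that $\|\boldsymbol u_h^{n+m}\|^2\le(1+C\tau)\|\boldsymbol u_h^n\|^2$ when $\tau\le h^{1+\frac1{2\rho}}$.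
   Context: Linear advection: $u_t+\boldsymbol\beta\cdot\nabla u=0$ with constant nonzero $\boldsymbol\beta$ (in 1D, $f(u)=\beta_1u$; in 2D, $\boldsymbol f(u)=(\beta_1u,\beta_2u)$). CDG setting: a primal mesh (1D cells $[x_{i-\frac12},x_{i+\frac12}]$; 2D Cartesian cells $[x_{i-\frac12},x_{i+\frac12}]\times[y_{j-\frac12},y_{j+\frac12}]$) and the dual mesh whose cells join neighbouring primal cell centers ($[x_i,x_{i+1}]$, resp. $[x_i,x_{i+1}]\times[y_j,y_{j+1}]$); $V_h$, $W_h$ are the spaces of discontinuous piecewise polynomials of degree $\le k$ on the primal and dual meshes; $h$ is the mesh size; $\langle\boldsymbol u,\boldsymbol\phi\rangle=\int_\Omega u_1\phi_1+u_2\phi_2$, $\|\cdot\|$ the induced norm. The CDG operator is (1D, $\tau_{\max}=C_{\rm CFL}h/|\beta_1|$) $\mathcal H(\boldsymbol u,\boldsymbol\phi)=-\frac1{\tau_{\max}}\int_\Omega(u_1-u_2)(\phi_1-\phi_2)+\int_\Omega f(u_2)\partial_x\phi_1+f(u_1)\partial_x\phi_2-\sum_i\big(f(u_2)_{i+\frac12}(\phi_1)^-_{i+\frac12}-f(u_2)_{i-\frac12}(\phi_1)^+_{i-\frac12}+f(u_1)_{i+1}(\phi_2)^-_{i+1}-f(u_1)_i(\phi_2)^+_i\big)$, with one-sided traces $\phi^\pm$, and analogously in 2D ($\tau_{\max}=C_{\rm CFL}/(|\beta_1|/h_x+|\beta_2|/h_y)$; volume term $\int\boldsymbol f(u_2)\cdot\nabla\phi_1+\boldsymbol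 f(u_1)\cdot\nabla\phi_2$ and edge terms $-\int_{\partial C}\boldsymbol f(u_2)\cdot\boldsymbol n\,\phi_1$ over primal cells $C$, $-\int_{\partial D}\boldsymbol f(u_1)\cdot\boldsymbol n\,\phi_2$ over dual cells $D$, with interior traces of $\phi$ and outward normals). RKCDG method: given $\boldsymbol u_h^n\in V_h\times W_h$, set $\boldsymbol u_h^{n,0}=\boldsymbol u_h^n$, $\langle\boldsymbol u_h^{n,l+1},\boldsymbol\varphi\rangle=\sum_{0\le m'\le l}\big(c_{lm'}\langle\boldsymbol u_h^{n,m'},\boldsymbol\varphi\rangle+\tau d_{lm'}\mathcal H(\boldsymbol u_h^{n,m'},\boldsymbol\varphi)\big)$ for all $\boldsymbol\varphi\in V_h\times W_h$, $l=0,\dots,s-1$, and $\boldsymbol u_h^{n+1}=\boldsymbol u_h^{n,s}$; $c_{lm'},d_{lm'}$ are the RK coefficients and $\tau$ the time step. Temporal difference operators: $\mathbb D_0\boldsymbol u=\boldsymbol u$, and $\langle\mathbb D_i\boldsymbol u,\boldsymbol\varphi\rangle=\tau\mathcal H(\mathbb D_{i-1}\boldsymbol u,\boldsymbol\varphi)$ for all $\boldsymbol\varphi\in V_h\times W_h$, $i\ge1$. There are constants $\alpha_0>0,\alpha_1,\dots,\alpha_{ms}$ (depending only on the RK method and $m$) with $\alpha_0\boldsymbol u_h^{n+m}=\sum_{0\le i\le ms}\alpha_i\mathbb D_i\boldsymbol u_h^n$. Matrix transferring process: symmetric matrices $\mathbb A^{(0)}=(a^{(0)}_{ij})$, $\mathbb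 B^{(0)}=(b^{(0)}_{ij})$ indexed by $0\le i,j\le ms$ with $a^{(0)}_{00}=0$, $a^{(0)}_{ij}=\alpha_i\alpha_j$ for $i+j>0$, $\mathbb B^{(0)}=0$; for $\ell\ge0$ (entries with $i\ge j$, the rest by symmetry): $a^{(\ell+1)}_{ij}=0$ if $0\le j\le\ell$; $a^{(\ell+1)}_{\ell+1,\ell+1}=a^{(\ell)}_{\ell+1,\ell+1}-2a^{(\ell)}_{\ell+2,\ell}$; $a^{(\ell+1)}_{i,\ell+1}=a^{(\ell)}_{i,\ell+1}-a^{(\ell)}_{i+1,\ell}$ for $\ell+2\le i\le ms-1$; $a^{(\ell+1)}_{ij}=a^{(\ell)}_{ij}$ otherwise; and $b^{(\ell+1)}_{i\ell}=2a^{(\ell)}_{i+1,\ell}$ for $\ell\le i\le ms-1$, $b^{(\ell+1)}_{ij}=b^{(\ell)}_{ij}$ otherwise. The process stops at the first $\ell=\zeta$ with $a^{(\zeta)}_{\zeta\zeta}\ne0$; $\zeta$ is the termination index. With $\mathbb B^{(\zeta)}_\kappa$ the $(\kappa+1)$-th order leading principal submatrix of $\mathbb B^{(\zeta)}$, the contribution index is $\rho=\max\{\kappa:0\le\kappa\le\zeta,\ \mathbb B^{(\zeta)}_{\kappa-1}\text{ positive definite}\}$. *)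

theory Defs
  imports "HOL-Analysis.Analysis" "HOL-Computational_Algebra.Polynomial"
begin

text \<open>Stage polynomials R_0, ..., R_l of the RK method with coefficients c l m', d l m':
  u^{n,l} = R_l(tau L) u^n.  R_0 = 1, R_{l+1}(z) = sum_{m' <= l} (c l m' + z d l m') R_{m'}(z).\<close>
primrec rk_polys :: "(nat \<Rightarrow> nat \<Rightarrow> real) \<Rightarrow> (nat \<Rightarrow> nat \<Rightarrow> real) \<Rightarrow> nat \<Rightarrow> real poly list" where
  "rk_polys c d 0 = [1]"
| "rk_polys c d (Suc l) = rk_polys c d l @
     [\<Sum>m'\<le>l. smult (c l m') (rk_polys c d l ! m') + smult (d l m') (pCons 0 (rk_polys c d l ! m'))]"

definition rk_stab_poly :: "(nat \<Rightarrow> nat \<Rightarrow> real) \<Rightarrow> (nat \<Rightarrow> nat \<Rightarrow> real) \<Rightarrow> nat \<Rightarrow> real poly" where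
  "rk_stab_poly c d s = rk_polys c d s ! s"

text \<open>The constants alpha_i with alpha_0 u^{n+m} = sum alpha_i D_i u^n (normalised by alpha_0 = R(0)^m):
  the coefficients of R_s(z)^m.\<close>
definition rk_alpha :: "(nat \<Rightarrow> nat \<Rightarrow> real) \<Rightarrow> (nat \<Rightarrow> nat \<Rightarrow> real) \<Rightarrow> nat \<Rightarrow> nat \<Rightarrow> nat \<Rightarrow> real" where
  "rk_alpha c d s m i = coeff (rk_stab_poly c d s ^ m) i"

section \<open>Matrix transferring process (indices 0..M, M = m s; entries outside are 0)\<close>

definition mt_A0 :: "(nat \<Rightarrow> real) \<Rightarrow> nat \<Rightarrow> nat \<Rightarrow> nat \<Rightarrow> real" where
  "mt_A0 \<alpha> M i j = (if i \<le> M \<and> j \<le> M \<and> 0 < i + j then \<alpha> i * \<alpha> j else 0)"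

definition mt_stepA_low :: "nat \<Rightarrow> nat \<Rightarrow> (nat \<Rightarrow> nat \<Rightarrow> real) \<Rightarrow> nat \<Rightarrow> nat \<Rightarrow> real" where
  "mt_stepA_low M l A i j =
     (if j \<le> l then 0
      else if i = l + 1 \<and> j = l + 1 then A (l+1) (l+1) - 2 * A (l+2) l
      else if j = l + 1 \<and> l + 2 \<le> i \<and> i \<le> M - 1 then A i (l+1) - A (i+1) l
      else A i j)"

definition mt_stepA :: "nat \<Rightarrow> nat \<Rightarrow> (nat \<Rightarrow> nat \<Rightarrow> real) \<Rightarrow> nat \<Rightarrow> nat \<Rightarrow> real" where
  "mt_stepA M l A i j = (if j \<le> i then mt_stepA_low M l A i j else mt_stepA_low M l A j i)"

definition mt_stepB_low :: "nat \<Rightarrow> nat \<Rightarrow> (nat \<Rightarrow> nat \<Rightarrow> real) \<Rightarrow> (nat \<Rightarrow> nat \<Rightarrow> real) \<Rightarrow> nat \<Rightarrow> nat \<Rightarrow> real" where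
  "mt_stepB_low M l A B i j = (if j = l \<and> l \<le> i \<and> i \<le> M - 1 then 2 * A (i+1) l else B i j)"

definition mt_stepB :: "nat \<Rightarrow> nat \<Rightarrow> (nat \<Rightarrow> nat \<Rightarrow> real) \<Rightarrow> (nat \<Rightarrow> nat \<Rightarrow> real) \<Rightarrow> nat \<Rightarrow> nat \<Rightarrow> real" where
  "mt_stepB M l A B i j = (if j \<le> i then mt_stepB_low M l A B i j else mt_stepB_low M l A B j i)"

fun mt_AB :: "(nat \<Rightarrow> real) \<Rightarrow> nat \<Rightarrow> nat \<Rightarrow> (nat \<Rightarrow> nat \<Rightarrow> real) \<times> (nat \<Rightarrow> nat \<Rightarrow> real)" where
  "mt_AB \<alpha> M 0 = (mt_A0 \<alpha> M, (\<lambda>i j. 0))"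
| "mt_AB \<alpha> M (Suc l) = (mt_stepA M l (fst (mt_AB \<alpha> M l)), mt_stepB M l (fst (mt_AB \<alpha> M l)) (snd (mt_AB \<alpha> M l)))"

definition is_termination_index :: "(nat \<Rightarrow> real) \<Rightarrow> nat \<Rightarrow> nat \<Rightarrow> bool" where
  "is_termination_index \<alpha> M \<zeta> \<longleftrightarrow>
     fst (mt_AB \<alpha> M \<zeta>) \<zeta> \<zeta> \<noteq> 0 \<and> (\<forall>l<\<zeta>. fst (mt_AB \<alpha> M l) l l = 0)"

text \<open>The leading principal submatrix of order kappa (indices 0..kappa-1) is positive definite
  (vacuously true for kappa = 0, the empty matrix).\<close>
definition pos_def_lead :: "(nat \<Rightarrow> nat \<Rightarrow> real) \<Rightarrow> nat \<Rightarrow> bool" where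
  "pos_def_lead B \<kappa> \<longleftrightarrow>
     (\<forall>x :: nat \<Rightarrow> real. (\<exists>i<\<kappa>. x i \<noteq> 0) \<longrightarrow> 0 < (\<Sum>i<\<kappa>. \<Sum>j<\<kappa>. x i * B i j * x j))"

definition contribution_index :: "(nat \<Rightarrow> real) \<Rightarrow> nat \<Rightarrow> nat \<Rightarrow> nat" where
  "contribution_index \<alpha> M \<zeta> = (GREATEST \<kappa>. \<kappa> \<le> \<zeta> \<and> pos_def_lead (snd (mt_AB \<alpha> M \<zeta>)) (\<kappa>))"

text \<open>U j l = u_h^{n+j,l}; U 0 0 = u_h^n and U m 0 = u_h^{n+m}.\<close>
definition rk_traj :: "'a set \<Rightarrow> ('a \<Rightarrow> 'a \<Rightarrow> real) \<Rightarrow> ('a \<Rightarrow> 'a \<Rightarrow> real) \<Rightarrow>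
    (nat \<Rightarrow> nat \<Rightarrow> real) \<Rightarrow> (nat \<Rightarrow> nat \<Rightarrow> real) \<Rightarrow> nat \<Rightarrow> real \<Rightarrow> nat \<Rightarrow> (nat \<Rightarrow> nat \<Rightarrow> 'a) \<Rightarrow> bool" where
  "rk_traj S ip H c d s \<tau> m U \<longleftrightarrow>
     U 0 0 \<in> S \<and>
     (\<forall>j<m. \<forall>l<s. U j (Suc l) \<in> S \<and>
        (\<forall>\<phi>\<in>S. ip (U j (Suc l)) \<phi> =
            (\<Sum>m'\<le>l. c l m' * ip (U j m') \<phi> + \<tau> * d l m' * H (U j m') \<phi>))) \<and>
     (\<forall>j<m. U (Suc j) 0 = U j s)"

text \<open>Stability notions for a family of meshes mu in Ms with mesh size h mu,
  space S mu, inner product ip mu and CDG operator H mu.\<close>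
definition monotonically_stable ::
  "'m set \<Rightarrow> ('m \<Rightarrow> real) \<Rightarrow> ('m \<Rightarrow> 'a set) \<Rightarrow> ('m \<Rightarrow> 'a \<Rightarrow> 'a \<Rightarrow> real) \<Rightarrow> ('m \<Rightarrow> 'a \<Rightarrow> 'a \<Rightarrow> real) \<Rightarrow>
   (nat \<Rightarrow> nat \<Rightarrow> real) \<Rightarrow> (nat \<Rightarrow> nat \<Rightarrow> real) \<Rightarrow> nat \<Rightarrow> nat \<Rightarrow> bool" where
  "monotonically_stable Ms h S ip H c d s m \<longleftrightarrow>
     (\<exists>C>0. \<forall>\<mu>\<in>Ms. \<forall>\<tau>. 0 < \<tau> \<and> \<tau> \<le> C * h \<mu> \<longrightarrow>
        (\<forall>U. rk_traj (S \<mu>) (ip \<mu>) (H \<mu>) c d s \<tau> m U \<longrightarrow>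
           sqrt (ip \<mu> (U m 0) (U m 0)) \<le> sqrt (ip \<mu> (U 0 0) (U 0 0))))"

definition weak_stable ::
  "nat \<Rightarrow> 'm set \<Rightarrow> ('m \<Rightarrow> real) \<Rightarrow> ('m \<Rightarrow> 'a set) \<Rightarrow> ('m \<Rightarrow> 'a \<Rightarrow> 'a \<Rightarrow> real) \<Rightarrow> ('m \<Rightarrow> 'a \<Rightarrow> 'a \<Rightarrow> real) \<Rightarrow>
   (nat \<Rightarrow> nat \<Rightarrow> real) \<Rightarrow> (nat \<Rightarrow> nat \<Rightarrow> real) \<Rightarrow> nat \<Rightarrow> nat \<Rightarrow> bool" where
  "weak_stable q Ms h S ip H c d s m \<longleftrightarrow>
     (\<exists>lam0>0. \<exists>C>0. \<forall>\<mu>\<in>Ms. \<forall>\<tau>. 0 < \<tau> \<and> \<tau> \<le> lam0 * h \<mu> \<and> \<tau> \<le> h \<mu> powr (1 + 1 / (real q - 1)) \<longrightarrow>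
        (\<forall>U. rk_traj (S \<mu>) (ip \<mu>) (H \<mu>) c d s \<tau> m U \<longrightarrow>
           sqrt (ip \<mu> (U m 0) (U m 0)) ^ 2 \<le> (1 + C * \<tau>) * sqrt (ip \<mu> (U 0 0) (U 0 0)) ^ 2))"

text \<open>A mesh is mu = (N, g) with g i = x_{i-1/2}, cells [g i, g (i+1)], extended periodically.\<close>
definition mesh1 :: "real \<Rightarrow> real \<Rightarrow> nat \<times> (int \<Rightarrow> real) \<Rightarrow> bool" where
  "mesh1 a P \<mu> \<longleftrightarrow> 0 < fst \<mu> \<and> strict_mono (snd \<mu>) \<and> snd \<mu> 0 = a \<and>
     (\<forall>i. snd \<mu> (i + int (fst \<mu>)) = snd \<mu> i + P)"

definition hmax1 :: "nat \<times> (int \<Rightarrow> real) \<Rightarrow> real" where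
  "hmax1 \<mu> = Max ((\<lambda>i. snd \<mu> (i+1) - snd \<mu> i) ` {0..<int (fst \<mu>)})"

definition hmin1 :: "nat \<times> (int \<Rightarrow> real) \<Rightarrow> real" where
  "hmin1 \<mu> = Min ((\<lambda>i. snd \<mu> (i+1) - snd \<mu> i) ` {0..<int (fst \<mu>)})"

definition quasi_uniform_meshes1 :: "real \<Rightarrow> real \<Rightarrow> real \<Rightarrow> (nat \<times> (int \<Rightarrow> real)) set" where
  "quasi_uniform_meshes1 a P \<sigma> = {\<mu>. mesh1 a P \<mu> \<and> \<sigma> * hmax1 \<mu> \<le> hmin1 \<mu>}"

text \<open>Cell centres x_i = (x_{i-1/2} + x_{i+1/2})/2; they are the nodes of the dual mesh.\<close>
definition centres :: "(int \<Rightarrow> real) \<Rightarrow> int \<Rightarrow> real" where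
  "centres g i = (g i + g (i+1)) / 2"

definition pw_poly1 :: "nat \<Rightarrow> (int \<Rightarrow> real) \<Rightarrow> (real \<Rightarrow> real) \<Rightarrow> bool" where
  "pw_poly1 k g u \<longleftrightarrow> (\<forall>i. \<exists>p. degree p \<le> k \<and> (\<forall>x\<in>{g i..<g (i+1)}. u x = poly p x))"

definition dg_space1 :: "nat \<Rightarrow> real \<Rightarrow> (int \<Rightarrow> real) \<Rightarrow> (real \<Rightarrow> real) set" where
  "dg_space1 k P g = {u. (\<forall>x. u (x + P) = u x) \<and> pw_poly1 k g u}"

definition S1 :: "nat \<Rightarrow> real \<Rightarrow> nat \<times> (int \<Rightarrow> real) \<Rightarrow> ((real \<Rightarrow> real) \<times> (real \<Rightarrow> real)) set" where
  "S1 k P \<mu> = dg_space1 k P (snd \<mu>) \<times> dg_space1 k P (centres (snd \<mu>))"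

definition ip1 :: "real \<Rightarrow> real \<Rightarrow> (real \<Rightarrow> real) \<times> (real \<Rightarrow> real) \<Rightarrow> (real \<Rightarrow> real) \<times> (real \<Rightarrow> real) \<Rightarrow> real" where
  "ip1 a P u \<phi> = integral {a..a+P} (\<lambda>x. fst u x * fst \<phi> x + snd u x * snd \<phi> x)"

definition H1 :: "real \<Rightarrow> real \<Rightarrow> real \<Rightarrow> real \<Rightarrow> nat \<times> (int \<Rightarrow> real) \<Rightarrow>
    (real \<Rightarrow> real) \<times> (real \<Rightarrow> real) \<Rightarrow> (real \<Rightarrow> real) \<times> (real \<Rightarrow> real) \<Rightarrow> real" where
  "H1 \<beta> Ccfl a P \<mu> u \<phi> =
     (let N = fst \<mu>; g = snd \<mu>; x = centres g; \<tau>max = Ccfl * hmax1 \<mu> / \<bar>\<beta>\<bar>;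
          u1 = fst u; u2 = snd u; \<phi>1 = fst \<phi>; \<phi>2 = snd \<phi> in
      - (1 / \<tau>max) * integral {a..a+P} (\<lambda>y. (u1 y - u2 y) * (\<phi>1 y - \<phi>2 y))
      + integral {a..a+P} (\<lambda>y. \<beta> * u2 y * deriv \<phi>1 y + \<beta> * u1 y * deriv \<phi>2 y)
      - (\<Sum>i\<in>{0..<int N}.
            \<beta> * u2 (g (i+1)) * Lim (at_left (g (i+1))) \<phi>1
          - \<beta> * u2 (g i) * Lim (at_right (g i)) \<phi>1
          + \<beta> * u1 (x (i+1)) * Lim (at_left (x (i+1))) \<phi>2
          - \<beta> * u1 (x i) * Lim (at_right (x i)) \<phi>2))"

text \<open>A mesh is mu = (Nx, Ny); hx = P1/Nx, hy = P2/Ny, x_{i-1/2} = a1 + i hx, y_{j-1/2} = a2 + j hy.\<close>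
definition grid :: "real \<Rightarrow> real \<Rightarrow> int \<Rightarrow> real" where
  "grid a h i = a + of_int i * h"

definition hmax2 :: "real \<Rightarrow> real \<Rightarrow> nat \<times> nat \<Rightarrow> real" where
  "hmax2 P1 P2 \<mu> = max (P1 / real (fst \<mu>)) (P2 / real (snd \<mu>))"

definition uniform_meshes2 :: "real \<Rightarrow> real \<Rightarrow> real \<Rightarrow> (nat \<times> nat) set" where
  "uniform_meshes2 P1 P2 \<sigma> = {\<mu>. 0 < fst \<mu> \<and> 0 < snd \<mu> \<and>
      \<sigma> * hmax2 P1 P2 \<mu> \<le> min (P1 / real (fst \<mu>)) (P2 / real (snd \<mu>))}"

definition poly2_on :: "nat \<Rightarrow> (real \<times> real \<Rightarrow> real) \<Rightarrow> (real \<times> real) set \<Rightarrow> bool" where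
  "poly2_on k u A \<longleftrightarrow> (\<exists>cf :: nat \<Rightarrow> nat \<Rightarrow> real.
      \<forall>z\<in>A. u z = (\<Sum>p\<le>k. \<Sum>q\<le>k - p. cf p q * fst z ^ p * snd z ^ q))"

definition dg_space2 :: "nat \<Rightarrow> real \<Rightarrow> real \<Rightarrow> (int \<Rightarrow> real) \<Rightarrow> (int \<Rightarrow> real) \<Rightarrow> (real \<times> real \<Rightarrow> real) set" where
  "dg_space2 k P1 P2 gx gy = {u. (\<forall>x y. u (x + P1, y) = u (x, y) \<and> u (x, y + P2) = u (x, y)) \<and>
      (\<forall>i j. poly2_on k u ({gx i..<gx (i+1)} \<times> {gy j..<gy (j+1)}))}"

definition S2 :: "nat \<Rightarrow> real \<Rightarrow> real \<Rightarrow> real \<Rightarrow> real \<Rightarrow> nat \<times> nat \<Rightarrow>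
    ((real \<times> real \<Rightarrow> real) \<times> (real \<times> real \<Rightarrow> real)) set" where
  "S2 k a1 a2 P1 P2 \<mu> =
     (let gx = grid a1 (P1 / real (fst \<mu>)); gy = grid a2 (P2 / real (snd \<mu>)) in
      dg_space2 k P1 P2 gx gy \<times> dg_space2 k P1 P2 (centres gx) (centres gy))"

definition ip2 :: "real \<Rightarrow> real \<Rightarrow> real \<Rightarrow> real \<Rightarrow>
    (real \<times> real \<Rightarrow> real) \<times> (real \<times> real \<Rightarrow> real) \<Rightarrow> (real \<times> real \<Rightarrow> real) \<times> (real \<times> real \<Rightarrow> real) \<Rightarrow> real" where
  "ip2 a1 a2 P1 P2 u \<phi> =
     integral (cbox (a1, a2) (a1 + P1, a2 + P2)) (\<lambda>z. fst u z * fst \<phi> z + snd u z * snd \<phi> z)"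

definition dx2 :: "(real \<times> real \<Rightarrow> real) \<Rightarrow> real \<times> real \<Rightarrow> real" where
  "dx2 \<phi> z = deriv (\<lambda>t. \<phi> (t, snd z)) (fst z)"

definition dy2 :: "(real \<times> real \<Rightarrow> real) \<Rightarrow> real \<times> real \<Rightarrow> real" where
  "dy2 \<phi> z = deriv (\<lambda>t. \<phi> (fst z, t)) (snd z)"

text \<open>integral over the boundary of the cell [X0,X1] x [Y0,Y1] of (beta . n) w phi, with phi the
  interior trace and n the outward normal.\<close>
definition cell_flux :: "real \<Rightarrow> real \<Rightarrow> real \<Rightarrow> real \<Rightarrow> real \<Rightarrow> real \<Rightarrow>
    (real \<times> real \<Rightarrow> real) \<Rightarrow> (real \<times> real \<Rightarrow> real) \<Rightarrow> real" where
  "cell_flux \<beta>1 \<beta>2 X0 X1 Y0 Y1 w \<phi> =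
       \<beta>1 * integral {Y0..Y1} (\<lambda>y. w (X1, y) * Lim (at_left X1) (\<lambda>t. \<phi> (t, y)))
     - \<beta>1 * integral {Y0..Y1} (\<lambda>y. w (X0, y) * Lim (at_right X0) (\<lambda>t. \<phi> (t, y)))
     + \<beta>2 * integral {X0..X1} (\<lambda>x. w (x, Y1) * Lim (at_left Y1) (\<lambda>t. \<phi> (x, t)))
     - \<beta>2 * integral {X0..X1} (\<lambda>x. w (x, Y0) * Lim (at_right Y0) (\<lambda>t. \<phi> (x, t)))"

definition H2 :: "real \<Rightarrow> real \<Rightarrow> real \<Rightarrow> real \<Rightarrow> real \<Rightarrow> real \<Rightarrow> real \<Rightarrow> nat \<times> nat \<Rightarrow>
    (real \<times> real \<Rightarrow> real) \<times> (real \<times> real \<Rightarrow> real) \<Rightarrow> (real \<times> real \<Rightarrow> real) \<times> (real \<times> real \<Rightarrow> real) \<Rightarrow> real" where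
  "H2 \<beta>1 \<beta>2 Ccfl a1 a2 P1 P2 \<mu> u \<phi> =
     (let Nx = fst \<mu>; Ny = snd \<mu>; hx = P1 / real Nx; hy = P2 / real Ny;
          gx = grid a1 hx; gy = grid a2 hy; cx = centres gx; cy = centres gy;
          \<tau>max = Ccfl / (\<bar>\<beta>1\<bar> / hx + \<bar>\<beta>2\<bar> / hy);
          u1 = fst u; u2 = snd u; \<phi>1 = fst \<phi>; \<phi>2 = snd \<phi>;
          \<Omega> = cbox (a1, a2) (a1 + P1, a2 + P2) in
      - (1 / \<tau>max) * integral \<Omega> (\<lambda>z. (u1 z - u2 z) * (\<phi>1 z - \<phi>2 z))
      + integral \<Omega> (\<lambda>z. \<beta>1 * u2 z * dx2 \<phi>1 z + \<beta>2 * u2 z * dy2 \<phi>1 z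
                        + \<beta>1 * u1 z * dx2 \<phi>2 z + \<beta>2 * u1 z * dy2 \<phi>2 z)
      - (\<Sum>i\<in>{0..<int Nx}. \<Sum>j\<in>{0..<int Ny}. cell_flux \<beta>1 \<beta>2 (gx i) (gx (i+1)) (gy j) (gy (j+1)) u2 \<phi>1)
      - (\<Sum>i\<in>{0..<int Nx}. \<Sum>j\<in>{0..<int Ny}. cell_flux \<beta>1 \<beta>2 (cx i) (cx (i+1)) (cy j) (cy (j+1)) u1 \<phi>2))"

end

theory Submission
  imports Defs
begin

text \<open>
  Write D_i for the i-th temporal difference of u^n. The CDG form is skew-symmetric up to the
  dissipation of u_1 - u_2, so <D_(i+1), D_j> + <D_i, D_(j+1)> = -2 tau [D_i, D_j] with a positive
  semidefinite form [.,.]. Each step of the matrix transferring process is this identity applied to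
  one column, hence the energy change equals
  sum a_ij <D_i, D_j> - tau sum b_ij [D_i, D_j]  (final matrices).
  Inverse inequalities give |D_(i+1)| <= C (tau/h) |D_i| and tau [D_i, D_i] <= C (tau/h) |D_i|^2.
  The positive definite leading block of B absorbs all mixed dissipation terms, and what remains is
  bounded by (a_zeta,zeta + C tau/h) |D_zeta|^2 if rho = zeta and by C (tau/h) |D_rho|^2 otherwise.

  In one dimension skew-symmetry comes from integration by parts on the half cells, on which primal
  and dual functions are polynomials. In two dimensions each of the two advection terms is an
  integral over one coordinate of the one-dimensional form in the other coordinate.
\<close>

section \<open>The matrix transferring process\<close>

text \<open>The stability half of the argument never sees a function: \<open>energy_grams\<close>
  records all it needs about the Gram matrices \<open>g\<close> and \<open>G\<close>, with a
  parameter \<open>t\<close> = 2 K \<tau> / h. Since K is the same for all meshes of a family, so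
  are the stability constants. The obstacle is that the scheme is given only by testing against the
  discrete space. The D_i therefore have to be constructed by a Riesz representation, which needs
  finite dimension. No basis of piecewise polynomials is set up for this; it is enough that point
  values are bounded by the L2 norm. Identities between functions are stated in tested form
  throughout, so null vectors of the inner product do no harm. Positive definiteness is used as a
  bound of the trace of \<open>G\<close> over the block by the pairing of \<open>B\<close> with
  \<open>G\<close>, a smallest-eigenvalue bound obtained without spectral theory. The exponents come
  from |D_i|^2 \<le> t^(2 i) |D_0|^2: this gives 2 \<zeta> directly, and 2 \<rho> + 1 when one
  factor \<open>t\<close> of the dissipation sits in front of |D_\<rho>|^2. The restriction \<tau>
  \<le> h^(1 + 1/(q - 1)) is equivalent to (\<tau>/h)^q \<le> \<tau>.\<close>

lemma mt_AB_symA: "fst (mt_AB \<alpha> M l) i j = fst (mt_AB \<alpha> M l) j i"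
  by (cases l) (auto simp: mt_A0_def mt_stepA_def)

lemma mt_AB_symB: "snd (mt_AB \<alpha> M l) i j = snd (mt_AB \<alpha> M l) j i"
  by (cases l) (auto simp: mt_stepB_def)

text \<open>The process updates only indices up to \<open>M - 1\<close>, while the energy identity
  shifts an index by one for every \<open>i \<le> M\<close>. With zeros beyond \<open>M\<close> the
  shifted entry at \<open>i = M\<close> vanishes and both rules agree.\<close>

lemma mt_AB_A_outside: "M < i \<Longrightarrow> fst (mt_AB \<alpha> M l) i j = 0"
proof (induction l arbitrary: i j)
  case (Suc l)
  have "M < i' \<Longrightarrow> fst (mt_AB \<alpha> M l) j' i' = 0" for i' j'
    using Suc.IH[of i' j'] mt_AB_symA[of \<alpha> M l] by simp
  with Suc show ?case by (auto simp: mt_stepA_def mt_stepA_low_def)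
qed (simp add: mt_A0_def)

lemma mt_AB_A_low: "j < l \<Longrightarrow> fst (mt_AB \<alpha> M l) i j = 0"
  by (cases l) (auto simp: mt_stepA_def mt_stepA_low_def)

text \<open>Each step writes only one row and column of \<open>B\<close>, so the block from
  \<open>l\<close> on still holds its initial zeros. The assignment made by the next step can thus
  be read as an addition.\<close>

lemma mt_AB_B_high: "l \<le> i \<Longrightarrow> l \<le> j \<Longrightarrow> snd (mt_AB \<alpha> M l) i j = 0"
  by (induction l arbitrary: i j) (auto simp: mt_stepB_def mt_stepB_low_def)

text \<open>One step of the process read backwards: row and column \<open>l\<close> are put back,
  together with what was subtracted from row and column \<open>Suc l\<close>. Both of the last two
  terms apply at \<open>i = j = Suc l\<close>, which is the factor 2 in the diagonal rule.
  \<open>A l l = 0\<close> lets column \<open>l\<close> be cleared without a diagonal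
  remainder.\<close>

lemma mt_AB_A_diff:
  fixes \<alpha> M l
  defines "A \<equiv> fst (mt_AB \<alpha> M l)" and "A' \<equiv> fst (mt_AB \<alpha> M (Suc l))"
  assumes "A l l = 0"
  shows "A i j = A' i j + (if j = l \<and> l < i then A i l else 0) + (if i = l \<and> l < j then A j l else 0)
    + (if j = Suc l \<and> l < i then A (Suc i) l else 0) + (if i = Suc l \<and> l < j then A (Suc j) l else 0)"
proof -
  have s: "A i j = A j i" for i j unfolding A_def by (rule mt_AB_symA)
  have o: "M < i \<Longrightarrow> A i j = 0" for i j unfolding A_def by (rule mt_AB_A_outside)
  have o': "M < i \<Longrightarrow> A j i = 0" for i j using o[of i j] s[of i j] by simp
  have z: "j < l \<Longrightarrow> A i j = 0" for i j unfolding A_def by (rule mt_AB_A_low)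
  have z': "j < l \<Longrightarrow> A j i = 0" for i j using z[of j i] s[of i j] by simp
  have A': "A' i j = mt_stepA M l A i j" for i j unfolding A_def A'_def by simp
  have M: "Suc M \<le> Suc i \<Longrightarrow> A (Suc i) l = 0" for i by (rule o) simp
  consider "j \<le> i" "j < l" | "j \<le> i" "j = l" | "j \<le> i" "j = Suc l" "i = Suc l"
    | "j \<le> i" "j = Suc l" "i \<noteq> Suc l" | "j \<le> i" "Suc l < j"
    | "i < j" "i < l" | "i < j" "i = l" | "i < j" "i = Suc l" | "i < j" "Suc l < i"
    by linarith
  then show ?thesis
  proof cases
    case 4
    then show ?thesis using M[of i] by (auto simp: A' mt_stepA_def mt_stepA_low_def)
  next
    case 8
    then show ?thesis using M[of j] s[of i j] by (auto simp: A' mt_stepA_def mt_stepA_low_def)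
  qed (use z z' s[of i j] assms(3) in \<open>auto simp: A' mt_stepA_def mt_stepA_low_def\<close>)
qed

text \<open>The written entries were zero before, so overwriting is adding. The conditions
  \<open>l \<le> i\<close> and \<open>l < j\<close> differ so that the diagonal entry is counted
  once and every other one on both sides of the diagonal.\<close>

lemma mt_AB_B_diff:
  fixes \<alpha> M l
  defines "A \<equiv> fst (mt_AB \<alpha> M l)"
  assumes "0 < M"
  shows "snd (mt_AB \<alpha> M (Suc l)) i j = snd (mt_AB \<alpha> M l) i j
    + (if j = l \<and> l \<le> i then 2 * A (Suc i) l else 0) + (if i = l \<and> l < j then 2 * A (Suc j) l else 0)"
proof -
  have o: "M < i \<Longrightarrow> A i j = 0" for i j unfolding A_def by (rule mt_AB_A_outside)
  have M: "M - Suc 0 < i \<Longrightarrow> A (Suc i) l = 0" for i by (rule o) (use assms in simp)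
  have z: "l \<le> i \<Longrightarrow> l \<le> j \<Longrightarrow> snd (mt_AB \<alpha> M l) i j = 0" for i j by (rule mt_AB_B_high)
  show ?thesis
    using M[of i] M[of j] z[of i j] z[of j i] mt_AB_symB[of \<alpha> M l i j]
    by (auto simp: mt_stepB_def mt_stepB_low_def A_def[symmetric] not_le)
qed

text \<open>Below the diagonal of column \<open>l\<close>, \<open>rel\<close> trades
  \<open>g (Suc i) l\<close> for \<open>- g i (Suc l) - 2 * G i l\<close>. The first part is what
  the step subtracts from column \<open>Suc l\<close> of \<open>A\<close>, the second is what it
  adds to \<open>B\<close>, so the combined form is invariant.\<close>

lemma mt_AB_energy_step:
  fixes g G :: "nat \<Rightarrow> nat \<Rightarrow> real"
  assumes g: "\<And>i j. g i j = g j i" and G: "\<And>i j. G i j = G j i"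
    and rel: "\<And>i j. g (Suc i) j + g i (Suc j) = - 2 * G i j"
    and 0: "fst (mt_AB \<alpha> M l) l l = 0" and l: "l < M"
  shows "(\<Sum>i\<le>M. \<Sum>j\<le>M. fst (mt_AB \<alpha> M (Suc l)) i j * g i j)
       - (\<Sum>i\<le>M. \<Sum>j\<le>M. snd (mt_AB \<alpha> M (Suc l)) i j * G i j)
      = (\<Sum>i\<le>M. \<Sum>j\<le>M. fst (mt_AB \<alpha> M l) i j * g i j)
       - (\<Sum>i\<le>M. \<Sum>j\<le>M. snd (mt_AB \<alpha> M l) i j * G i j)"
proof -
  define A where "A = fst (mt_AB \<alpha> M l)"
  define A' where "A' = fst (mt_AB \<alpha> M (Suc l))"
  define B where "B = snd (mt_AB \<alpha> M l)"
  define B' where "B' = snd (mt_AB \<alpha> M (Suc l))"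
  have l': "0 < M" using l by simp
  have oA: "A (Suc M) l = 0" unfolding A_def by (rule mt_AB_A_outside) simp
  have sA: "(\<Sum>i\<le>M. \<Sum>j\<le>M. A i j * g i j) = (\<Sum>i\<le>M. \<Sum>j\<le>M. A' i j * g i j)
      + 2 * (\<Sum>i\<le>M. if l < i then A i l * g i l else 0)
      + 2 * (\<Sum>i\<le>M. if l < i then A (Suc i) l * g i (Suc l) else 0)" (is "_ = _ + 2 * ?X + 2 * ?Y")
  proof -
    have E: "A i j * g i j = A' i j * g i j
        + (if j = l then (if l < i then A i l * g i l else 0) else 0)
        + (if i = l then (if l < j then A j l * g j l else 0) else 0)
        + (if j = Suc l then (if l < i then A (Suc i) l * g i (Suc l) else 0) else 0)
        + (if i = Suc l then (if l < j then A (Suc j) l * g j (Suc l) else 0) else 0)" for i j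
    proof -
      have e0: "A i j * g i j = (A' i j + (if j = l \<and> l < i then A i l else 0) + (if i = l \<and> l < j then A j l else 0)
        + (if j = Suc l \<and> l < i then A (Suc i) l else 0) + (if i = Suc l \<and> l < j then A (Suc j) l else 0)) * g i j"
        unfolding A_def A'_def by (rule arg_cong[OF mt_AB_A_diff[OF 0]])
      have e1: "(if i = l \<and> l < j then A j l else 0) * g i j = (if i = l then (if l < j then A j l * g j l else 0) else 0)"
        using g[of i j] by simp
      have e2: "(if i = Suc l \<and> l < j then A (Suc j) l else 0) * g i j = (if i = Suc l then (if l < j then A (Suc j) l * g j (Suc l) else 0) else 0)"
        using g[of i j] by simp
      have e3: "(if j = l \<and> l < i then A i l else 0) * g i j = (if j = l then (if l < i then A i l * g i l else 0) else 0)"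
        "(if j = Suc l \<and> l < i then A (Suc i) l else 0) * g i j = (if j = Suc l then (if l < i then A (Suc i) l * g i (Suc l) else 0) else 0)"
        by simp_all
      show ?thesis by (subst e0) (simp only: distrib_right e1 e2 e3)
    qed
    have "(\<Sum>i\<le>M. \<Sum>j\<le>M. A i j * g i j) = (\<Sum>i\<le>M. \<Sum>j\<le>M. A' i j * g i j
        + (if j = l then (if l < i then A i l * g i l else 0) else 0)
        + (if i = l then (if l < j then A j l * g j l else 0) else 0)
        + (if j = Suc l then (if l < i then A (Suc i) l * g i (Suc l) else 0) else 0)
        + (if i = Suc l then (if l < j then A (Suc j) l * g j (Suc l) else 0) else 0))"
      by (intro sum.cong refl E)
    also have "\<dots> = (\<Sum>i\<le>M. \<Sum>j\<le>M. A' i j * g i j)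
        + (\<Sum>i\<le>M. \<Sum>j\<le>M. if j = l then (if l < i then A i l * g i l else 0) else 0)
        + (\<Sum>j\<le>M. \<Sum>i\<le>M. if i = l then (if l < j then A j l * g j l else 0) else 0)
        + (\<Sum>i\<le>M. \<Sum>j\<le>M. if j = Suc l then (if l < i then A (Suc i) l * g i (Suc l) else 0) else 0)
        + (\<Sum>j\<le>M. \<Sum>i\<le>M. if i = Suc l then (if l < j then A (Suc j) l * g j (Suc l) else 0) else 0)"
      by (subst (3 5) sum.swap) (simp only: sum.distrib)
    finally show ?thesis
      using l by (simp add: sum.delta Suc_le_eq)
  qed
  have sB: "(\<Sum>i\<le>M. \<Sum>j\<le>M. B' i j * G i j) = (\<Sum>i\<le>M. \<Sum>j\<le>M. B i j * G i j)
      + (\<Sum>i\<le>M. if l \<le> i then 2 * A (Suc i) l * G i l else 0)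
      + (\<Sum>i\<le>M. if l < i then 2 * A (Suc i) l * G i l else 0)" (is "_ = _ + ?Z + ?W")
  proof -
    have E: "B' i j * G i j = B i j * G i j
        + (if j = l then (if l \<le> i then 2 * A (Suc i) l * G i l else 0) else 0)
        + (if i = l then (if l < j then 2 * A (Suc j) l * G j l else 0) else 0)" for i j
      using G[of i j] l unfolding B'_def mt_AB_B_diff[of M \<alpha> l i j, OF l'] A_def[symmetric] B_def[symmetric]
      by (auto simp: algebra_simps)
    have "(\<Sum>i\<le>M. \<Sum>j\<le>M. B' i j * G i j) = (\<Sum>i\<le>M. \<Sum>j\<le>M. B i j * G i j
        + (if j = l then (if l \<le> i then 2 * A (Suc i) l * G i l else 0) else 0)
        + (if i = l then (if l < j then 2 * A (Suc j) l * G j l else 0) else 0))"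
      by (intro sum.cong refl E)
    also have "\<dots> = (\<Sum>i\<le>M. \<Sum>j\<le>M. B i j * G i j)
        + (\<Sum>i\<le>M. \<Sum>j\<le>M. if j = l then (if l \<le> i then 2 * A (Suc i) l * G i l else 0) else 0)
        + (\<Sum>j\<le>M. \<Sum>i\<le>M. if i = l then (if l < j then 2 * A (Suc j) l * G j l else 0) else 0)"
      by (subst (3) sum.swap) (simp only: sum.distrib)
    finally show ?thesis
      using l by (simp add: sum.delta Suc_le_eq)
  qed
  \<comment> \<open>Summing one index further adds nothing by \<open>oA\<close>, and makes room for
    the shift from \<open>i\<close> to \<open>Suc i\<close>. The term \<open>i = l\<close> is kept
    apart: there \<open>rel\<close> pairs an entry with its own mirror image and expresses it by
    \<open>G l l\<close> alone.\<close>
  have X: "?X = A (Suc l) l * g (Suc l) l + (\<Sum>i\<le>M. if l < i then A (Suc i) l * g (Suc i) l else 0)"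
  proof -
    have "?X = (\<Sum>i\<le>Suc M. if l < i then A i l * g i l else 0)"
      using oA by simp
    also have "\<dots> = (\<Sum>i\<le>M. if l \<le> i then A (Suc i) l * g (Suc i) l else 0)"
      by (subst sum.atMost_Suc_shift) (simp add: less_Suc_eq_le)
    also have "\<dots> = (\<Sum>i\<le>M. (if i = l then A (Suc l) l * g (Suc l) l else 0) + (if l < i then A (Suc i) l * g (Suc i) l else 0))"
      by (intro sum.cong) auto
    finally show ?thesis using l by (simp add: sum.distrib)
  qed
  have Z: "?Z = 2 * A (Suc l) l * G l l + ?W"
  proof -
    have "?Z = (\<Sum>i\<le>M. (if i = l then 2 * A (Suc l) l * G l l else 0) + (if l < i then 2 * A (Suc i) l * G i l else 0))"
      by (intro sum.cong) auto
    then show ?thesis using l by (simp add: sum.distrib)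
  qed
  have gl: "g (Suc l) l = - G l l" using rel[of l l] g[of l "Suc l"] by simp
  have "(\<Sum>i\<le>M. if l < i then A (Suc i) l * g (Suc i) l else 0) + ?Y = - ?W"
    unfolding sum.distrib[symmetric] sum_negf[symmetric]
  proof (intro sum.cong refl)
    fix i
    have "A (Suc i) l * g (Suc i) l + A (Suc i) l * g i (Suc l) = - (2 * A (Suc i) l * G i l)"
      using rel[of i l] by (simp add: distrib_left[symmetric])
    then show "(if l < i then A (Suc i) l * g (Suc i) l else 0) + (if l < i then A (Suc i) l * g i (Suc l) else 0)
      = - (if l < i then 2 * A (Suc i) l * G i l else 0)" by simp
  qed
  then show ?thesis
    unfolding A_def[symmetric] A'_def[symmetric] B_def[symmetric] B'_def[symmetric] sA sB X Z gl
    by (simp add: algebra_simps)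
qed

text \<open>Iterates the invariance. The initial matrix has its entry (0, 0) removed, so the energy
  of the starting value appears as a separate term.\<close>

lemma mt_AB_energy:
  fixes g G :: "nat \<Rightarrow> nat \<Rightarrow> real"
  assumes g: "\<And>i j. g i j = g j i" and G: "\<And>i j. G i j = G j i"
    and rel: "\<And>i j. g (Suc i) j + g i (Suc j) = - 2 * G i j"
    and 0: "\<And>l. l < n \<Longrightarrow> fst (mt_AB \<alpha> M l) l l = 0" and n: "n \<le> M"
  shows "(\<Sum>i\<le>M. \<Sum>j\<le>M. \<alpha> i * \<alpha> j * g i j) = (\<alpha> 0)\<^sup>2 * g 0 0
       + (\<Sum>i\<le>M. \<Sum>j\<le>M. fst (mt_AB \<alpha> M n) i j * g i j)
       - (\<Sum>i\<le>M. \<Sum>j\<le>M. snd (mt_AB \<alpha> M n) i j * G i j)"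
  using 0 n
proof (induction n)
  case 0
  have "\<alpha> i * \<alpha> j * g i j = mt_A0 \<alpha> M i j * g i j + (if j = 0 then if i = 0 then (\<alpha> 0)\<^sup>2 * g 0 0 else 0 else 0)"
    if "i \<le> M" "j \<le> M" for i j
    using that by (auto simp: mt_A0_def power2_eq_square)
  then have "(\<Sum>i\<le>M. \<Sum>j\<le>M. \<alpha> i * \<alpha> j * g i j) = (\<Sum>i\<le>M. \<Sum>j\<le>M. mt_A0 \<alpha> M i j * g i j
       + (if j = 0 then if i = 0 then (\<alpha> 0)\<^sup>2 * g 0 0 else 0 else 0))"
    by (intro sum.cong refl) auto
  then show ?case by (simp add: sum.distrib)
next
  case (Suc n)
  then show ?case
    using mt_AB_energy_step[of g G \<alpha> M n] g G rel by simp
qed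

section \<open>Positive semidefinite Gram matrices and energy estimates\<close>

definition psd_gram :: "(nat \<Rightarrow> nat \<Rightarrow> real) \<Rightarrow> bool" where
  "psd_gram G \<longleftrightarrow> (\<forall>i j. G i j = G j i) \<and> (\<forall>n c. 0 \<le> (\<Sum>i<n. \<Sum>j<n. c i * c j * G i j))"

lemma psd_gram_sym: "psd_gram G \<Longrightarrow> G i j = G j i"
  unfolding psd_gram_def by blast

lemma psd_gram_pair:
  assumes "psd_gram G"
  shows "0 \<le> x\<^sup>2 * G i i + 2 * (x * y * G i j) + y\<^sup>2 * G j j"
proof -
  define n where "n = Suc (max i j)"
  \<comment> \<open>The two coefficients are added, so \<open>i = j\<close> needs no separate
    treatment.\<close>
  define v where "v k = (if k = i then x else 0) + (if k = j then y else 0)" for k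
  have d: "(\<Sum>k<n. v k * f k) = x * f i + y * f j" for f :: "nat \<Rightarrow> real"
  proof -
    have "v k * f k = (if k = i then x * f i else 0) + (if k = j then y * f j else 0)" for k
      by (auto simp: v_def algebra_simps)
    then show ?thesis by (simp add: sum.distrib n_def less_Suc_eq_le)
  qed
  have "0 \<le> (\<Sum>k<n. \<Sum>l<n. v k * v l * G k l)" using assms unfolding psd_gram_def by blast
  also have "\<dots> = (\<Sum>k<n. v k * (\<Sum>l<n. v l * G k l))" by (simp add: sum_distrib_left mult_ac)
  also have "\<dots> = x\<^sup>2 * G i i + 2 * (x * y * G i j) + y\<^sup>2 * G j j"
    unfolding d using psd_gram_sym[OF assms, of i j] by (simp add: power2_eq_square algebra_simps)
  finally show ?thesis .
qed

lemma psd_gram_diag: "psd_gram G \<Longrightarrow> 0 \<le> G i i"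
  using psd_gram_pair[of G 1 i 0 i] by simp

text \<open>The discriminant argument for a 2 by 2 minor, with multipliers that leave one diagonal
  entry as a common factor. If both diagonal entries vanish, the test vector
  \<open>(1, - G i j)\<close> forces \<open>G i j = 0\<close>.\<close>

lemma psd_gram_CS:
  assumes "psd_gram G"
  shows "\<bar>G i j\<bar> \<le> sqrt (G i i) * sqrt (G j j)"
proof -
  note q = psd_gram_pair[OF assms, of _ i _ j]
  have nn: "0 \<le> G i i" "0 \<le> G j j" using psd_gram_diag[OF assms] by auto
  have "(G i j)\<^sup>2 \<le> G i i * G j j"
  proof (cases "G i i = 0 \<and> G j j = 0")
    case True
    then show ?thesis using q[of 1 "- G i j"] by (simp add: power2_eq_square)
  next
    case False
    have "0 \<le> G i i * (G i i * G j j - (G i j)\<^sup>2)" "0 \<le> G j j * (G i i * G j j - (G i j)\<^sup>2)"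
      using q[of "- G i j" "G i i"] q[of "G j j" "- G i j"] by (simp_all add: power2_eq_square algebra_simps)
    then show ?thesis using False nn by (auto simp: zero_le_mult_iff)
  qed
  then have "sqrt ((G i j)\<^sup>2) \<le> sqrt (G i i * G j j)" by (rule real_sqrt_le_mono)
  then show ?thesis by (simp add: real_sqrt_mult)
qed

text \<open>Induction over Schur complements.\<close>

lemma pos_def_lead_psd_trace:
  assumes "\<And>i j. B i j = B j i" and "pos_def_lead B \<kappa>"
  shows "\<exists>C>0. \<forall>G. psd_gram G \<longrightarrow> (\<Sum>i<\<kappa>. G i i) \<le> C * (\<Sum>i<\<kappa>. \<Sum>j<\<kappa>. B i j * (G i j :: real))"
  using assms
proof (induction \<kappa> arbitrary: B)
  case 0
  show ?case by (intro exI[of _ 1]) auto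
next
  case (Suc n)
  define b where "b = B n n"
  have expand: "(\<Sum>i<Suc n. \<Sum>j<Suc n. f i j) = (\<Sum>i<n. \<Sum>j<n. f i j) + (\<Sum>i<n. f i n + f n i) + f n n"
    for f :: "nat \<Rightarrow> nat \<Rightarrow> real"
    by (simp add: sum.distrib)
  have b: "b > 0"
  proof -
    have "0 < (\<Sum>i<Suc n. \<Sum>j<Suc n. (if i = n then 1 else 0) * B i j * (if j = n then 1 else 0))"
      using Suc.prems(2)[unfolded pos_def_lead_def, rule_format, of "\<lambda>i. if i = n then 1 else 0"] by auto
    then show ?thesis unfolding expand b_def by simp
  qed
  \<comment> \<open>The Schur complement of the last diagonal entry: \<open>B\<close> is
    \<open>b\<close> times the rank-one matrix of \<open>c\<close>, plus \<open>S\<close> extended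
    by zero.\<close>
  define S where "S i j = B i j - B i n * B j n / b" for i j
  define c where "c i = B i n / b" for i
  have sym: "B i j = B j i" for i j by (rule Suc.prems(1))
  have cb: "B n i = b * c i" "B i n = b * c i" for i using b sym[of n i] by (auto simp: c_def)
  have split: "(\<Sum>i<Suc n. \<Sum>j<Suc n. B i j * G i j)
      = b * (\<Sum>i<Suc n. \<Sum>j<Suc n. c i * c j * G i j) + (\<Sum>i<n. \<Sum>j<n. S i j * G i j)"
    if "\<And>i j. G i j = G j i" for G
  proof -
    have cn: "c n = 1" using b by (simp add: c_def b_def)
    have 1: "(\<Sum>i<n. B i n * G i n + B n i * G n i) = b * (\<Sum>i<n. c i * c n * G i n + c n * c i * G n i)"
      unfolding sum_distrib_left cb cn by (simp add: algebra_simps)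
    have 2: "(\<Sum>i<n. \<Sum>j<n. B i j * G i j) = b * (\<Sum>i<n. \<Sum>j<n. c i * c j * G i j) + (\<Sum>i<n. \<Sum>j<n. S i j * G i j)"
      unfolding sum_distrib_left sum.distrib[symmetric]
      by (intro sum.cong refl) (use b in \<open>simp add: S_def c_def field_simps\<close>)
    show ?thesis unfolding expand 1 2 cn by (simp add: b_def algebra_simps)
  qed
  have "pos_def_lead S n"
    unfolding pos_def_lead_def
  proof safe
    fix x :: "nat \<Rightarrow> real" and i assume i: "i < n" "x i \<noteq> 0"
    \<comment> \<open>The last coordinate makes \<open>y\<close> orthogonal to \<open>c\<close>,
      since \<open>c n = 1\<close>. The rank-one part then vanishes, and positivity of
      \<open>B\<close> at \<open>y\<close> becomes positivity of \<open>S\<close> at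
      \<open>x\<close>.\<close>
    define y where "y i = (if i = n then - (\<Sum>j<n. c j * x j) else x i)" for i
    have "\<exists>i<Suc n. y i \<noteq> 0" using i by (intro exI[of _ i]) (auto simp: y_def)
    then have "0 < (\<Sum>i<Suc n. \<Sum>j<Suc n. y i * B i j * y j)"
      using Suc.prems(2) unfolding pos_def_lead_def by blast
    also have "\<dots> = (\<Sum>i<Suc n. \<Sum>j<Suc n. B i j * (y i * y j))" by (simp add: mult_ac)
    also have "\<dots> = b * (\<Sum>i<Suc n. \<Sum>j<Suc n. c i * c j * (y i * y j)) + (\<Sum>i<n. \<Sum>j<n. S i j * (y i * y j))"
      by (rule split) simp
    also have "(\<Sum>i<Suc n. \<Sum>j<Suc n. c i * c j * (y i * y j)) = (\<Sum>i<Suc n. c i * y i) * (\<Sum>i<Suc n. c i * y i)"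
      by (subst sum_product) (simp add: mult_ac)
    also have "(\<Sum>i<Suc n. c i * y i) = 0" using b by (simp add: y_def c_def b_def)
    also have "(\<Sum>i<n. \<Sum>j<n. S i j * (y i * y j)) = (\<Sum>i<n. \<Sum>j<n. x i * S i j * x j)"
      by (intro sum.cong) (auto simp: y_def)
    finally show "0 < (\<Sum>i<n. \<Sum>j<n. x i * S i j * x j)" by simp
  qed
  moreover have "S i j = S j i" for i j using sym[of i j] by (simp add: S_def)
  ultimately obtain C where C: "C > 0" and
    CG: "\<And>G. psd_gram G \<Longrightarrow> (\<Sum>i<n. G i i) \<le> C * (\<Sum>i<n. \<Sum>j<n. S i j * G i j)"
    using Suc.IH[of S] by blast
  define m where "m = 2 * (n + 1) * (\<Sum>i<n. (c i)\<^sup>2)"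
  define D where "D = C + 2 / b + 2 * m * C"
  have m: "0 \<le> m" unfolding m_def by (intro mult_nonneg_nonneg sum_nonneg) auto
  have "(\<Sum>i<Suc n. G i i) \<le> D * (\<Sum>i<Suc n. \<Sum>j<Suc n. B i j * G i j)"
    if G: "psd_gram G" for G
  proof -
    define q where "q c = (\<Sum>i<Suc n. \<Sum>j<Suc n. c i * c j * G i j)" for c
    define T where "T = (\<Sum>i<Suc n. \<Sum>j<Suc n. B i j * G i j)"
    define V where "V = (\<Sum>i<n. \<Sum>j<n. S i j * G i j)"
    have q0: "0 \<le> q c" for c using G unfolding q_def psd_gram_def by blast
    note Gii = psd_gram_diag[OF G]
    have T: "T = b * q c + V" unfolding T_def q_def V_def using split psd_gram_sym[OF G] by blast
    have s: "(\<Sum>i<n. G i i) \<le> C * V" unfolding V_def using CG G by blast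
    have s0: "0 \<le> (\<Sum>i<n. G i i)" using Gii by (rule sum_nonneg)
    have V0: "0 \<le> V" using s s0 C by (smt (verit) zero_le_mult_iff)
    have VT: "V \<le> T" and qT: "q c \<le> T / b" using T V0 b q0[of c] by (auto simp: field_simps)
    \<comment> \<open>\<open>c - c'\<close> is the last unit vector, so the parallelogram identity
      bounds \<open>G n n\<close> by \<open>q c\<close>, which the rank-one part controls, and
      \<open>q c'\<close>, which the trace of the smaller block controls.\<close>
    define c' where "c' i = (if i = n then 0 else c i)" for i
    have cn: "c n = 1" using b by (simp add: c_def b_def)
    have par: "q (\<lambda>i. c i - c' i) + q (\<lambda>i. c i + c' i) = 2 * q c + 2 * q c'"
      unfolding q_def by (simp add: sum_distrib_left sum.distrib[symmetric] algebra_simps del: sum.lessThan_Suc)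
    have "q (\<lambda>i. c i - c' i) = G n n"
      unfolding q_def expand by (simp add: c'_def cn)
    then have 1: "G n n \<le> 2 * q c + 2 * q c'" using par q0[of "\<lambda>i. c i + c' i"] by simp
    have "q c' = (\<Sum>i<n. \<Sum>j<n. c i * c j * G i j)"
      unfolding q_def expand by (simp add: c'_def)
    also have "\<dots> \<le> (\<Sum>i<n. \<Sum>j<n. (c i)\<^sup>2 * G i i + (c j)\<^sup>2 * G j j)"
    proof (intro sum_mono)
      fix i j
      have "2 * (c i * c j * G i j) \<le> (c i)\<^sup>2 * G i i + (c j)\<^sup>2 * G j j"
        using psd_gram_pair[OF G, of "c i" i "- c j" j] by simp
      moreover have "0 \<le> (c i)\<^sup>2 * G i i + (c j)\<^sup>2 * G j j" using Gii by simp
      ultimately show "c i * c j * G i j \<le> (c i)\<^sup>2 * G i i + (c j)\<^sup>2 * G j j" by linarith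
    qed
    also have "\<dots> = 2 * n * (\<Sum>i<n. (c i)\<^sup>2 * G i i)"
      by (simp add: sum.distrib sum_distrib_left mult.assoc)
    also have "\<dots> \<le> 2 * n * ((\<Sum>i<n. (c i)\<^sup>2) * (\<Sum>i<n. G i i))"
    proof (intro mult_left_mono)
      show "(\<Sum>i<n. (c i)\<^sup>2 * G i i) \<le> (\<Sum>i<n. (c i)\<^sup>2) * (\<Sum>i<n. G i i)"
        unfolding sum_distrib_left
        by (intro sum_mono mult_right_mono member_le_sum) (use Gii in auto)
    qed simp
    also have "\<dots> \<le> m * (\<Sum>i<n. G i i)"
    proof -
      have "0 \<le> (\<Sum>i<n. (c i)\<^sup>2) * (\<Sum>i<n. G i i)" using Gii by (intro mult_nonneg_nonneg sum_nonneg) auto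
      then show ?thesis unfolding m_def by (simp add: algebra_simps)
    qed
    also have "\<dots> \<le> m * (C * T)"
      using s VT C m by (intro mult_left_mono) (auto intro: order_trans)
    finally have "G n n \<le> 2 / b * T + 2 * m * C * T" using 1 qT by simp
    moreover have "(\<Sum>i<n. G i i) \<le> C * T" using s VT C by (auto intro: order_trans)
    ultimately show ?thesis unfolding D_def T_def[symmetric] by (simp add: algebra_simps)
  qed
  moreover have "D > 0" unfolding D_def using C b m by (simp add: add_pos_nonneg)
  ultimately show ?case by blast
qed

text \<open>Here g i j stands for <D_i, D_j>, G i j for tau [D_i, D_j], and t for a multiple of tau/h.\<close>

definition energy_grams :: "real \<Rightarrow> (nat \<Rightarrow> nat \<Rightarrow> real) \<Rightarrow> (nat \<Rightarrow> nat \<Rightarrow> real) \<Rightarrow> bool" where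
  "energy_grams t g G \<longleftrightarrow> psd_gram g \<and> psd_gram G \<and>
     (\<forall>i j. g (Suc i) j + g i (Suc j) = - 2 * G i j) \<and>
     (\<forall>i. g (Suc i) (Suc i) \<le> t\<^sup>2 * g i i) \<and> (\<forall>i. G i i \<le> t * g i i)"

lemma energy_grams_decay:
  assumes "energy_grams t g G" and "\<gamma> \<le> i"
  shows "g i i \<le> (t ^ (i - \<gamma>))\<^sup>2 * g \<gamma> \<gamma>"
  using \<open>\<gamma> \<le> i\<close>
proof (induction i rule: dec_induct)
  case (step n)
  have "g (Suc n) (Suc n) \<le> t\<^sup>2 * g n n" using assms unfolding energy_grams_def by blast
  also have "\<dots> \<le> t\<^sup>2 * ((t ^ (n - \<gamma>))\<^sup>2 * g \<gamma> \<gamma>)" using step.IH by (intro mult_left_mono) auto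
  also have "\<dots> = (t ^ (Suc n - \<gamma>))\<^sup>2 * g \<gamma> \<gamma>"
    using step.hyps by (simp add: Suc_diff_le power_mult_distrib)
  finally show ?case .
qed simp

text \<open>All rows and columns before \<zeta> are cleared, so every pair other than (\<zeta>,
  \<zeta>) exceeds it by at least one index in total. Cauchy-Schwarz and the decay of the diagonal
  of \<open>g\<close> turn this excess into a factor \<open>t\<close>.\<close>

lemma energy_A_bound:
  assumes A: "\<And>i j. j < \<zeta> \<Longrightarrow> A i j = 0" "\<And>i j. A i j = A j i" and "\<zeta> \<le> M"
  shows "\<exists>C\<ge>0. \<forall>t g G. energy_grams t g G \<and> 0 \<le> t \<and> t \<le> 1 \<longrightarrow>
    (\<Sum>i\<le>M. \<Sum>j\<le>M. A i j * g i j) \<le> (A \<zeta> \<zeta> + C * t) * g \<zeta> \<zeta>"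
proof (intro exI[of _ "\<Sum>i\<le>M. \<Sum>j\<le>M. \<bar>A i j\<bar>"] conjI allI impI; (elim conjE)?)
  fix t :: real and g G :: "nat \<Rightarrow> nat \<Rightarrow> real"
  assume eg: "energy_grams t g G" and t: "0 \<le> t" "t \<le> 1"
  have g: "psd_gram g" using eg by (simp add: energy_grams_def)
  note g0 = psd_gram_diag[OF g]
  have A': "A i j = 0" if "i < \<zeta>" for i j using A(1)[OF that, of j] A(2)[of i j] by simp
  have "A i j * g i j \<le> (if i = \<zeta> then if j = \<zeta> then A \<zeta> \<zeta> * g \<zeta> \<zeta> else 0 else 0) + \<bar>A i j\<bar> * (t * g \<zeta> \<zeta>)" for i j
  proof (cases "i < \<zeta> \<or> j < \<zeta> \<or> (i = \<zeta> \<and> j = \<zeta>)")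
    case True
    then show ?thesis using A(1)[of j i] A'[of i j] t g0[of \<zeta>] by auto
  next
    case False
    then have ij: "\<zeta> \<le> i" "\<zeta> \<le> j" "1 \<le> (i - \<zeta>) + (j - \<zeta>)" by auto
    have sq: "sqrt (g i i) \<le> t ^ (i - \<zeta>) * sqrt (g \<zeta> \<zeta>)" if "\<zeta> \<le> i" for i
      using real_sqrt_le_mono[OF energy_grams_decay[OF eg that]] t by (simp add: real_sqrt_mult)
    have "\<bar>g i j\<bar> \<le> sqrt (g i i) * sqrt (g j j)" by (rule psd_gram_CS[OF g])
    also have "\<dots> \<le> (t ^ (i - \<zeta>) * sqrt (g \<zeta> \<zeta>)) * (t ^ (j - \<zeta>) * sqrt (g \<zeta> \<zeta>))"
      using ij t g0 by (intro mult_mono sq) auto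
    also have "\<dots> = t ^ ((i - \<zeta>) + (j - \<zeta>)) * g \<zeta> \<zeta>"
      using g0[of \<zeta>] by (simp add: power_add)
    also have "\<dots> \<le> t ^ 1 * g \<zeta> \<zeta>"
      using ij t g0 by (intro mult_right_mono power_decreasing) auto
    finally have "\<bar>A i j\<bar> * \<bar>g i j\<bar> \<le> \<bar>A i j\<bar> * (t * g \<zeta> \<zeta>)" by (intro mult_left_mono) auto
    moreover have "A i j * g i j \<le> \<bar>A i j\<bar> * \<bar>g i j\<bar>" unfolding abs_mult[symmetric] by simp
    ultimately show ?thesis using False by (auto intro: order_trans)
  qed
  then have "(\<Sum>i\<le>M. \<Sum>j\<le>M. A i j * g i j) \<le>
    (\<Sum>i\<le>M. \<Sum>j\<le>M. (if i = \<zeta> then if j = \<zeta> then A \<zeta> \<zeta> * g \<zeta> \<zeta> else 0 else 0) + \<bar>A i j\<bar> * (t * g \<zeta> \<zeta>))"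
    by (intro sum_mono)
  also have "\<dots> = A \<zeta> \<zeta> * g \<zeta> \<zeta> + (\<Sum>i\<le>M. \<Sum>j\<le>M. \<bar>A i j\<bar>) * (t * g \<zeta> \<zeta>)"
    unfolding sum.distrib sum_distrib_right
    by (subst sum.swap) (use \<open>\<zeta> \<le> M\<close> in simp)
  finally show "(\<Sum>i\<le>M. \<Sum>j\<le>M. A i j * g i j) \<le> (A \<zeta> \<zeta> + (\<Sum>i\<le>M. \<Sum>j\<le>M. \<bar>A i j\<bar>) * t) * g \<zeta> \<zeta>"
    by (simp add: algebra_simps)
qed (auto intro!: sum_nonneg)

text \<open>The leading block bounds the trace of \<open>G\<close> below \<gamma>. An entry outside
  the block has at least one index from \<gamma> on, so Young's inequality charges it to that trace
  with a small weight and to the tail with a large one; each tail entry is at most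
  \<open>t * g \<gamma> \<gamma>\<close>.\<close>

lemma energy_B_bound:
  assumes B: "\<And>i j. B i j = B j i" and pd: "pos_def_lead B \<gamma>" and "\<gamma> \<le> M"
  shows "\<exists>C\<ge>0. \<forall>t g G. energy_grams t g G \<and> 0 \<le> t \<and> t \<le> 1 \<longrightarrow>
    - (C * t * g \<gamma> \<gamma>) \<le> (\<Sum>i\<le>M. \<Sum>j\<le>M. B i j * G i j)"
proof -
  obtain C0 where C0: "C0 > 0" and
    CG: "\<And>G. psd_gram G \<Longrightarrow> (\<Sum>i<\<gamma>. G i i) \<le> C0 * (\<Sum>i<\<gamma>. \<Sum>j<\<gamma>. B i j * G i j)"
    using pos_def_lead_psd_trace[OF B pd] by blast
  define b where "b = (\<Sum>i\<le>M. \<Sum>j\<le>M. \<bar>B i j\<bar>)"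
  have b0: "0 \<le> b" unfolding b_def by (intro sum_nonneg) auto
  have bb: "\<bar>B i j\<bar> \<le> b" if "i \<le> M" "j \<le> M" for i j
  proof -
    have "\<bar>B i j\<bar> \<le> (\<Sum>j\<le>M. \<bar>B i j\<bar>)" using that by (intro member_le_sum) auto
    also have "\<dots> \<le> b" unfolding b_def
      by (rule member_le_sum[where f = "\<lambda>i. \<Sum>j\<le>M. \<bar>B i j\<bar>"]) (use that in \<open>auto intro!: sum_nonneg\<close>)
    finally show ?thesis .
  qed
  \<comment> \<open>Small enough for the head share of all off-block terms,
    \<open>2 * b * (M + 1) * \<delta> * T\<close>, to be absorbed by \<open>T / C0\<close>. The
    summand 1 keeps \<delta> at most 1.\<close>
  define \<delta> where "\<delta> = 1 / (1 + C0 * (2 * b * (M + 1)))"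
  have den: "1 + C0 * (2 * b * (M + 1)) \<ge> 1" using C0 b0 by simp
  then have \<delta>: "0 < \<delta>" "\<delta> \<le> 1" by (auto simp: \<delta>_def)
  have \<delta>b: "2 * b * (M + 1) * \<delta> \<le> 1 / C0"
    using den C0 by (simp add: \<delta>_def field_simps)
  define C where "C = 2 * b * (M + 1) / \<delta> * (M + 1)"
  have "0 \<le> C" using b0 \<delta> by (simp add: C_def)
  moreover have "- (C * t * g \<gamma> \<gamma>) \<le> (\<Sum>i\<le>M. \<Sum>j\<le>M. B i j * G i j)"
    if eg: "energy_grams t g G" and t: "0 \<le> t" "t \<le> 1" for t g G
  proof -
    have g: "psd_gram g" and G: "psd_gram G" using eg by (auto simp: energy_grams_def)
    note g0 = psd_gram_diag[OF g] and G0 = psd_gram_diag[OF G]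
    \<comment> \<open>Head and tail of the diagonal of \<open>G\<close>, extended by zero so that
      one formula covers all index pairs.\<close>
    define w where "w i = (if i < \<gamma> then G i i else 0)" for i
    define v where "v i = (if i < \<gamma> then 0 else G i i)" for i
    have wv: "0 \<le> w i" "0 \<le> v i" for i using G0 by (auto simp: w_def v_def)
    have young: "2 * \<bar>G i j\<bar> \<le> \<delta> * G i i + 1 / \<delta> * G j j" for i j
    proof -
      have "0 \<le> (sqrt \<delta>)\<^sup>2 * G i i + 2 * (sqrt \<delta> * (1 / sqrt \<delta>) * G i j) + (1 / sqrt \<delta>)\<^sup>2 * G j j"
        "0 \<le> (sqrt \<delta>)\<^sup>2 * G i i + 2 * (sqrt \<delta> * (- 1 / sqrt \<delta>) * G i j) + (- 1 / sqrt \<delta>)\<^sup>2 * G j j"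
        by (rule psd_gram_pair[OF G])+
      then show ?thesis using \<delta> by (simp add: power_divide)
    qed
    have \<delta>1: "1 \<le> 1 / \<delta>" using \<delta> by simp
    have off: "- (b * (\<delta> * (w i + w j) + 1 / \<delta> * (v i + v j))) \<le> B i j * G i j - (if i < \<gamma> \<and> j < \<gamma> then B i j * G i j else 0)"
      if ij: "i \<le> M" "j \<le> M" for i j
    proof (cases "i < \<gamma> \<and> j < \<gamma>")
      case True
      have "0 \<le> b * (\<delta> * (w i + w j) + 1 / \<delta> * (v i + v j))"
        using b0 \<delta> wv by (intro mult_nonneg_nonneg add_nonneg_nonneg) auto
      then show ?thesis using True by simp
    next
      case False
      have *: "\<delta> * G i i \<le> \<delta> * w i + 1 / \<delta> * v i" for i
      proof -
        have "\<delta> * G i i \<le> 1 / \<delta> * G i i" using order_trans[OF \<delta>(2) \<delta>1] G0 by (intro mult_right_mono) auto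
        then show ?thesis by (auto simp: w_def v_def)
      qed
      have **: "\<bar>G i j\<bar> \<le> \<delta> * (w i + w j) + 1 / \<delta> * (v i + v j)"
      proof (cases "j < \<gamma>")
        case False
        then have "2 * \<bar>G i j\<bar> \<le> \<delta> * w i + 1 / \<delta> * v i + 1 / \<delta> * v j"
          using young[of i j] *[of i] by (simp add: v_def)
        moreover have "0 \<le> \<delta> * w j" using wv \<delta> by simp
        ultimately show ?thesis unfolding distrib_left using abs_ge_zero[of "G i j"] by linarith
      next
        case True
        then have "i \<ge> \<gamma>" using False by simp
        then have "2 * \<bar>G i j\<bar> \<le> \<delta> * w j + 1 / \<delta> * v j + 1 / \<delta> * v i"
          using young[of j i] *[of j] psd_gram_sym[OF G, of i j] by (simp add: v_def)
        moreover have "0 \<le> \<delta> * w i" using wv \<delta> by simp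
        ultimately show ?thesis unfolding distrib_left using abs_ge_zero[of "G i j"] by linarith
      qed
      have "\<bar>B i j * G i j\<bar> \<le> b * (\<delta> * (w i + w j) + 1 / \<delta> * (v i + v j))"
        unfolding abs_mult using ij b0 by (intro mult_mono bb **) auto
      then show ?thesis using False by auto
    qed
    have cut: "(\<Sum>i\<le>M. \<Sum>j\<le>M. if i < \<gamma> \<and> j < \<gamma> then f i j else 0) = (\<Sum>i<\<gamma>. \<Sum>j<\<gamma>. f i j)" for f :: "nat \<Rightarrow> nat \<Rightarrow> real"
    proof -
      have 1: "(\<Sum>i\<le>M. if i < \<gamma> then h i else 0) = (\<Sum>i<\<gamma>. h i)" for h :: "nat \<Rightarrow> real"
        by (rule sum.mono_neutral_cong_right) (use \<open>\<gamma> \<le> M\<close> in auto)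
      have "(\<Sum>j\<le>M. if i < \<gamma> \<and> j < \<gamma> then f i j else 0) = (if i < \<gamma> then \<Sum>j<\<gamma>. f i j else 0)" for i
        using 1[of "f i"] by simp
      then show ?thesis using 1 by simp
    qed
    define T where "T = (\<Sum>i<\<gamma>. G i i)"
    define V where "V = (\<Sum>i\<le>M. v i)"
    have W: "(\<Sum>i\<le>M. w i) = T" unfolding w_def T_def
      by (rule sum.mono_neutral_cong_right) (use \<open>\<gamma> \<le> M\<close> in auto)
    have v_le: "v i \<le> t * g \<gamma> \<gamma>" for i
    proof (cases "i < \<gamma>")
      case False
      then have "g i i \<le> (t ^ (i - \<gamma>))\<^sup>2 * g \<gamma> \<gamma>" using energy_grams_decay[OF eg] by simp
      also have "\<dots> \<le> 1 * g \<gamma> \<gamma>"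
        using t g0 by (intro mult_right_mono) (auto intro!: power_le_one)
      finally have "t * g i i \<le> t * g \<gamma> \<gamma>" using t by (intro mult_left_mono) auto
      then show ?thesis using eg False unfolding energy_grams_def v_def by (auto intro: order_trans)
    qed (use t g0 in \<open>simp add: v_def\<close>)
    have V: "V \<le> (M + 1) * (t * g \<gamma> \<gamma>)"
      using sum_bounded_above[of "{..M}" v "t * g \<gamma> \<gamma>"] v_le unfolding V_def by simp
    have dbl: "(\<Sum>i\<le>M. \<Sum>j\<le>M. f i + f j) = 2 * (M + 1) * (\<Sum>i\<le>M. f i)" for f :: "nat \<Rightarrow> real"
      unfolding sum.distrib sum_constant card_atMost sum_distrib_left[symmetric] by (simp add: algebra_simps)
    have sums: "(\<Sum>i\<le>M. \<Sum>j\<le>M. b * (\<delta> * (w i + w j) + 1 / \<delta> * (v i + v j)))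
        = 2 * b * (M + 1) * \<delta> * T + 2 * b * (M + 1) / \<delta> * V"
    proof -
      have "(\<Sum>i\<le>M. \<Sum>j\<le>M. b * (\<delta> * (w i + w j) + 1 / \<delta> * (v i + v j)))
        = b * (\<delta> * (\<Sum>i\<le>M. \<Sum>j\<le>M. w i + w j) + 1 / \<delta> * (\<Sum>i\<le>M. \<Sum>j\<le>M. v i + v j))"
        by (simp only: sum.distrib sum_distrib_left[symmetric])
      also have "(\<Sum>i\<le>M. \<Sum>j\<le>M. w i + w j) = 2 * (M + 1) * T" unfolding dbl W ..
      also have "(\<Sum>i\<le>M. \<Sum>j\<le>M. v i + v j) = 2 * (M + 1) * V" unfolding dbl V_def ..
      finally show ?thesis by (simp add: algebra_simps add_divide_distrib)
    qed
    have "- (\<Sum>i\<le>M. \<Sum>j\<le>M. b * (\<delta> * (w i + w j) + 1 / \<delta> * (v i + v j)))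
        \<le> (\<Sum>i\<le>M. \<Sum>j\<le>M. B i j * G i j - (if i < \<gamma> \<and> j < \<gamma> then B i j * G i j else 0))"
      unfolding sum_negf[symmetric] by (intro sum_mono off) auto
    also have "\<dots> = (\<Sum>i\<le>M. \<Sum>j\<le>M. B i j * G i j) - (\<Sum>i<\<gamma>. \<Sum>j<\<gamma>. B i j * G i j)"
      by (simp only: sum_subtractf cut)
    finally have 1: "(\<Sum>i<\<gamma>. \<Sum>j<\<gamma>. B i j * G i j) - (2 * b * (M + 1) * \<delta> * T + 2 * b * (M + 1) / \<delta> * V)
        \<le> (\<Sum>i\<le>M. \<Sum>j\<le>M. B i j * G i j)" unfolding sums by linarith
    have "T \<le> C0 * (\<Sum>i<\<gamma>. \<Sum>j<\<gamma>. B i j * G i j)" unfolding T_def by (rule CG[OF G])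
    then have 2: "1 / C0 * T \<le> (\<Sum>i<\<gamma>. \<Sum>j<\<gamma>. B i j * G i j)" using C0 by (simp add: field_simps)
    have "0 \<le> T" unfolding T_def using G0 by (rule sum_nonneg)
    then have 3: "2 * b * (M + 1) * \<delta> * T \<le> 1 / C0 * T" using \<delta>b by (intro mult_right_mono)
    have "2 * b * (M + 1) / \<delta> * V \<le> 2 * b * (M + 1) / \<delta> * ((M + 1) * (t * g \<gamma> \<gamma>))"
      using V b0 \<delta> by (intro mult_left_mono) auto
    also have "\<dots> = C * t * g \<gamma> \<gamma>" by (simp add: C_def)
    finally show ?thesis using 1 2 3 by linarith
  qed
  ultimately show ?thesis by blast
qed

text \<open>The last remainder decays better the larger \<gamma> is, and positive definiteness
  limits \<gamma>; the best choice is the contribution index.\<close>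

lemma energy_growth:
  assumes tix: "is_termination_index \<alpha> M \<zeta>" and \<alpha>0: "\<alpha> 0 = 1"
    and pd: "pos_def_lead (snd (mt_AB \<alpha> M \<zeta>)) \<gamma>" and "\<gamma> \<le> \<zeta>"
  shows "\<exists>C\<ge>0. \<forall>t g G. energy_grams t g G \<and> 0 \<le> t \<and> t \<le> 1 \<longrightarrow>
    (\<Sum>i\<le>M. \<Sum>j\<le>M. \<alpha> i * \<alpha> j * g i j)
      \<le> g 0 0 + (fst (mt_AB \<alpha> M \<zeta>) \<zeta> \<zeta> + C * t) * g \<zeta> \<zeta> + C * t * g \<gamma> \<gamma>"
proof -
  define A where "A = fst (mt_AB \<alpha> M \<zeta>)"
  define B where "B = snd (mt_AB \<alpha> M \<zeta>)"
  have \<zeta>: "\<zeta> \<le> M" using tix mt_AB_A_outside[of M \<zeta> \<alpha> \<zeta> \<zeta>] unfolding is_termination_index_def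
    by (meson not_le)
  obtain C1 where C1: "C1 \<ge> 0" "\<And>t g G. energy_grams t g G \<Longrightarrow> 0 \<le> t \<Longrightarrow> t \<le> 1 \<Longrightarrow>
    (\<Sum>i\<le>M. \<Sum>j\<le>M. A i j * g i j) \<le> (A \<zeta> \<zeta> + C1 * t) * g \<zeta> \<zeta>"
    using energy_A_bound[of \<zeta> A M, OF _ _ \<zeta>] mt_AB_A_low[of _ \<zeta> \<alpha> M] mt_AB_symA[of \<alpha> M \<zeta>] unfolding A_def by blast
  obtain C2 where C2: "C2 \<ge> 0" "\<And>t g G. energy_grams t g G \<Longrightarrow> 0 \<le> t \<Longrightarrow> t \<le> 1 \<Longrightarrow>
    - (C2 * t * g \<gamma> \<gamma>) \<le> (\<Sum>i\<le>M. \<Sum>j\<le>M. B i j * G i j)"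
    using energy_B_bound[of B \<gamma> M] mt_AB_symB[of \<alpha> M \<zeta>] pd le_trans[OF \<open>\<gamma> \<le> \<zeta>\<close> \<zeta>] unfolding B_def by blast
  have "(\<Sum>i\<le>M. \<Sum>j\<le>M. \<alpha> i * \<alpha> j * g i j)
      \<le> g 0 0 + (A \<zeta> \<zeta> + max C1 C2 * t) * g \<zeta> \<zeta> + max C1 C2 * t * g \<gamma> \<gamma>"
    if eg: "energy_grams t g G" and t: "0 \<le> t" "t \<le> 1" for t g G
  proof -
    have g: "psd_gram g" and G: "psd_gram G" and rel: "\<And>i j. g (Suc i) j + g i (Suc j) = - 2 * G i j"
      using eg by (auto simp: energy_grams_def)
    have "(\<Sum>i\<le>M. \<Sum>j\<le>M. \<alpha> i * \<alpha> j * g i j) = g 0 0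
       + (\<Sum>i\<le>M. \<Sum>j\<le>M. A i j * g i j) - (\<Sum>i\<le>M. \<Sum>j\<le>M. B i j * G i j)"
      using mt_AB_energy[of g G \<zeta> \<alpha> M] psd_gram_sym[OF g] psd_gram_sym[OF G] rel tix \<zeta> \<alpha>0
      unfolding A_def B_def is_termination_index_def by simp
    also have "\<dots> \<le> g 0 0 + (A \<zeta> \<zeta> + C1 * t) * g \<zeta> \<zeta> + C2 * t * g \<gamma> \<gamma>"
      using C1(2)[OF eg t] C2(2)[OF eg t] by linarith
    also have "\<dots> \<le> g 0 0 + (A \<zeta> \<zeta> + max C1 C2 * t) * g \<zeta> \<zeta> + max C1 C2 * t * g \<gamma> \<gamma>"
      using t psd_gram_diag[OF g] by (intro add_mono mult_right_mono) auto
    finally show ?thesis .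
  qed
  then show ?thesis unfolding A_def using C1(1) by (intro exI[of _ "max C1 C2"]) auto
qed

text \<open>The termination index is positive because the (0, 0) entry starts as 0. Hence the first
  step has been made, and the value \<open>2 * \<alpha> 1\<close> it writes at (0, 0) of
  \<open>B\<close> is never changed again. The block of order 1 is thus positive definite, which
  makes the set under \<open>GREATEST\<close> nonempty and gives the lower bound 1.\<close>

lemma contribution_index_props:
  assumes "is_termination_index \<alpha> M \<zeta>" and "\<alpha> 0 = 1" and "\<alpha> 1 > 0" and "0 < M"
  defines "\<rho> \<equiv> contribution_index \<alpha> M \<zeta>"
  shows "1 \<le> \<rho>" and "\<rho> \<le> \<zeta>" and "pos_def_lead (snd (mt_AB \<alpha> M \<zeta>)) \<rho>"
proof -
  let ?P = "\<lambda>\<kappa>. \<kappa> \<le> \<zeta> \<and> pos_def_lead (snd (mt_AB \<alpha> M \<zeta>)) \<kappa>"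
  have "\<zeta> \<noteq> 0" using assms(1) by (intro notI) (simp add: is_termination_index_def mt_A0_def)
  then obtain n where n: "\<zeta> = Suc n" by (cases \<zeta>) auto
  have "snd (mt_AB \<alpha> M (Suc n)) 0 0 = 2 * \<alpha> 1" for n
  proof (induction n)
    case 0
    then show ?case using assms by (simp add: mt_stepB_def mt_stepB_low_def mt_A0_def)
  next
    case (Suc n)
    then show ?case by (subst mt_AB.simps(2)) (simp add: mt_stepB_def mt_stepB_low_def del: mt_AB.simps)
  qed
  then have "snd (mt_AB \<alpha> M \<zeta>) 0 0 > 0" using assms(3) unfolding n by (simp only:)
  then have "0 < x * snd (mt_AB \<alpha> M \<zeta>) 0 0 * x" if "x \<noteq> 0" for x
  proof -
    have e: "x * snd (mt_AB \<alpha> M \<zeta>) 0 0 * x = snd (mt_AB \<alpha> M \<zeta>) 0 0 * x\<^sup>2" by (simp add: power2_eq_square)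
    show ?thesis unfolding e using that \<open>snd (mt_AB \<alpha> M \<zeta>) 0 0 > 0\<close> by simp
  qed
  then have "?P 1" using n by (simp add: pos_def_lead_def del: mt_AB.simps)
  have ex: "?P \<rho>" unfolding \<rho>_def contribution_index_def
    by (rule GreatestI_nat[where b = \<zeta>]) (use \<open>?P 1\<close> in auto)
  then show "\<rho> \<le> \<zeta>" "pos_def_lead (snd (mt_AB \<alpha> M \<zeta>)) \<rho>" by auto
  show "1 \<le> \<rho>" unfolding \<rho>_def contribution_index_def
    by (rule Greatest_le_nat[where b = \<zeta>]) (use \<open>?P 1\<close> in auto)
qed

lemma energy_bounds:
  assumes tix: "is_termination_index \<alpha> M \<zeta>" and "\<alpha> 0 = 1" and "\<alpha> 1 > 0" and "0 < M"
  defines "\<rho> \<equiv> contribution_index \<alpha> M \<zeta>" and "a \<equiv> fst (mt_AB \<alpha> M \<zeta>) \<zeta> \<zeta>"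
    and "E \<equiv> \<lambda>g. \<Sum>i\<le>M. \<Sum>j\<le>M. \<alpha> i * \<alpha> j * g i j"
  shows "\<rho> = \<zeta> \<Longrightarrow> a < 0 \<Longrightarrow> \<exists>t0>0. \<forall>t g G. energy_grams t g G \<and> 0 \<le> t \<and> t \<le> t0 \<longrightarrow> E g \<le> g 0 0"
    and "\<rho> = \<zeta> \<Longrightarrow> \<exists>C\<ge>0. \<forall>t g G. energy_grams t g G \<and> 0 \<le> t \<and> t \<le> 1 \<longrightarrow> E g \<le> (1 + C * t ^ (2 * \<zeta>)) * g 0 0"
    and "\<rho> < \<zeta> \<Longrightarrow> \<exists>C\<ge>0. \<forall>t g G. energy_grams t g G \<and> 0 \<le> t \<and> t \<le> 1 \<longrightarrow> E g \<le> (1 + C * t ^ (2 * \<rho> + 1)) * g 0 0"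
proof -
  note \<rho> = contribution_index_props[OF assms(1-4), folded \<rho>_def]
  obtain C where C: "C \<ge> 0" and bd: "\<And>t g G. energy_grams t g G \<Longrightarrow> 0 \<le> t \<Longrightarrow> t \<le> 1 \<Longrightarrow>
      E g \<le> g 0 0 + (a + C * t) * g \<zeta> \<zeta> + C * t * g \<rho> \<rho>"
    using energy_growth[OF tix \<open>\<alpha> 0 = 1\<close> \<rho>(3,2)] unfolding E_def a_def by blast
  have g0: "0 \<le> g i i" if "energy_grams t g G" for t g G i
    using that psd_gram_diag unfolding energy_grams_def by blast
  show "\<exists>t0>0. \<forall>t g G. energy_grams t g G \<and> 0 \<le> t \<and> t \<le> t0 \<longrightarrow> E g \<le> g 0 0" if "\<rho> = \<zeta>" "a < 0"
  \<comment> \<open>For equal indices both remainders multiply \<open>g \<zeta> \<zeta>\<close>,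
    with total factor \<open>a + 2 * C * t\<close>; the threshold makes this nonpositive.
    \<open>C + 1\<close> avoids division by zero.\<close>
  proof (intro exI[of _ "min 1 (- a / (2 * (C + 1)))"] conjI allI impI; (elim conjE)?)
    fix t g G assume eg: "energy_grams t g G" and t: "0 \<le> t" "t \<le> min 1 (- a / (2 * (C + 1)))"
    have "t * (2 * (C + 1)) \<le> - a" using t C by (simp add: field_simps)
    then have "a + 2 * C * t \<le> 0" using t by (simp add: algebra_simps)
    then have "(a + 2 * C * t) * g \<zeta> \<zeta> \<le> 0" using g0[OF eg] by (simp add: mult_nonpos_nonneg)
    then show "E g \<le> g 0 0" using bd[OF eg] t that by (simp add: algebra_simps)
  qed (use C \<open>a < 0\<close> in \<open>auto simp: divide_neg_pos\<close>)
  have dec: "g i i \<le> t ^ (2 * i) * g 0 0" if "energy_grams t g G" for t g G i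
    using energy_grams_decay[OF that, of 0 i] by (simp add: power_even_eq)
  show "\<exists>C\<ge>0. \<forall>t g G. energy_grams t g G \<and> 0 \<le> t \<and> t \<le> 1 \<longrightarrow> E g \<le> (1 + C * t ^ (2 * \<zeta>)) * g 0 0" if "\<rho> = \<zeta>"
  proof (intro exI[of _ "\<bar>a\<bar> + 2 * C"] conjI allI impI; (elim conjE)?)
    fix t g G assume eg: "energy_grams t g G" and t: "0 \<le> t" "t \<le> 1"
    have "C * t \<le> C" using t C by (simp add: mult_left_le)
    then have "(a + 2 * (C * t)) * g \<zeta> \<zeta> \<le> (\<bar>a\<bar> + 2 * C) * g \<zeta> \<zeta>"
      using g0[OF eg] by (intro mult_right_mono) auto
    also have "\<dots> \<le> (\<bar>a\<bar> + 2 * C) * (t ^ (2 * \<zeta>) * g 0 0)"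
      using dec[OF eg] C by (intro mult_left_mono) auto
    finally show "E g \<le> (1 + (\<bar>a\<bar> + 2 * C) * t ^ (2 * \<zeta>)) * g 0 0"
      using bd[OF eg t] that by (simp add: algebra_simps)
  qed (use C in auto)
  show "\<exists>C\<ge>0. \<forall>t g G. energy_grams t g G \<and> 0 \<le> t \<and> t \<le> 1 \<longrightarrow> E g \<le> (1 + C * t ^ (2 * \<rho> + 1)) * g 0 0" if "\<rho> < \<zeta>"
  proof (intro exI[of _ "\<bar>a\<bar> + 2 * C"] conjI allI impI; (elim conjE)?)
    fix t g G assume eg: "energy_grams t g G" and t: "0 \<le> t" "t \<le> 1"
    have "C * t \<le> C" using t C by (simp add: mult_left_le)
    then have "(a + C * t) * g \<zeta> \<zeta> \<le> (\<bar>a\<bar> + C) * g \<zeta> \<zeta>"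
      using g0[OF eg] by (intro mult_right_mono) auto
    \<comment> \<open>Passing from \<rho> to \<zeta> gains at least two factors \<open>t\<close>;
      keeping one of them is enough to merge this term with the remainder
      \<open>C * t * g \<rho> \<rho>\<close>.\<close>
    also have "g \<zeta> \<zeta> \<le> t * g \<rho> \<rho>"
    proof -
      have "g \<zeta> \<zeta> \<le> t ^ (2 * (\<zeta> - \<rho>)) * g \<rho> \<rho>"
        using energy_grams_decay[OF eg, of \<rho> \<zeta>] that by (simp add: power_even_eq)
      also have "\<dots> \<le> t ^ 1 * g \<rho> \<rho>"
        using t that g0[OF eg] by (intro mult_right_mono power_decreasing) auto
      finally show ?thesis by simp
    qed
    then have "(\<bar>a\<bar> + C) * g \<zeta> \<zeta> \<le> (\<bar>a\<bar> + C) * (t * g \<rho> \<rho>)"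
      using C by (intro mult_left_mono) auto
    finally have "(a + C * t) * g \<zeta> \<zeta> + C * t * g \<rho> \<rho> \<le> (\<bar>a\<bar> + 2 * C) * t * g \<rho> \<rho>"
      by (simp add: algebra_simps)
    also have "\<dots> \<le> (\<bar>a\<bar> + 2 * C) * t * (t ^ (2 * \<rho>) * g 0 0)"
      using dec[OF eg] C t by (intro mult_left_mono) auto
    finally show "E g \<le> (1 + (\<bar>a\<bar> + 2 * C) * t ^ (2 * \<rho> + 1)) * g 0 0"
      using bd[OF eg t] by (simp add: algebra_simps)
  qed (use C in auto)
qed

section \<open>Temporal differences in an abstract energy space\<close>

lemma rk_polys_length: "length (rk_polys c d l) = Suc l"
  by (induction l) auto

lemma rk_polys_nth: "n \<le> l \<Longrightarrow> rk_polys c d l ! n = rk_polys c d n ! n"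
proof (induction l)
  case (Suc l)
  then show ?case
    by (cases "n = Suc l") (auto simp: nth_append rk_polys_length)
qed simp

lemma rk_stab_poly_0: "rk_stab_poly c d 0 = 1"
  by (simp add: rk_stab_poly_def)

text \<open>The list of stages only grows at its end, so \<open>rk_stab_poly c d n\<close> is the
  n-th stage polynomial in a list of any length. The recursion for lists becomes one for
  polynomials, which suits induction over stages.\<close>

lemma rk_stab_poly_Suc:
  "rk_stab_poly c d (Suc l) = (\<Sum>n\<le>l. smult (c l n) (rk_stab_poly c d n) + smult (d l n) (pCons 0 (rk_stab_poly c d n)))"
proof -
  have "rk_stab_poly c d (Suc l) = (\<Sum>n\<le>l. smult (c l n) (rk_polys c d l ! n) + smult (d l n) (pCons 0 (rk_polys c d l ! n)))"
    by (simp add: rk_stab_poly_def nth_append rk_polys_length)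
  also have "\<dots> = (\<Sum>n\<le>l. smult (c l n) (rk_stab_poly c d n) + smult (d l n) (pCons 0 (rk_stab_poly c d n)))"
  proof (intro sum.cong refl)
    fix n assume "n \<in> {..l}"
    then have "rk_polys c d l ! n = rk_stab_poly c d n" by (simp add: rk_stab_poly_def rk_polys_nth[of n l])
    then show "smult (c l n) (rk_polys c d l ! n) + smult (d l n) (pCons 0 (rk_polys c d l ! n))
      = smult (c l n) (rk_stab_poly c d n) + smult (d l n) (pCons 0 (rk_stab_poly c d n))" by simp
  qed
  finally show ?thesis .
qed

lemma degree_rk_stab_poly: "degree (rk_stab_poly c d l) \<le> l"
proof (induction l rule: less_induct)
  case (less l)
  show ?case
  proof (cases l)
    case (Suc k)
    have "degree (smult a (rk_stab_poly c d n) + smult b (pCons 0 (rk_stab_poly c d n))) \<le> Suc k" if "n \<le> k" for n a b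
    proof (rule degree_add_le)
      have n: "degree (rk_stab_poly c d n) \<le> k" using less[of n] that Suc by simp
      show "degree (smult a (rk_stab_poly c d n)) \<le> Suc k" using n degree_smult_le[of a "rk_stab_poly c d n"] by linarith
      have "degree (pCons 0 (rk_stab_poly c d n)) \<le> Suc k" using n degree_pCons_le[of 0 "rk_stab_poly c d n"] by linarith
      then show "degree (smult b (pCons 0 (rk_stab_poly c d n))) \<le> Suc k" using degree_smult_le order_trans by blast
    qed
    then show ?thesis unfolding Suc rk_stab_poly_Suc by (intro degree_sum_le) auto
  qed (simp add: rk_stab_poly_0)
qed

text \<open>The linear functional sending the i-th power of the variable to \<open>x i\<close>. For
  \<open>x i\<close> = <D_i, \<phi>> it is the tested value <p(\<tau> L) u, \<phi>>, written without
  an operator L.\<close>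

definition coeff_sum :: "real poly \<Rightarrow> (nat \<Rightarrow> real) \<Rightarrow> real" where
  "coeff_sum p x = (\<Sum>i\<le>degree p. coeff p i * x i)"

lemma coeff_sum_eq: "degree p \<le> n \<Longrightarrow> coeff_sum p x = (\<Sum>i\<le>n. coeff p i * x i)"
  unfolding coeff_sum_def by (intro sum.mono_neutral_left) (auto simp: coeff_eq_0)

lemma coeff_sum_add: "coeff_sum (p + q) x = coeff_sum p x + coeff_sum q x"
proof -
  define n where "n = max (degree p) (degree q)"
  have "degree (p + q) \<le> n" "degree p \<le> n" "degree q \<le> n" by (auto simp: n_def degree_add_le)
  then show ?thesis by (simp add: coeff_sum_eq[where n = n] sum.distrib algebra_simps)
qed

lemma coeff_sum_smult: "coeff_sum (smult a p) x = a * coeff_sum p x"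
  by (simp add: coeff_sum_eq[OF degree_smult_le] coeff_sum_def sum_distrib_left mult.assoc)

lemma coeff_sum_sum: "coeff_sum (\<Sum>i\<in>A. p i) x = (\<Sum>i\<in>A. coeff_sum (p i) x)"
  by (induction A rule: infinite_finite_induct) (simp_all add: coeff_sum_add, simp_all add: coeff_sum_def)

text \<open>A factor z is a shift of the sequence: one more application of the operator moves from
  D_i to D_(i+1).\<close>

lemma coeff_sum_pCons: "coeff_sum (pCons 0 p) x = coeff_sum p (\<lambda>i. x (Suc i))"
  by (simp add: coeff_sum_eq[OF degree_pCons_le] sum.atMost_Suc_shift coeff_sum_def del: sum.atMost_Suc)

lemma coeff_sum_mult_x: "coeff_sum p (\<lambda>i. x i * a) = coeff_sum p x * a"
  by (simp add: coeff_sum_def sum_distrib_right mult.assoc)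

section \<open>Linear algebra in semi-inner-product spaces\<close>

lemma small_nonpos:
  fixes x y :: real
  assumes "\<And>a. 0 < a \<Longrightarrow> x \<le> y * a"
  shows "x \<le> 0"
proof (rule ccontr)
  assume "\<not> x \<le> 0"
  then show False using assms[of "x / (2 * (\<bar>y\<bar> + 1))"]
    by (simp add: field_simps) (smt (verit, best) mult_left_mono mult_less_cancel_left)
qed

text \<open>Carrier-based, with \<open>comb c u v\<close> (meaning u + c v) as the only operation,
  so that sets of pairs of functions can be plugged in directly. \<open>ip\<close> is merely
  semidefinite: vectors of norm 0 are not identified with zero.\<close>

locale ip_space =
  fixes S :: "'a set" and comb :: "real \<Rightarrow> 'a \<Rightarrow> 'a \<Rightarrow> 'a" and ip :: "'a \<Rightarrow> 'a \<Rightarrow> real"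
  assumes comb_in: "u \<in> S \<Longrightarrow> v \<in> S \<Longrightarrow> comb c u v \<in> S"
    and ip_comb: "u \<in> S \<Longrightarrow> v \<in> S \<Longrightarrow> w \<in> S \<Longrightarrow> ip (comb c u v) w = ip u w + c * ip v w"
    and ip_sym: "u \<in> S \<Longrightarrow> v \<in> S \<Longrightarrow> ip u v = ip v u"
    and ip_nonneg: "u \<in> S \<Longrightarrow> 0 \<le> ip u u"
begin

lemma ip_comb_right: "u \<in> S \<Longrightarrow> v \<in> S \<Longrightarrow> w \<in> S \<Longrightarrow> ip w (comb c u v) = ip w u + c * ip w v"
  using ip_comb[of u v w c] ip_sym comb_in by simp

text \<open>The carrier has no distinguished zero; u - u serves, for whichever u is at hand. The
  argument \<open>z\<close> of \<open>lincomb\<close> is such a seed.\<close>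

definition zero_of :: "'a \<Rightarrow> 'a" where "zero_of u = comb (-1) u u"

lemma zero_of_in: "u \<in> S \<Longrightarrow> zero_of u \<in> S"
  by (simp add: zero_of_def comb_in)

lemma ip_zero_of: "u \<in> S \<Longrightarrow> v \<in> S \<Longrightarrow> ip (zero_of u) v = 0"
  by (simp add: zero_of_def ip_comb)

definition scale :: "real \<Rightarrow> 'a \<Rightarrow> 'a" where "scale a u = comb a (zero_of u) u"

lemma scale_in: "u \<in> S \<Longrightarrow> scale a u \<in> S"
  by (simp add: scale_def comb_in zero_of_in)

lemma ip_scale: "u \<in> S \<Longrightarrow> v \<in> S \<Longrightarrow> ip (scale a u) v = a * ip u v"
  by (simp add: scale_def ip_comb zero_of_in ip_zero_of)

lemma ip_scale_right: "u \<in> S \<Longrightarrow> v \<in> S \<Longrightarrow> ip v (scale a u) = a * ip v u"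
  using ip_scale ip_sym scale_in by metis

primrec lincomb :: "'a \<Rightarrow> nat \<Rightarrow> (nat \<Rightarrow> real) \<Rightarrow> (nat \<Rightarrow> 'a) \<Rightarrow> 'a" where
  "lincomb z 0 c e = zero_of z"
| "lincomb z (Suc n) c e = comb (c n) (lincomb z n c e) (e n)"

lemma lincomb_in: "z \<in> S \<Longrightarrow> (\<And>i. i < n \<Longrightarrow> e i \<in> S) \<Longrightarrow> lincomb z n c e \<in> S"
  by (induction n) (auto intro: comb_in zero_of_in)

lemma lincomb_linear:
  assumes F: "\<And>c u v. u \<in> S \<Longrightarrow> v \<in> S \<Longrightarrow> F (comb c u v) = F u + c * F v"
    and "z \<in> S" and "\<And>i. i < n \<Longrightarrow> e i \<in> S"
  shows "F (lincomb z n c e) = (\<Sum>i<n. c i * (F (e i) :: real))"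
  using assms(3)
proof (induction n)
  case 0
  then show ?case using F[of z z "-1"] \<open>z \<in> S\<close> by (simp add: zero_of_def)
next
  case (Suc n)
  then show ?case using lincomb_in[OF \<open>z \<in> S\<close>, of n e c] by (simp add: F)
qed

definition orthonormal :: "nat \<Rightarrow> (nat \<Rightarrow> 'a) \<Rightarrow> bool" where
  "orthonormal n e \<longleftrightarrow> (\<forall>i<n. e i \<in> S) \<and> (\<forall>i<n. \<forall>j<n. ip (e i) (e j) = (if i = j then 1 else 0))"

text \<open>The combination v of the \<open>e i\<close> with coefficients \<open>F (e i)\<close>
  satisfies F v = <v, v> = s, where s is the sum to be bounded. The assumed bound at v is then s^2
  \<le> C s.\<close>

lemma bessel:
  assumes e: "orthonormal n e" and F: "\<And>c u v. u \<in> S \<Longrightarrow> v \<in> S \<Longrightarrow> F (comb c u v) = F u + c * F v"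
    and C: "0 \<le> C" "\<And>u. u \<in> S \<Longrightarrow> (F u)\<^sup>2 \<le> C * ip u u"
  shows "(\<Sum>i<n. (F (e i))\<^sup>2) \<le> C"
proof (cases n)
  case (Suc m)
  have eS: "e i \<in> S" if "i < n" for i using e that by (simp add: orthonormal_def)
  then have z: "e 0 \<in> S" using Suc by simp
  define v where "v = lincomb (e 0) n (\<lambda>i. F (e i)) e"
  have v: "v \<in> S" unfolding v_def using z eS by (rule lincomb_in)
  define s where "s = (\<Sum>i<n. (F (e i))\<^sup>2)"
  have Fv: "F v = s"
    unfolding v_def s_def using lincomb_linear[where F = F, OF F z eS] by (simp add: power2_eq_square)
  have "ip v (e j) = F (e j)" if "j < n" for j
  proof -
    have "ip v (e j) = (\<Sum>i<n. F (e i) * ip (e i) (e j))"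
      unfolding v_def by (rule lincomb_linear[of "\<lambda>x. ip x (e j)"]) (use z eS ip_comb that in auto)
    also have "\<dots> = (\<Sum>i<n. if i = j then F (e j) else 0)"
      using e that by (intro sum.cong) (auto simp: orthonormal_def)
    finally show ?thesis using that by simp
  qed
  then have "ip v v = s"
    using lincomb_linear[of "\<lambda>x. ip v x" "e 0" n e "\<lambda>i. F (e i)"] z eS ip_comb_right v
    by (simp add: s_def power2_eq_square flip: v_def)
  then have "s * s \<le> C * s" using C(2)[OF v] Fv by (simp add: power2_eq_square)
  moreover have "0 \<le> s" unfolding s_def by (intro sum_nonneg) simp
  ultimately show ?thesis using C(1) unfolding s_def[symmetric] by (cases "s = 0") auto
qed (use C in simp)

end

text \<open>\<open>K\<close> will be a mesh-independent constant divided by h. A bound of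
  \<open>H\<close> by a sum of squares is what the inverse inequalities deliver; homogeneity
  recovers weighted versions. \<open>fin_dim\<close> speaks of orthonormal families, so that no
  basis has to be exhibited.\<close>

locale energy_space = ip_space S comb ip
  for S :: "'a set" and comb :: "real \<Rightarrow> 'a \<Rightarrow> 'a \<Rightarrow> 'a" and ip :: "'a \<Rightarrow> 'a \<Rightarrow> real" +
  fixes H :: "'a \<Rightarrow> 'a \<Rightarrow> real" and K :: real
  assumes H_comb_left: "u \<in> S \<Longrightarrow> v \<in> S \<Longrightarrow> w \<in> S \<Longrightarrow> H (comb c u v) w = H u w + c * H v w"
    and H_comb_right: "u \<in> S \<Longrightarrow> v \<in> S \<Longrightarrow> w \<in> S \<Longrightarrow> H w (comb c u v) = H w u + c * H w v"
    and H_diss: "u \<in> S \<Longrightarrow> H u u \<le> 0"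
    and K_pos: "0 < K"
    and H_bound: "u \<in> S \<Longrightarrow> v \<in> S \<Longrightarrow> \<bar>H u v\<bar> \<le> K * (ip u u + ip v v)"
    and fin_dim: "\<exists>n0. \<forall>n e. orthonormal n e \<longrightarrow> n \<le> n0"
begin

lemma H_scale: "u \<in> S \<Longrightarrow> v \<in> S \<Longrightarrow> H (scale a u) v = a * H u v"
  by (simp add: scale_def zero_of_def comb_in H_comb_left)

lemma H_scale_right: "u \<in> S \<Longrightarrow> v \<in> S \<Longrightarrow> H v (scale a u) = a * H v u"
  by (simp add: scale_def zero_of_def comb_in H_comb_right)

text \<open>A maximal orthonormal family spans the space up to null vectors.\<close>

lemma riesz:
  assumes F: "\<And>c u v. u \<in> S \<Longrightarrow> v \<in> S \<Longrightarrow> F (comb c u v) = F u + c * F v"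
    and F0: "\<And>u. u \<in> S \<Longrightarrow> ip u u = 0 \<Longrightarrow> F u = 0" and "z \<in> S"
  shows "\<exists>w\<in>S. \<forall>u\<in>S. ip w u = (F u :: real)"
proof -
  obtain n0 where n0: "\<And>n. (\<exists>e. orthonormal n e) \<Longrightarrow> n \<le> n0"
    using fin_dim by blast
  define n where "n = (GREATEST n. \<exists>e. orthonormal n e)"
  have "\<exists>e. orthonormal 0 e" by (simp add: orthonormal_def)
  then have "\<exists>e. orthonormal n e" unfolding n_def by (rule GreatestI_nat) (use n0 in blast)
  then obtain e where e: "orthonormal n e" by blast
  have max: "\<not> orthonormal (Suc n) e'" for e'
    using Greatest_le_nat[of "\<lambda>n. \<exists>e. orthonormal n e" "Suc n" n0] n0 unfolding n_def[symmetric] by (meson Suc_n_not_le_n)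
  have eS: "e i \<in> S" if "i < n" for i using e that by (simp add: orthonormal_def)
  have ee: "ip (e i) (e j) = (if i = j then 1 else 0)" if "i < n" "j < n" for i j using e that by (simp add: orthonormal_def)
  define w where "w = lincomb z n (\<lambda>i. F (e i)) e"
  have w: "w \<in> S" unfolding w_def using \<open>z \<in> S\<close> eS by (rule lincomb_in)
  have "ip w u = F u" if u: "u \<in> S" for u
  proof -
    define p where "p = lincomb z n (\<lambda>i. ip (e i) u) e"
    have p: "p \<in> S" unfolding p_def using \<open>z \<in> S\<close> eS by (rule lincomb_in)
    define r where "r = comb (-1) u p"
    have r: "r \<in> S" unfolding r_def using u p by (rule comb_in)
    have ip_p: "ip v p = (\<Sum>i<n. ip (e i) u * ip v (e i))" if "v \<in> S" for v
      unfolding p_def by (rule lincomb_linear) (use that \<open>z \<in> S\<close> eS ip_comb_right in auto)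
    have er: "ip (e i) r = 0" if "i < n" for i
    proof -
      have "ip (e i) p = (\<Sum>j<n. if j = i then ip (e i) u else 0)"
        unfolding ip_p[OF eS[OF that]] by (intro sum.cong) (use ee that in auto)
      then show ?thesis unfolding r_def using that eS u p by (simp add: ip_comb_right)
    qed
    have "ip r r = 0"
    proof (rule ccontr)
      assume "ip r r \<noteq> 0"
      then have pos: "0 < ip r r" using ip_nonneg[OF r] by simp
      define e' where "e' = e(n := scale (1 / sqrt (ip r r)) r)"
      have re: "ip r (e i) = 0" if "i < n" for i using er[OF that] ip_sym[OF r eS[OF that]] by simp
      have "orthonormal (Suc n) e'"
        unfolding orthonormal_def e'_def
        using pos r ee er re eS by (auto simp: less_Suc_eq scale_in ip_scale ip_scale_right)
      then show False using max by blast
    qed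
    then have "F r = 0" using F0 r by blast
    then have "F u = F p" unfolding r_def using F u p by simp
    also have "\<dots> = (\<Sum>i<n. ip (e i) u * F (e i))"
      unfolding p_def by (rule lincomb_linear) (use \<open>z \<in> S\<close> eS F in auto)
    also have "\<dots> = ip w u"
    proof -
      have "ip w u = (\<Sum>i<n. F (e i) * ip (e i) u)"
        unfolding w_def by (rule lincomb_linear[of "\<lambda>x. ip x u"]) (use \<open>z \<in> S\<close> eS ip_comb u in auto)
      then show ?thesis by (simp add: mult.commute)
    qed
    finally show ?thesis by simp
  qed
  then show ?thesis using w by blast
qed

text \<open>Scaling \<open>u\<close> by \<open>sqrt a\<close> and \<open>v\<close> by its inverse
  leaves \<open>H u v\<close> unchanged and redistributes the weights.\<close>

lemma H_scaled_bound:
  assumes "u \<in> S" "v \<in> S" "0 < a"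
  shows "\<bar>H u v\<bar> \<le> K * (a * ip u u + ip v v / a)"
proof -
  have "\<bar>H (scale (sqrt a) u) (scale (1 / sqrt a) v)\<bar>
      \<le> K * (ip (scale (sqrt a) u) (scale (sqrt a) u) + ip (scale (1 / sqrt a) v) (scale (1 / sqrt a) v))"
    using assms by (intro H_bound scale_in)
  then show ?thesis
    using assms by (simp add: H_scale H_scale_right ip_scale ip_scale_right scale_in flip: mult.assoc)
qed

text \<open>A null vector can carry an arbitrarily large weight at no cost, while the weight of the
  other vector tends to 0. So \<open>H\<close> descends to the quotient by null vectors, as
  \<open>riesz\<close> requires of a functional.\<close>

lemma H_null_left:
  assumes "u \<in> S" "v \<in> S" "ip u u = 0" shows "H u v = 0"
proof -
  have "\<bar>H u v\<bar> \<le> (K * ip v v) * a" if "0 < a" for a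
    using H_scaled_bound[OF assms(1,2), of "1 / a"] that assms by (simp add: mult_ac)
  then show ?thesis using small_nonpos by (metis abs_le_zero_iff)
qed

lemma H_null_right:
  assumes "u \<in> S" "v \<in> S" "ip v v = 0" shows "H u v = 0"
proof -
  have "\<bar>H u v\<bar> \<le> (K * ip u u) * a" if "0 < a" for a
    using H_scaled_bound[OF assms(1,2), of a] that assms by (simp add: mult_ac)
  then show ?thesis using small_nonpos by (metis abs_le_zero_iff)
qed

lemma H_repr:
  assumes "u \<in> S"
  shows "\<exists>w\<in>S. \<forall>\<phi>\<in>S. ip w \<phi> = \<tau> * H u \<phi>"
  by (rule riesz[of _ u]) (use assms in \<open>auto simp: H_comb_right H_null_right algebra_simps\<close>)

text \<open>The expansion of a stage value is known only after pairing with elements of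
  \<open>S\<close>. To apply it inside the first argument of \<open>H\<close>, the map from u to
  \<open>H u \<phi>\<close> must itself be such a pairing.\<close>

lemma H_repr_adj:
  assumes "\<phi> \<in> S"
  shows "\<exists>w\<in>S. \<forall>u\<in>S. ip w u = H u \<phi>"
  by (rule riesz[of _ \<phi>]) (use assms in \<open>auto simp: H_comb_left H_null_left algebra_simps\<close>)

text \<open>Selected by \<open>SOME\<close>, since a temporal difference is determined by its
  pairings only up to null vectors.\<close>

primrec tdiff :: "real \<Rightarrow> 'a \<Rightarrow> nat \<Rightarrow> 'a" where
  "tdiff \<tau> u 0 = u"
| "tdiff \<tau> u (Suc i) = (SOME w. w \<in> S \<and> (\<forall>\<phi>\<in>S. ip w \<phi> = \<tau> * H (tdiff \<tau> u i) \<phi>))"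

lemma tdiff_in: "u \<in> S \<Longrightarrow> tdiff \<tau> u i \<in> S"
  and tdiff_Suc: "u \<in> S \<Longrightarrow> \<phi> \<in> S \<Longrightarrow> ip (tdiff \<tau> u (Suc i)) \<phi> = \<tau> * H (tdiff \<tau> u i) \<phi>"
proof -
  assume u: "u \<in> S"
  have *: "tdiff \<tau> u (Suc i) \<in> S \<and> (\<forall>\<phi>\<in>S. ip (tdiff \<tau> u (Suc i)) \<phi> = \<tau> * H (tdiff \<tau> u i) \<phi>)" if "tdiff \<tau> u i \<in> S" for i
    unfolding tdiff.simps by (rule someI_ex) (use H_repr[OF that] in blast)
  show in_S: "tdiff \<tau> u i \<in> S" for i
    by (induction i) (use * u in auto)
  show "ip (tdiff \<tau> u (Suc i)) \<phi> = \<tau> * H (tdiff \<tau> u i) \<phi>" if "\<phi> \<in> S"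
    using *[OF in_S] that by blast
qed

lemma rk_traj_in:
  assumes "rk_traj S ip H c d s \<tau> m U" and "1 \<le> s"
  shows "j \<le> m \<Longrightarrow> U j 0 \<in> S" and "j < m \<Longrightarrow> l \<le> s \<Longrightarrow> U j l \<in> S"
proof -
  have s: "U j (Suc l) \<in> S" if "j < m" "l < s" for j l using assms that unfolding rk_traj_def by blast
  show 0: "U j 0 \<in> S" if "j \<le> m" for j
  proof (cases j)
    case 0
    then show ?thesis using assms unfolding rk_traj_def by simp
  next
    case (Suc k)
    then have "U j 0 = U k s" using assms that unfolding rk_traj_def by simp
    then show ?thesis using s[of k "s - 1"] that Suc \<open>1 \<le> s\<close> by simp
  qed
  show "U j l \<in> S" if "j < m" "l \<le> s" for j l
    using 0[of j] s[of j "l - 1"] that by (cases l) auto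
qed

text \<open>The polynomial \<open>p\<close> accounts for the full time steps already taken, so one
  induction over stages serves every \<open>j\<close>.\<close>

lemma rk_stage_expansion:
  assumes tr: "rk_traj S ip H c d s \<tau> m U" and "1 \<le> s" and j: "j < m"
    and 0: "\<And>\<phi>. \<phi> \<in> S \<Longrightarrow> ip (U j 0) \<phi> = coeff_sum p (\<lambda>i. ip (tdiff \<tau> (U 0 0) i) \<phi>)"
    and "l \<le> s" and "\<phi> \<in> S"
  shows "ip (U j l) \<phi> = coeff_sum (p * rk_stab_poly c d l) (\<lambda>i. ip (tdiff \<tau> (U 0 0) i) \<phi>)"
  using \<open>l \<le> s\<close> \<open>\<phi> \<in> S\<close>
proof (induction l arbitrary: \<phi> rule: less_induct)
  case (less l)
  let ?D = "tdiff \<tau> (U 0 0)"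
  have u: "U 0 0 \<in> S" using tr unfolding rk_traj_def by blast
  have Di: "?D i \<in> S" for i using u by (rule tdiff_in)
  show ?case
  proof (cases l)
    case 0
    then show ?thesis using assms(4) less.prems by (simp add: rk_stab_poly_0)
  next
    case (Suc k)
    have Us: "U j n \<in> S" if "n \<le> k" for n
      using rk_traj_in(2)[OF tr \<open>1 \<le> s\<close> j] that less.prems Suc by simp
    \<comment> \<open>The adjoint image of \<phi>: the induction hypothesis is used with
      \<open>w\<close> in place of \<phi>, which is why \<phi> is kept arbitrary.\<close>
    obtain w where w: "w \<in> S" "\<And>u. u \<in> S \<Longrightarrow> ip w u = H u \<phi>"
      using H_repr_adj[OF \<open>\<phi> \<in> S\<close>] by blast
    have w': "ip u w = H u \<phi>" if "u \<in> S" for u using w that ip_sym by metis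
    have H: "\<tau> * H (U j n) \<phi> = coeff_sum (pCons 0 (p * rk_stab_poly c d n)) (\<lambda>i. ip (?D i) \<phi>)" if "n \<le> k" for n
    proof -
      have "H (U j n) \<phi> = ip (U j n) w" using w' Us that by simp
      also have "\<dots> = coeff_sum (p * rk_stab_poly c d n) (\<lambda>i. ip (?D i) w)"
        using less.IH[of n w] that less.prems Suc w(1) by simp
      also have "\<dots> = coeff_sum (p * rk_stab_poly c d n) (\<lambda>i. H (?D i) \<phi>)"
        using w' Di by simp
      finally have "\<tau> * H (U j n) \<phi> = coeff_sum (p * rk_stab_poly c d n) (\<lambda>i. H (?D i) \<phi> * \<tau>)"
        unfolding coeff_sum_mult_x by simp
      also have "\<dots> = coeff_sum (p * rk_stab_poly c d n) (\<lambda>i. ip (?D (Suc i)) \<phi>)"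
        using tdiff_Suc[OF u \<open>\<phi> \<in> S\<close>] by (simp add: mult.commute del: tdiff.simps)
      finally show ?thesis unfolding coeff_sum_pCons .
    qed
    have "ip (U j l) \<phi> = (\<Sum>n\<le>k. c k n * ip (U j n) \<phi> + \<tau> * d k n * H (U j n) \<phi>)"
      using tr j less.prems Suc unfolding rk_traj_def by simp
    also have "\<dots> = (\<Sum>n\<le>k. c k n * coeff_sum (p * rk_stab_poly c d n) (\<lambda>i. ip (?D i) \<phi>)
        + d k n * coeff_sum (pCons 0 (p * rk_stab_poly c d n)) (\<lambda>i. ip (?D i) \<phi>))"
    proof (intro sum.cong refl)
      fix n assume "n \<in> {..k}"
      then have "n \<le> k" by simp
      then have "ip (U j n) \<phi> = coeff_sum (p * rk_stab_poly c d n) (\<lambda>i. ip (?D i) \<phi>)"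
        using less.IH[of n \<phi>] less.prems Suc by simp
      then show "c k n * ip (U j n) \<phi> + \<tau> * d k n * H (U j n) \<phi> =
          c k n * coeff_sum (p * rk_stab_poly c d n) (\<lambda>i. ip (?D i) \<phi>)
          + d k n * coeff_sum (pCons 0 (p * rk_stab_poly c d n)) (\<lambda>i. ip (?D i) \<phi>)"
        unfolding H[OF \<open>n \<le> k\<close>, symmetric] by simp
    qed
    also have "\<dots> = coeff_sum (p * rk_stab_poly c d l) (\<lambda>i. ip (?D i) \<phi>)"
      unfolding Suc rk_stab_poly_Suc sum_distrib_left coeff_sum_sum
      by (simp add: distrib_left coeff_sum_add coeff_sum_smult del: smult_pCons)
    finally show ?thesis .
  qed
qed

lemma rk_expansion:
  assumes tr: "rk_traj S ip H c d s \<tau> m U" and "1 \<le> s" and "j \<le> m" and "\<phi> \<in> S"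
  shows "ip (U j 0) \<phi> = coeff_sum (rk_stab_poly c d s ^ j) (\<lambda>i. ip (tdiff \<tau> (U 0 0) i) \<phi>)"
  using \<open>j \<le> m\<close> \<open>\<phi> \<in> S\<close>
proof (induction j arbitrary: \<phi>)
  case 0
  then show ?case by (simp add: coeff_sum_def)
next
  case (Suc j)
  have "U (Suc j) 0 = U j s" using tr Suc.prems unfolding rk_traj_def by simp
  then show ?case
    using rk_stage_expansion[OF tr \<open>1 \<le> s\<close>, of j "rk_stab_poly c d s ^ j" s \<phi>] Suc by (simp add: mult.commute)
qed

lemma gram_sum:
  assumes "\<And>i. e i \<in> S" and "\<And>i j. Q i j = B (e i) (e j)"
    and B1: "\<And>u v w c. u \<in> S \<Longrightarrow> v \<in> S \<Longrightarrow> w \<in> S \<Longrightarrow> B (comb c u v) w = B u w + c * B v w"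
    and B2: "\<And>u v w c. u \<in> S \<Longrightarrow> v \<in> S \<Longrightarrow> w \<in> S \<Longrightarrow> B w (comb c u v) = B w u + c * B w v"
    and B0: "\<And>u. u \<in> S \<Longrightarrow> 0 \<le> B u u" and Bs: "\<And>u v. u \<in> S \<Longrightarrow> v \<in> S \<Longrightarrow> B u v = B v u"
  shows "psd_gram Q"
  unfolding psd_gram_def
proof (intro conjI allI)
  show "Q i j = Q j i" for i j using assms by metis
  fix n c
  define v where "v = lincomb (e 0) n c e"
  have v: "v \<in> S" unfolding v_def using assms(1) by (intro lincomb_in)
  have "B v v = (\<Sum>i<n. c i * B (e i) v)"
    unfolding v_def by (rule lincomb_linear[of "\<lambda>x. B x _"]) (use B1 v assms(1) in \<open>auto simp: v_def\<close>)
  also have "\<dots> = (\<Sum>i<n. c i * (\<Sum>j<n. c j * B (e i) (e j)))"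
  proof (intro sum.cong refl)
    fix i
    have "B (e i) v = (\<Sum>j<n. c j * B (e i) (e j))"
      unfolding v_def by (rule lincomb_linear) (use B2 assms(1) in auto)
    then show "c i * B (e i) v = c i * (\<Sum>j<n. c j * B (e i) (e j))" by simp
  qed
  also have "\<dots> = (\<Sum>i<n. \<Sum>j<n. c i * c j * Q i j)" by (simp add: assms(2) sum_distrib_left mult.assoc)
  finally show "0 \<le> (\<Sum>i<n. \<Sum>j<n. c i * c j * Q i j)" using B0[OF v] by simp
qed

lemma tdiff_energy_grams:
  assumes u: "u \<in> S" and "0 < \<tau>"
  defines "D \<equiv> tdiff \<tau> u"
  shows "energy_grams (2 * K * \<tau>) (\<lambda>i j. ip (D i) (D j)) (\<lambda>i j. - \<tau> * (H (D i) (D j) + H (D j) (D i)) / 2)"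
  unfolding energy_grams_def
proof (intro conjI allI)
  have D: "D i \<in> S" for i unfolding D_def using u by (rule tdiff_in)
  have D1: "ip (D (Suc i)) v = \<tau> * H (D i) v" if "v \<in> S" for i v unfolding D_def using u that by (rule tdiff_Suc)
  show "psd_gram (\<lambda>i j. ip (D i) (D j))"
    by (rule gram_sum[where e = D and B = ip])
      (use D ip_comb ip_comb_right ip_nonneg ip_sym in auto)
  show "psd_gram (\<lambda>i j. - \<tau> * (H (D i) (D j) + H (D j) (D i)) / 2)"
    by (rule gram_sum[where e = D and B = "\<lambda>u v. - \<tau> * (H u v + H v u) / 2"])
      (use D H_comb_left H_comb_right H_diss \<open>0 < \<tau>\<close> in \<open>auto simp: algebra_simps mult_le_0_iff add_divide_distrib diff_divide_distrib\<close>)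
  show "ip (D (Suc i)) (D j) + ip (D i) (D (Suc j)) = - 2 * (- \<tau> * (H (D i) (D j) + H (D j) (D i)) / 2)" for i j
    using D1[OF D] ip_sym[OF D D] by (simp add: algebra_simps)
  fix i
  have "\<bar>H (D i) (D i)\<bar> \<le> K * (ip (D i) (D i) + ip (D i) (D i))" using D by (intro H_bound)
  then have "- H (D i) (D i) \<le> 2 * K * ip (D i) (D i)" by simp
  then have "\<tau> * - H (D i) (D i) \<le> \<tau> * (2 * K * ip (D i) (D i))" using \<open>0 < \<tau>\<close> by (intro mult_left_mono) auto
  then show "- \<tau> * (H (D i) (D i) + H (D i) (D i)) / 2 \<le> 2 * K * \<tau> * ip (D i) (D i)" by (simp add: algebra_simps)
  define x where "x = ip (D i) (D i)"
  define y where "y = ip (D (Suc i)) (D (Suc i))"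
  \<comment> \<open>With this weight the bound for \<open>y\<close> reads y \<le> a^2 x / 2 + y / 2,
    and the last summand is absorbed on the left.\<close>
  define a where "a = 2 * K * \<tau>"
  have a: "0 < a" using K_pos \<open>0 < \<tau>\<close> by (simp add: a_def)
  have "y = \<tau> * H (D i) (D (Suc i))" unfolding y_def using D1[OF D] .
  also have "\<dots> \<le> \<tau> * (K * (a * x + y / a))"
    unfolding x_def y_def using H_scaled_bound[OF D D a, of i "Suc i"] \<open>0 < \<tau>\<close> by (intro mult_left_mono) auto
  also have "\<dots> = a\<^sup>2 * x / 2 + y / 2" using a K_pos \<open>0 < \<tau>\<close> by (simp add: a_def power2_eq_square field_simps)
  finally show "ip (D (Suc i)) (D (Suc i)) \<le> (2 * K * \<tau>)\<^sup>2 * ip (D i) (D i)"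
    by (simp add: x_def y_def a_def)
qed

theorem rk_energy:
  assumes tr: "rk_traj S ip H c d s \<tau> m U" and "1 \<le> s" and "0 < \<tau>"
  shows "\<exists>g G. energy_grams (2 * K * \<tau>) g G \<and> g 0 0 = ip (U 0 0) (U 0 0) \<and>
    ip (U m 0) (U m 0) = (\<Sum>i\<le>m * s. \<Sum>j\<le>m * s. rk_alpha c d s m i * rk_alpha c d s m j * g i j)"
proof (intro exI conjI)
  have u: "U 0 0 \<in> S" using tr unfolding rk_traj_def by blast
  let ?D = "tdiff \<tau> (U 0 0)" and ?\<alpha> = "rk_alpha c d s m"
  have Um: "U m 0 \<in> S" using rk_traj_in(1)[OF tr \<open>1 \<le> s\<close>] by simp
  show "energy_grams (2 * K * \<tau>) (\<lambda>i j. ip (?D i) (?D j)) (\<lambda>i j. - \<tau> * (H (?D i) (?D j) + H (?D j) (?D i)) / 2)"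
    using u \<open>0 < \<tau>\<close> by (rule tdiff_energy_grams)
  have "degree (rk_stab_poly c d s ^ m) \<le> m * s"
    using order_trans[OF degree_power_le[of "rk_stab_poly c d s" m] mult_le_mono1[OF degree_rk_stab_poly[of c d s], of m]]
    by (simp add: mult.commute)
  then have ex: "ip (U m 0) \<phi> = (\<Sum>i\<le>m * s. ?\<alpha> i * ip (?D i) \<phi>)" if "\<phi> \<in> S" for \<phi>
    using rk_expansion[OF tr \<open>1 \<le> s\<close> order.refl that] by (simp add: coeff_sum_eq rk_alpha_def)
  have "ip (U m 0) (U m 0) = (\<Sum>i\<le>m * s. ?\<alpha> i * ip (U m 0) (?D i))"
    using ex[OF Um] ip_sym[OF tdiff_in[OF u] Um] by simp
  also have "\<dots> = (\<Sum>i\<le>m * s. \<Sum>j\<le>m * s. ?\<alpha> i * ?\<alpha> j * ip (?D i) (?D j))"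
    using ip_sym[OF tdiff_in[OF u] tdiff_in[OF u]] by (simp add: ex[OF tdiff_in[OF u]] sum_distrib_left mult_ac)
  finally show "ip (U m 0) (U m 0) = (\<Sum>i\<le>m * s. \<Sum>j\<le>m * s. ?\<alpha> i * ?\<alpha> j * ip (?D i) (?D j))" .
qed simp

end

section \<open>From energy bounds to the stability notions\<close>

lemma power_ratio_le:
  fixes \<tau> h :: real
  assumes "0 < \<tau>" "0 < h" "2 \<le> q" "\<tau> \<le> h powr (1 + 1 / (real q - 1))"
  shows "(\<tau> / h) ^ q \<le> \<tau>"
proof -
  \<comment> \<open>The power \<open>q - 1\<close> removes the fraction, as (1 + 1/(q - 1)) (q - 1)
    = q. One further factor \<tau> on both sides gives \<tau>^q \<le> \<tau> h^q.\<close>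
  have "\<tau> ^ (q - 1) \<le> (h powr (1 + 1 / (real q - 1))) ^ (q - 1)" using assms by (intro power_mono) auto
  also have "\<dots> = h powr ((1 + 1 / (real q - 1)) * real (q - 1))"
    using assms by (simp add: powr_powr flip: powr_realpow)
  also have "(1 + 1 / (real q - 1)) * real (q - 1) = real q"
    using assms by (simp add: field_simps)
  also have "h powr real q = h ^ q" using assms by (simp add: powr_realpow)
  finally have "\<tau> * \<tau> ^ (q - 1) \<le> \<tau> * h ^ q" using assms by (intro mult_left_mono) auto
  also have "\<tau> * \<tau> ^ (q - 1) = \<tau> ^ q" using assms by (simp add: power_eq_if)
  finally show ?thesis using assms by (simp add: power_divide divide_le_eq)
qed

text \<open>Consistency of the scheme thus yields \<open>\<alpha> 0 = 1\<close> and
  \<open>\<alpha> 1 = m\<close>: the normalisation of the energy identity, and the sign that puts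
  the contribution index at 1 or above.\<close>

lemma coeff_power_1:
  assumes "coeff (p :: real poly) 0 = 1"
  shows "coeff (p ^ m) 0 = 1" and "coeff (p ^ m) 1 = of_nat m * coeff p 1"
proof -
  show 0: "coeff (p ^ m) 0 = 1" for m using assms by (induction m) (auto simp: coeff_mult_0)
  show "coeff (p ^ m) 1 = of_nat m * coeff p 1"
  proof (induction m)
    case (Suc m)
    then show ?case using 0[of m] assms by (simp add: coeff_mult algebra_simps)
  qed simp
qed

text \<open>The operation \<open>comb\<close> may vary with the mesh, whereas \<open>K\<close> is
  common to all of them. A mesh enters the energy bounds through the value of \<open>t\<close>
  alone, so thresholds for \<open>t\<close> become thresholds for \<tau> / h that hold
  uniformly.\<close>

lemma stability_of_energy_spaces:
  fixes S :: "'m \<Rightarrow> 'a set"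
  assumes "1 \<le> s" "1 \<le> r" "1 \<le> m"
    and ord: "\<forall>j\<le>r. coeff (rk_stab_poly c d s) j = 1 / fact j"
    and tix: "is_termination_index (rk_alpha c d s m) (m * s) \<zeta>"
    and K: "0 < K" and h: "\<And>\<mu>. \<mu> \<in> Ms \<Longrightarrow> 0 < h \<mu>"
    and es: "\<And>\<mu>. \<mu> \<in> Ms \<Longrightarrow> \<exists>comb. energy_space (S \<mu>) comb (ip \<mu>) (H \<mu>) (K / h \<mu>)"
  defines "\<rho> \<equiv> contribution_index (rk_alpha c d s m) (m * s) \<zeta>"
    and "a \<equiv> fst (mt_AB (rk_alpha c d s m) (m * s) \<zeta>) \<zeta> \<zeta>"
  shows "\<rho> = \<zeta> \<Longrightarrow> a < 0 \<Longrightarrow> monotonically_stable Ms h S ip H c d s m"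
    and "\<rho> = \<zeta> \<Longrightarrow> weak_stable (2 * \<zeta>) Ms h S ip H c d s m"
    and "\<rho> < \<zeta> \<Longrightarrow> weak_stable (2 * \<rho> + 1) Ms h S ip H c d s m"
proof -
  define \<alpha> where "\<alpha> = rk_alpha c d s m"
  define E where "E g = (\<Sum>i\<le>m * s. \<Sum>j\<le>m * s. \<alpha> i * \<alpha> j * g i j)" for g :: "nat \<Rightarrow> nat \<Rightarrow> real"
  have c0: "coeff (rk_stab_poly c d s) 0 = 1" using ord by simp
  have c1: "coeff (rk_stab_poly c d s) 1 = 1" using ord \<open>1 \<le> r\<close> by simp
  have \<alpha>: "\<alpha> 0 = 1" "0 < \<alpha> 1"
    using coeff_power_1[OF c0, of m] c1 \<open>1 \<le> m\<close> by (auto simp: \<alpha>_def rk_alpha_def)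
  have ms: "0 < m * s" using assms(1,3) by simp
  note bounds = energy_bounds[OF tix, folded \<alpha>_def \<rho>_def a_def E_def, OF \<alpha> ms]
  have \<rho>: "1 \<le> \<rho>" using contribution_index_props(1)[OF tix] \<alpha> ms unfolding \<rho>_def \<alpha>_def by simp
  have en: "\<exists>g G. energy_grams (2 * K * (\<tau> / h \<mu>)) g G \<and> g 0 0 = ip \<mu> (U 0 0) (U 0 0) \<and> 0 \<le> g 0 0
      \<and> ip \<mu> (U m 0) (U m 0) = E g \<and> 0 \<le> E g"
    if "\<mu> \<in> Ms" "0 < \<tau>" and tr: "rk_traj (S \<mu>) (ip \<mu>) (H \<mu>) c d s \<tau> m U" for \<mu> \<tau> U
  proof -
    obtain comb where "energy_space (S \<mu>) comb (ip \<mu>) (H \<mu>) (K / h \<mu>)" using es[OF \<open>\<mu> \<in> Ms\<close>] by blast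
    then interpret energy_space "S \<mu>" comb "ip \<mu>" "H \<mu>" "K / h \<mu>" .
    obtain g G where "energy_grams (2 * (K / h \<mu>) * \<tau>) g G" "g 0 0 = ip \<mu> (U 0 0) (U 0 0)" "ip \<mu> (U m 0) (U m 0) = E g"
      using rk_energy[OF tr \<open>1 \<le> s\<close> \<open>0 < \<tau>\<close>] unfolding E_def \<alpha>_def by blast
    \<comment> \<open>Recorded because the stability notions square a square root, which gives back
      the energy only if it is nonnegative.\<close>
    moreover have "0 \<le> ip \<mu> (U 0 0) (U 0 0)" "0 \<le> ip \<mu> (U m 0) (U m 0)"
      using rk_traj_in(1)[OF tr \<open>1 \<le> s\<close>] ip_nonneg by auto
    ultimately show ?thesis by (intro exI[of _ g] exI[of _ G]) simp
  qed
  show "monotonically_stable Ms h S ip H c d s m" if "\<rho> = \<zeta>" "a < 0"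
  proof -
    obtain t0 where t0: "0 < t0" "\<And>t g G. energy_grams t g G \<Longrightarrow> 0 \<le> t \<Longrightarrow> t \<le> t0 \<Longrightarrow> E g \<le> g 0 0"
      using bounds(1)[OF \<open>\<rho> = \<zeta>\<close> \<open>a < 0\<close>] unfolding E_def by blast
    show ?thesis unfolding monotonically_stable_def
    proof (intro exI[of _ "t0 / (2 * K)"] conjI ballI allI impI; (elim conjE)?)
      fix \<mu> \<tau> U assume \<mu>: "\<mu> \<in> Ms" and \<tau>: "0 < \<tau>" "\<tau> \<le> t0 / (2 * K) * h \<mu>"
        and tr: "rk_traj (S \<mu>) (ip \<mu>) (H \<mu>) c d s \<tau> m U"
      obtain g G where g: "energy_grams (2 * K * (\<tau> / h \<mu>)) g G" "g 0 0 = ip \<mu> (U 0 0) (U 0 0)" "ip \<mu> (U m 0) (U m 0) = E g"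
        using en[OF \<mu> \<tau>(1) tr] by blast
      have "2 * K * (\<tau> / h \<mu>) \<le> t0" "0 \<le> 2 * K * (\<tau> / h \<mu>)" using \<tau> h[OF \<mu>] K by (auto simp: field_simps)
      then show "sqrt (ip \<mu> (U m 0) (U m 0)) \<le> sqrt (ip \<mu> (U 0 0) (U 0 0))"
        using t0(2)[OF g(1)] g by simp
    qed (use t0 K in auto)
  qed
  have weak: "weak_stable q Ms h S ip H c d s m"
    if "2 \<le> q" and ex: "\<exists>C\<ge>0. \<forall>t g G. energy_grams t g G \<and> 0 \<le> t \<and> t \<le> 1 \<longrightarrow> E g \<le> (1 + C * t ^ q) * g 0 0" for q
  proof -
    obtain C where C: "0 \<le> C" "\<And>t g G. energy_grams t g G \<Longrightarrow> 0 \<le> t \<Longrightarrow> t \<le> 1 \<Longrightarrow> E g \<le> (1 + C * t ^ q) * g 0 0"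
      using ex by blast
    show ?thesis unfolding weak_stable_def
    \<comment> \<open>The first witness makes \<open>t\<close> at most 1. In the second one
      \<open>(2 * K) ^ q\<close> is what \<open>t ^ q\<close> has beyond (\<tau>/h)^q, and 1 is
      added for positivity.\<close>
    proof (rule exI[of _ "1 / (2 * K)"], intro exI[of _ "C * (2 * K) ^ q + 1"] conjI ballI allI impI; (elim conjE)?)
      fix \<mu> \<tau> U assume \<mu>: "\<mu> \<in> Ms" and \<tau>: "0 < \<tau>" "\<tau> \<le> 1 / (2 * K) * h \<mu>" "\<tau> \<le> h \<mu> powr (1 + 1 / (real q - 1))"
        and tr: "rk_traj (S \<mu>) (ip \<mu>) (H \<mu>) c d s \<tau> m U"
      obtain g G where g: "energy_grams (2 * K * (\<tau> / h \<mu>)) g G" "g 0 0 = ip \<mu> (U 0 0) (U 0 0)" "0 \<le> g 0 0"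
          "ip \<mu> (U m 0) (U m 0) = E g" "0 \<le> E g"
        using en[OF \<mu> \<tau>(1) tr] by blast
      have "2 * K * (\<tau> / h \<mu>) \<le> 1" "0 \<le> 2 * K * (\<tau> / h \<mu>)" using \<tau> h[OF \<mu>] K by (auto simp: field_simps)
      then have "E g \<le> (1 + C * (2 * K * (\<tau> / h \<mu>)) ^ q) * g 0 0" using C(2)[OF g(1)] by blast
      also have "\<dots> \<le> (1 + (C * (2 * K) ^ q + 1) * \<tau>) * g 0 0"
      proof (intro mult_right_mono)
        have "C * (2 * K) ^ q * (\<tau> / h \<mu>) ^ q \<le> C * (2 * K) ^ q * \<tau>"
          using power_ratio_le[OF \<tau>(1) h[OF \<mu>] \<open>2 \<le> q\<close> \<tau>(3)] C K by (intro mult_left_mono) auto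
        then show "1 + C * (2 * K * (\<tau> / h \<mu>)) ^ q \<le> 1 + (C * (2 * K) ^ q + 1) * \<tau>"
          using \<tau> unfolding power_mult_distrib by (simp add: algebra_simps)
      qed fact
      finally show "(sqrt (ip \<mu> (U m 0) (U m 0)))\<^sup>2 \<le> (1 + (C * (2 * K) ^ q + 1) * \<tau>) * (sqrt (ip \<mu> (U 0 0) (U 0 0)))\<^sup>2"
        using g by simp
    qed (use C K in \<open>auto simp: add_nonneg_pos\<close>)
  qed
  show "weak_stable (2 * \<zeta>) Ms h S ip H c d s m" if "\<rho> = \<zeta>"
    using weak[of "2 * \<zeta>"] bounds(2)[OF that] \<rho> that unfolding E_def by simp
  show "weak_stable (2 * \<rho> + 1) Ms h S ip H c d s m" if "\<rho> < \<zeta>"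
    using weak[of "2 * \<rho> + 1"] bounds(3)[OF that] \<rho> unfolding E_def by simp
qed

section \<open>Inverse inequalities\<close>

lemmas hk_integral_add = Henstock_Kurzweil_Integration.integral_add
  and hk_integral_diff = Henstock_Kurzweil_Integration.integral_diff
  and hk_integral_sum = Henstock_Kurzweil_Integration.integral_sum
  and hk_integral_combine = Henstock_Kurzweil_Integration.integral_combine
  and hk_integral_mult_right = Henstock_Kurzweil_Integration.integral_mult_right

text \<open>The difference 2^j p(x/2) - p(x) no longer contains the monomial x^j.\<close>

lemma monomial_coeff_L2_bound:
  assumes "finite A" and "i \<in> A"
  shows "\<exists>C\<ge>0. \<forall>c. (c i)\<^sup>2 \<le> C * integral {0..1} (\<lambda>x. (\<Sum>j\<in>A. c j * x ^ j)\<^sup>2 :: real)"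
  using assms
proof (induction A arbitrary: i rule: finite_psubset_induct)
  case (psubset A)
  show ?case
  proof (cases "A = {i}")
    case True
    have "((\<lambda>x::real. x ^ (2 * i)) has_integral (1 ^ Suc (2 * i) / real (Suc (2 * i)) - 0 ^ Suc (2 * i) / real (Suc (2 * i)))) {0..1}"
      by (rule fundamental_theorem_of_calculus)
        (auto intro!: derivative_eq_intros simp: has_real_derivative_iff_has_vector_derivative[symmetric] simp del: power_Suc of_nat_Suc)
    then have "integral {0..1} (\<lambda>x::real. x ^ (2 * i)) = 1 / real (Suc (2 * i))" by (simp add: integral_unique)
    then have "(c i)\<^sup>2 = real (Suc (2 * i)) * integral {0..1} (\<lambda>x. (\<Sum>j\<in>A. c j * x ^ j)\<^sup>2 :: real)" for c
      by (simp add: True power_mult_distrib power_mult[symmetric] mult.commute[of _ 2] del: of_nat_Suc)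
    then show ?thesis by (intro exI[of _ "real (Suc (2 * i))"]) auto
  next
    case False
    then obtain j where j: "j \<in> A" "j \<noteq> i" using psubset.prems by blast
    define B where "B = A - {j}"
    have B: "B \<subset> A" "i \<in> B" "finite B" "A = insert j B" "j \<notin> B"
      using j psubset.prems psubset.hyps by (auto simp: B_def)
    obtain C where C: "C \<ge> 0" "\<And>c. (c i)\<^sup>2 \<le> C * integral {0..1} (\<lambda>x. (\<Sum>j\<in>B. c j * x ^ j)\<^sup>2 :: real)"
      using psubset.IH[OF B(1,2)] by blast
    have "(c i)\<^sup>2 \<le> (4 * C * (4 * 4 ^ j + 2)) * integral {0..1} (\<lambda>x. (\<Sum>j\<in>A. c j * x ^ j)\<^sup>2 :: real)" for c
    proof -
      define p where "p x = (\<Sum>j\<in>A. c j * x ^ j)" for x :: real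
      \<comment> \<open>The factor is 0 for \<open>l = j\<close> and has modulus at least 1/2 for
        every other exponent, so no remaining coefficient is lost.\<close>
      define c' where "c' l = (2 ^ j * (1 / 2) ^ l - 1) * c l" for l
      define q where "q x = 2 ^ j * p (x / 2) - p x" for x
      have q: "q x = (\<Sum>l\<in>B. c' l * x ^ l)" for x
      proof -
        have "q x = (\<Sum>l\<in>A. 2 ^ j * (c l * (x / 2) ^ l) - c l * x ^ l)"
          by (simp only: q_def p_def sum_distrib_left sum_subtractf)
        also have "\<dots> = (\<Sum>l\<in>A. c' l * x ^ l)"
          by (intro sum.cong refl) (simp add: c'_def power_divide algebra_simps)
        also have "\<dots> = (\<Sum>l\<in>B. c' l * x ^ l)"
          using B by (simp add: c'_def power_divide)
        finally show ?thesis .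
      qed
      have cont: "continuous_on X p" for X unfolding p_def by (intro continuous_intros)
      have int: "(\<lambda>x. (p x)\<^sup>2) integrable_on {0..1}"
        by (intro integrable_continuous_interval continuous_intros cont)
      have cont2: "continuous_on {0..1} (\<lambda>x. p (x / 2))" unfolding p_def by (intro continuous_intros) auto
      have int2: "(\<lambda>x. (p (x / 2))\<^sup>2) integrable_on {0..1}"
        by (intro integrable_continuous_interval continuous_intros cont2)
      have half: "integral {0..1} (\<lambda>x. (p (x / 2))\<^sup>2) \<le> 2 * integral {0..1} (\<lambda>x. (p x)\<^sup>2)"
      proof -
        have i2: "(\<lambda>x. (p x)\<^sup>2) integrable_on {0..1/2}"
          by (intro integrable_continuous_interval continuous_intros cont)
        have "((\<lambda>x. (p ((1/2) *\<^sub>R x + 0))\<^sup>2) has_integral (integral {0..1/2} (\<lambda>x. (p x)\<^sup>2) /\<^sub>R (1/2) ^ DIM(real)))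
            (cbox ((0 - 0) /\<^sub>R (1/2)) ((1/2 - 0) /\<^sub>R (1/2)))"
          by (rule has_integral_affinity') (use i2 in \<open>auto simp: integrable_integral\<close>)
        then have "integral {0..1} (\<lambda>x. (p (x / 2))\<^sup>2) = 2 * integral {0..1/2} (\<lambda>x. (p x)\<^sup>2)"
          by (simp add: integral_unique)
        also have "\<dots> \<le> 2 * integral {0..1} (\<lambda>x. (p x)\<^sup>2)"
          using integral_subset_le[OF _ i2 int] by simp
        finally show ?thesis .
      qed
      have "integral {0..1} (\<lambda>x. (q x)\<^sup>2) \<le> integral {0..1} (\<lambda>x. 2 * 4 ^ j * (p (x / 2))\<^sup>2 + 2 * (p x)\<^sup>2)"
      proof (rule integral_le)
        show "(\<lambda>x. (q x)\<^sup>2) integrable_on {0..1}" unfolding q_def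
          by (intro integrable_continuous_interval continuous_intros cont cont2)
        show "(\<lambda>x. 2 * 4 ^ j * (p (x / 2))\<^sup>2 + 2 * (p x)\<^sup>2) integrable_on {0..1}"
          by (intro integrable_continuous_interval continuous_intros cont cont2)
        fix x :: real
        have "(q x)\<^sup>2 \<le> 2 * (2 ^ j * p (x / 2))\<^sup>2 + 2 * (p x)\<^sup>2"
          unfolding q_def using zero_le_power2[of "2 ^ j * p (x / 2) + p x"]
          by (simp add: power2_eq_square algebra_simps)
        also have "(2 ^ j * p (x / 2))\<^sup>2 = 4 ^ j * (p (x / 2))\<^sup>2"
          by (simp add: power_mult_distrib power_mult[symmetric] mult.commute[of j 2]) (simp add: power_mult)
        finally show "(q x)\<^sup>2 \<le> 2 * 4 ^ j * (p (x / 2))\<^sup>2 + 2 * (p x)\<^sup>2" by simp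
      qed
      also have "\<dots> = 2 * 4 ^ j * integral {0..1} (\<lambda>x. (p (x / 2))\<^sup>2) + 2 * integral {0..1} (\<lambda>x. (p x)\<^sup>2)"
        by (subst integral_add) (use int int2 in \<open>auto intro: integrable_on_mult_right\<close>)
      also have "\<dots> \<le> 2 * 4 ^ j * (2 * integral {0..1} (\<lambda>x. (p x)\<^sup>2)) + 2 * integral {0..1} (\<lambda>x. (p x)\<^sup>2)"
        using half by (intro add_right_mono mult_left_mono) auto
      finally have qI: "integral {0..1} (\<lambda>x. (q x)\<^sup>2) \<le> (4 * 4 ^ j + 2) * integral {0..1} (\<lambda>x. (p x)\<^sup>2)"
        by (simp add: algebra_simps)
      \<comment> \<open>The worst case is \<open>i = j + 1\<close>, where the factor is -1/2; for
        \<open>i < j\<close> it is at least 1.\<close>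
      have fac: "1 / 4 \<le> (2 ^ j * (1 / 2) ^ i - 1 :: real)\<^sup>2"
      proof (cases "i < j")
        case True
        then have "(2::real) ^ j = 2 ^ (j - i) * 2 ^ i" by (simp flip: power_add)
        then have e: "(2 ^ j * (1 / 2) ^ i :: real) = 2 ^ (j - i)" by (simp add: power_divide)
        have "(2::real) ^ 1 \<le> 2 ^ (j - i)" using True by (intro power_increasing) auto
        then have "(1 / 2)\<^sup>2 \<le> (2 ^ j * (1 / 2) ^ i - 1 :: real)\<^sup>2" unfolding e by (intro power_mono) auto
        then show ?thesis by (simp add: power2_eq_square)
      next
        case False
        then have ij: "j < i" using j by simp
        then have "(2::real) ^ i = 2 ^ (i - j) * 2 ^ j" by (simp flip: power_add)
        then have e: "(2 ^ j * (1 / 2) ^ i :: real) = 1 / 2 ^ (i - j)" by (simp add: power_divide)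
        have "(2::real) ^ 1 \<le> 2 ^ (i - j)" using ij by (intro power_increasing) auto
        then have "1 / 2 \<le> 1 - (2 ^ j * (1 / 2) ^ i :: real)" unfolding e by (simp add: field_simps)
        then have "(1 / 2)\<^sup>2 \<le> (1 - 2 ^ j * (1 / 2) ^ i :: real)\<^sup>2" by (intro power_mono) auto
        then show ?thesis by (simp add: power2_eq_square algebra_simps)
      qed
      have "(c i)\<^sup>2 = 4 * (1 / 4 * (c i)\<^sup>2)" by simp
      also have "\<dots> \<le> 4 * (c' i)\<^sup>2"
        unfolding c'_def power_mult_distrib using fac by (intro mult_left_mono mult_right_mono) auto
      also have "\<dots> \<le> 4 * (C * integral {0..1} (\<lambda>x. (q x)\<^sup>2))" using C(2)[of c'] by (simp add: q)
      also have "\<dots> \<le> 4 * (C * ((4 * 4 ^ j + 2) * integral {0..1} (\<lambda>x. (p x)\<^sup>2)))"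
        using qI C by (intro mult_left_mono) auto
      finally show ?thesis by (simp add: p_def mult.assoc)
    qed
    then show ?thesis using C(1) by (intro exI[of _ "4 * C * (4 * 4 ^ j + 2)"]) auto
  qed
qed

lemma poly_coeff_L2_bound:
  "\<exists>C\<ge>0. \<forall>p. degree p \<le> k \<longrightarrow> (\<forall>i. (coeff p i)\<^sup>2 \<le> C * integral {0..1} (\<lambda>x. (poly p x :: real)\<^sup>2))"
proof -
  have "\<forall>i\<in>{..k}. \<exists>C. C \<ge> 0 \<and> (\<forall>c. (c i)\<^sup>2 \<le> C * integral {0..1} (\<lambda>x. (\<Sum>j\<le>k. c j * x ^ j)\<^sup>2 :: real))"
    using monomial_coeff_L2_bound[OF finite_atMost] by blast
  from bchoice[OF this] obtain C where
    C': "\<forall>i\<in>{..k}. C i \<ge> 0 \<and> (\<forall>c. (c i)\<^sup>2 \<le> C i * integral {0..1} (\<lambda>x. (\<Sum>j\<le>k. c j * x ^ j)\<^sup>2 :: real))" ..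
  then have C: "\<And>i. i \<le> k \<Longrightarrow> C i \<ge> 0"
    "\<And>i c. i \<le> k \<Longrightarrow> (c i)\<^sup>2 \<le> C i * integral {0..1} (\<lambda>x. (\<Sum>j\<le>k. c j * x ^ j)\<^sup>2 :: real)" by blast+
  have nn: "0 \<le> integral {0..1} (\<lambda>x. (poly p x :: real)\<^sup>2)" for p
    by (intro integral_nonneg integrable_continuous_interval continuous_intros) auto
  have "(coeff p i)\<^sup>2 \<le> (\<Sum>i\<le>k. C i) * integral {0..1} (\<lambda>x. (poly p x)\<^sup>2)" if p: "degree p \<le> k" for p i
  proof (cases "i \<le> k")
    case True
    have "poly p x = (\<Sum>j\<le>k. coeff p j * x ^ j)" for x
      unfolding poly_altdef by (rule sum.mono_neutral_left) (use p in \<open>auto simp: coeff_eq_0\<close>)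
    then have "(coeff p i)\<^sup>2 \<le> C i * integral {0..1} (\<lambda>x. (poly p x)\<^sup>2)"
      using C(2)[OF True, of "coeff p"] by simp
    also have "\<dots> \<le> (\<Sum>i\<le>k. C i) * integral {0..1} (\<lambda>x. (poly p x)\<^sup>2)"
      using True C(1) nn by (intro mult_right_mono member_le_sum) auto
    finally show ?thesis .
  next
    case False
    then show ?thesis using p nn C(1) by (auto simp: coeff_eq_0 intro!: mult_nonneg_nonneg sum_nonneg)
  qed
  then show ?thesis using C(1) by (intro exI[of _ "\<Sum>i\<le>k. C i"]) (auto intro!: sum_nonneg)
qed

text \<open>After pulling back to the unit interval, \<open>poly_coeff_L2_bound\<close> controls all
  coefficients and with them values and derivatives. Rescaling the integral contributes one power of
  the length and the squared derivative two more.\<close>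

lemma poly_inverse_inequality:
  "\<exists>C>0. \<forall>p \<alpha> \<beta> x. degree p \<le> k \<and> \<alpha> < \<beta> \<and> x \<in> {\<alpha>..\<beta>} \<longrightarrow>
     (poly p x :: real)\<^sup>2 \<le> C / (\<beta> - \<alpha>) * integral {\<alpha>..\<beta>} (\<lambda>x. (poly p x)\<^sup>2) \<and>
     (poly (pderiv p) x)\<^sup>2 \<le> C / (\<beta> - \<alpha>) ^ 3 * integral {\<alpha>..\<beta>} (\<lambda>x. (poly p x)\<^sup>2)"
proof -
  obtain C where C: "C \<ge> 0" "\<And>p i. degree p \<le> k \<Longrightarrow> (coeff p i)\<^sup>2 \<le> C * integral {0..1} (\<lambda>x. (poly p x :: real)\<^sup>2)"
    using poly_coeff_L2_bound[of k] by blast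
  \<comment> \<open>Evaluating at most k + 1 terms costs one factor \<open>real k + 1\<close>,
    differentiating another; squaring gives the fourth power. The added 1 makes the constant
    positive.\<close>
  define C' where "C' = (real k + 1) ^ 4 * C + 1"
  have "(poly p x)\<^sup>2 \<le> C' / (\<beta> - \<alpha>) * integral {\<alpha>..\<beta>} (\<lambda>x. (poly p x)\<^sup>2) \<and>
     (poly (pderiv p) x)\<^sup>2 \<le> C' / (\<beta> - \<alpha>) ^ 3 * integral {\<alpha>..\<beta>} (\<lambda>x. (poly p x)\<^sup>2)"
    if p: "degree p \<le> k" and ab: "\<alpha> < \<beta>" and x: "x \<in> {\<alpha>..\<beta>}" for p \<alpha> \<beta> x
  proof -
    define L where "L = \<beta> - \<alpha>"
    define I where "I = integral {\<alpha>..\<beta>} (\<lambda>x. (poly p x)\<^sup>2)"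
    define r where "r = pcompose p [:\<alpha>, L:]"
    define t where "t = (x - \<alpha>) / L"
    have L: "0 < L" using ab by (simp add: L_def)
    have t: "0 \<le> t" "t \<le> 1" using x L by (auto simp: t_def L_def)
    have xt: "\<alpha> + t * L = x" using L by (simp add: t_def)
    have dr: "degree r \<le> k" using p L by (simp add: r_def degree_pcompose)
    have I: "0 \<le> I" unfolding I_def by (intro integral_nonneg integrable_continuous_interval continuous_intros) auto
    have "((\<lambda>x. (poly p (L *\<^sub>R x + \<alpha>))\<^sup>2) has_integral (I /\<^sub>R L ^ DIM(real))) (cbox ((\<alpha> - \<alpha>) /\<^sub>R L) ((\<beta> - \<alpha>) /\<^sub>R L))"
      unfolding I_def using L
      by (intro has_integral_affinity') (auto intro!: integrable_integral integrable_continuous_interval continuous_intros)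
    moreover have "(\<beta> - \<alpha>) / L = 1" using L unfolding L_def by simp
    ultimately have "((\<lambda>x. (poly p (L * x + \<alpha>))\<^sup>2) has_integral (I / L)) {0..1}"
      by (simp add: divide_inverse mult.commute)
    then have Ir: "integral {0..1} (\<lambda>x. (poly r x)\<^sup>2) = I / L"
      by (simp add: r_def poly_pcompose algebra_simps integral_unique)
    define s where "s = sqrt (C * (I / L))"
    have s2: "s\<^sup>2 = C * (I / L)" unfolding s_def using C I L by simp
    have s0: "0 \<le> s" unfolding s_def using C I L by simp
    have ci: "\<bar>coeff r i\<bar> \<le> s" for i
      using real_sqrt_le_mono[OF C(2)[OF dr, of i]] unfolding Ir s_def by simp
    have pb: "\<bar>poly q t\<bar> \<le> (real k + 1) * b" if "degree q \<le> k" "\<And>i. i \<le> k \<Longrightarrow> \<bar>coeff q i\<bar> \<le> b" for q b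
    proof -
      have "poly q t = (\<Sum>j\<le>k. coeff q j * t ^ j)"
        unfolding poly_altdef by (rule sum.mono_neutral_left) (use that in \<open>auto simp: coeff_eq_0\<close>)
      also have "\<bar>\<dots>\<bar> \<le> (\<Sum>j\<le>k. \<bar>coeff q j * t ^ j\<bar>)" by (rule sum_abs)
      also have "\<dots> \<le> (\<Sum>j\<le>k. b)"
      proof (intro sum_mono)
        fix j assume "j \<in> {..k}"
        have "\<bar>coeff q j * t ^ j\<bar> = \<bar>coeff q j\<bar> * t ^ j" using t by (simp add: abs_mult)
        also have "\<dots> \<le> \<bar>coeff q j\<bar> * 1" using t by (intro mult_left_mono power_le_one) auto
        also have "\<dots> \<le> b" using that(2) \<open>j \<in> {..k}\<close> by simp
        finally show "\<bar>coeff q j * t ^ j\<bar> \<le> b" .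
      qed
      finally show ?thesis by (simp add: algebra_simps)
    qed
    have "\<bar>poly r t\<bar> \<le> (real k + 1) * s" using dr ci by (rule pb)
    also have "poly r t = poly p x" using xt by (simp add: r_def poly_pcompose)
    finally have 1: "\<bar>poly p x\<bar> \<le> (real k + 1) * s" .
    have "\<bar>poly (pderiv r) t\<bar> \<le> (real k + 1) * ((real k + 1) * s)"
    proof (rule pb)
      show "degree (pderiv r) \<le> k" using dr by (simp add: degree_pderiv)
      show "\<bar>coeff (pderiv r) i\<bar> \<le> (real k + 1) * s" if "i \<le> k" for i
        unfolding coeff_pderiv abs_mult using ci[of "Suc i"] that s0 by (intro mult_mono) auto
    qed
    also have "poly (pderiv r) t = L * poly (pderiv p) x"
      using xt by (simp add: r_def pderiv_pcompose poly_pcompose pderiv_pCons mult.commute)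
    finally have 2: "\<bar>L * poly (pderiv p) x\<bar> \<le> (real k + 1) * ((real k + 1) * s)" .
    have k14: "(real k + 1)\<^sup>2 \<le> (real k + 1) ^ 4" by (intro power_increasing) auto
    have CI: "0 \<le> C * (I / L)" using C I L by simp
    have "(poly p x)\<^sup>2 \<le> ((real k + 1) * s)\<^sup>2" using power_mono[OF 1, of 2] by simp
    also have "\<dots> = (real k + 1)\<^sup>2 * (C * (I / L))" by (simp add: power_mult_distrib s2)
    also have "\<dots> \<le> (real k + 1) ^ 4 * (C * (I / L))" using k14 CI by (intro mult_right_mono)
    also have "\<dots> \<le> C' / L * I" using I L by (simp add: C'_def algebra_simps add_divide_distrib)
    finally have A: "(poly p x)\<^sup>2 \<le> C' / L * I" .
    have "(L * poly (pderiv p) x)\<^sup>2 \<le> ((real k + 1) * ((real k + 1) * s))\<^sup>2" using power_mono[OF 2, of 2] by simp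
    also have "\<dots> = (real k + 1) ^ 4 * (C * (I / L))"
      unfolding power_mult_distrib s2 by (simp add: power2_eq_square power4_eq_xxxx)
    also have "\<dots> \<le> C' / L * I" using I L by (simp add: C'_def algebra_simps add_divide_distrib)
    finally have "(poly (pderiv p) x)\<^sup>2 \<le> C' / L * I / L\<^sup>2"
      using L by (simp add: power_mult_distrib pos_le_divide_eq mult.commute)
    also have "\<dots> = C' / L ^ 3 * I" by (simp add: power3_eq_cube power2_eq_square)
    finally show ?thesis using A unfolding L_def I_def by simp
  qed
  moreover have "C' > 0" using C by (simp add: C'_def add_nonneg_pos)
  ultimately show ?thesis by blast
qed

section \<open>Bounded Borel functions\<close>

lemma compact_abs_bound:
  fixes f :: "'a::topological_space \<Rightarrow> real"
  assumes "compact S" "continuous_on S f" shows "\<exists>M. \<forall>z\<in>S. \<bar>f z\<bar> \<le> M"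
  using compact_imp_bounded[OF compact_continuous_image[OF assms(2,1)]] unfolding bounded_iff by fastforce

text \<open>A class closed under sums, products, slices and partial integrals, whose members are
  integrable over every box. Integrability conditions then follow from the shape of the integrand,
  and Fubini's theorem applies.\<close>

definition bounded_borel :: "('a::euclidean_space \<Rightarrow> real) \<Rightarrow> bool" where
  "bounded_borel f \<longleftrightarrow> f \<in> borel_measurable borel \<and> (\<exists>M. \<forall>x. \<bar>f x\<bar> \<le> M)"

lemma bounded_borel_const [simp]: "bounded_borel (\<lambda>x. c)"
  by (auto simp: bounded_borel_def)

lemma bounded_borel_add: "bounded_borel f \<Longrightarrow> bounded_borel g \<Longrightarrow> bounded_borel (\<lambda>x. f x + g x)"
  unfolding bounded_borel_def by (auto intro!: borel_measurable_add) (metis abs_triangle_ineq add_mono order_trans)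

lemma bounded_borel_mult:
  assumes "bounded_borel f" and "bounded_borel g" shows "bounded_borel (\<lambda>x. f x * g x)"
proof -
  obtain A B where "\<And>x. \<bar>f x\<bar> \<le> A" "\<And>x. \<bar>g x\<bar> \<le> B" using assms unfolding bounded_borel_def by blast
  then have "\<bar>f x * g x\<bar> \<le> A * B" for x
    unfolding abs_mult by (intro mult_mono) (auto intro: order_trans[OF abs_ge_zero])
  then show ?thesis using assms unfolding bounded_borel_def by (auto intro: borel_measurable_times)
qed

lemma bounded_borel_diff: "bounded_borel f \<Longrightarrow> bounded_borel g \<Longrightarrow> bounded_borel (\<lambda>x. f x - g x)"
  using bounded_borel_add[of f "\<lambda>x. - 1 * g x"] bounded_borel_mult[of "\<lambda>x. - 1" g] by simp

lemma bounded_borel_power2: "bounded_borel f \<Longrightarrow> bounded_borel (\<lambda>x. (f x)\<^sup>2)"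
  using bounded_borel_mult[of f f] by (simp add: power2_eq_square)

lemma bounded_borel_sum: "(\<And>i. i \<in> A \<Longrightarrow> bounded_borel (f i)) \<Longrightarrow> bounded_borel (\<lambda>x. \<Sum>i\<in>A. f i x)"
  by (induction A rule: infinite_finite_induct) (auto intro: bounded_borel_add)

lemmas bounded_borel_intros = bounded_borel_const bounded_borel_add bounded_borel_diff bounded_borel_mult
  bounded_borel_power2 bounded_borel_sum

lemma bounded_borel_set_integrable:
  assumes "bounded_borel f" shows "set_integrable lborel (cbox a b) f"
proof -
  obtain M where M: "\<And>x. \<bar>f x\<bar> \<le> M" using assms unfolding bounded_borel_def by blast
  have "set_integrable lborel (cbox a b) (\<lambda>x. M)"
    unfolding set_integrable_def using emeasure_lborel_cbox_finite[of a b] by simp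
  then show ?thesis
    by (rule set_integrable_bound) (use M assms in \<open>auto simp: bounded_borel_def set_borel_measurable_def intro!: borel_measurable_scaleR AE_I2 intro: order_trans[OF _ abs_ge_self]\<close>)
qed

lemma bounded_borel_integrable: "bounded_borel f \<Longrightarrow> f integrable_on cbox a b"
  using set_borel_integral_eq_integral(1) bounded_borel_set_integrable by blast

lemma bounded_borel_integrable_real: "bounded_borel (f :: real \<Rightarrow> real) \<Longrightarrow> f integrable_on {a..b}"
  using bounded_borel_integrable[of f a b] by simp

lemma bounded_borel_slice:
  fixes f :: "real \<times> real \<Rightarrow> real"
  assumes "bounded_borel f" shows "bounded_borel (\<lambda>x. f (x, y))" and "bounded_borel (\<lambda>y. f (x, y))"
proof -
  have f: "f \<in> borel_measurable (borel \<Otimes>\<^sub>M borel)" using assms by (simp add: bounded_borel_def borel_prod)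
  have "(\<lambda>x. f (x, y)) \<in> borel_measurable borel" "(\<lambda>y. f (x, y)) \<in> borel_measurable borel"
    using f by measurable
  then show "bounded_borel (\<lambda>x. f (x, y))" and "bounded_borel (\<lambda>y. f (x, y))"
    using assms by (auto simp: bounded_borel_def)
qed

lemma bounded_borel_swap:
  fixes f :: "real \<times> real \<Rightarrow> real"
  assumes "bounded_borel f" shows "bounded_borel (\<lambda>z. f (snd z, fst z))"
proof -
  have f [measurable]: "f \<in> borel_measurable (borel \<Otimes>\<^sub>M borel)" using assms by (simp add: bounded_borel_def borel_prod)
  have "(\<lambda>z. f (snd z, fst z)) \<in> borel_measurable (borel \<Otimes>\<^sub>M borel)" by measurable
  then show ?thesis using assms by (auto simp: bounded_borel_def borel_prod)
qed

text \<open>Each Henstock-Kurzweil integral is converted to a Lebesgue integral, where joint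
  measurability gives both measurability of the partial integral and Fubini's theorem.\<close>

lemma bounded_borel_integral_fst:
  fixes f :: "real \<times> real \<Rightarrow> real"
  assumes f: "bounded_borel f"
  shows "bounded_borel (\<lambda>y. integral {a..b} (\<lambda>x. f (x, y)))"
    and "integral (cbox (a, c) (b, d)) f = integral {c..d} (\<lambda>y. integral {a..b} (\<lambda>x. f (x, y)))"
proof -
  obtain M where M: "\<And>x. \<bar>f x\<bar> \<le> M" using f unfolding bounded_borel_def by blast
  have fm [measurable]: "f \<in> borel_measurable (borel \<Otimes>\<^sub>M borel)" using f by (simp add: bounded_borel_def borel_prod)
  have eq: "integral {a..b} (\<lambda>x. f (x, y)) = (LINT x:{a..b}|lborel. f (x, y))" for y
    using set_borel_integral_eq_integral(2)[OF bounded_borel_set_integrable[OF bounded_borel_slice(1)[OF f]], of a b y] by simp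
  have m: "(\<lambda>y. integral {a..b} (\<lambda>x. f (x, y))) \<in> borel_measurable borel"
    unfolding eq set_lebesgue_integral_def by measurable
  have "\<bar>integral {a..b} (\<lambda>x. f (x, y))\<bar> \<le> \<bar>M * (b - a)\<bar>" for y
  proof (cases "a \<le> b")
    case True
    have "norm (integral (cbox a b) (\<lambda>x. f (x, y))) \<le> M * measure lborel (cbox a b)"
      using M bounded_borel_integrable[OF bounded_borel_slice(1)[OF f]]
      by (intro integrable_bound) (auto intro: order_trans[OF abs_ge_zero])
    then show ?thesis using True by simp
  qed simp
  then show bb: "bounded_borel (\<lambda>y. integral {a..b} (\<lambda>x. f (x, y)))"
    using m unfolding bounded_borel_def by blast
  have "integral (cbox (a, c) (b, d)) f = (LINT z:cbox (a, c) (b, d)|lborel. f z)"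
    using set_borel_integral_eq_integral(2)[OF bounded_borel_set_integrable[OF f]] by simp
  also have "\<dots> = integral\<^sup>L (lborel \<Otimes>\<^sub>M lborel) (\<lambda>z. indicator (cbox (a, c) (b, d)) z *\<^sub>R f z)"
    by (simp add: set_lebesgue_integral_def lborel_prod)
  also have "\<dots> = (LINT y|lborel. LINT x|lborel. indicator (cbox (a, c) (b, d)) (x, y) *\<^sub>R f (x, y))"
    using bounded_borel_set_integrable[OF f, of "(a, c)" "(b, d)"]
    using lborel_pair.integral_snd[of "\<lambda>x y. indicator (cbox (a, c) (b, d)) (x, y) *\<^sub>R f (x, y)"]
    by (simp add: set_integrable_def lborel_prod case_prod_unfold)
  also have "\<dots> = (LINT y:{c..d}|lborel. LINT x:{a..b}|lborel. f (x, y))"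
    unfolding set_lebesgue_integral_def
    by (intro Bochner_Integration.integral_cong refl) (auto simp: indicator_def cbox_Pair_iff)
  also have "\<dots> = integral {c..d} (\<lambda>y. integral {a..b} (\<lambda>x. f (x, y)))"
    unfolding eq[symmetric]
    using set_borel_integral_eq_integral(2)[OF bounded_borel_set_integrable[OF bb]] by simp
  finally show "integral (cbox (a, c) (b, d)) f = integral {c..d} (\<lambda>y. integral {a..b} (\<lambda>x. f (x, y)))" .
qed

lemma integral_swap_cbox:
  fixes f :: "real \<times> real \<Rightarrow> real"
  assumes f: "bounded_borel f"
  shows "integral (cbox (a, c) (b, d)) f = integral (cbox (c, a) (d, b)) (\<lambda>z. f (snd z, fst z))"
proof -
  note g = bounded_borel_swap[OF f]
  have "integral (cbox (c, a) (d, b)) (\<lambda>z. f (snd z, fst z)) = (LINT z:cbox (c, a) (d, b)|lborel. f (snd z, fst z))"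
    using set_borel_integral_eq_integral(2)[OF bounded_borel_set_integrable[OF g]] by simp
  also have "\<dots> = integral\<^sup>L (lborel \<Otimes>\<^sub>M lborel) (\<lambda>(x, y). indicator (cbox (a, c) (b, d)) (y, x) *\<^sub>R f (y, x))"
    unfolding set_lebesgue_integral_def lborel_prod
    by (intro Bochner_Integration.integral_cong refl) (auto simp: indicator_def cbox_Pair_iff)
  also have "\<dots> = integral\<^sup>L (lborel \<Otimes>\<^sub>M lborel) (\<lambda>z. indicator (cbox (a, c) (b, d)) z *\<^sub>R f z)"
    using f by (intro lborel_pair.integral_product_swap) (auto simp: bounded_borel_def lborel_prod)
  also have "\<dots> = integral (cbox (a, c) (b, d)) f"
    using set_borel_integral_eq_integral(2)[OF bounded_borel_set_integrable[OF f]]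
    by (simp add: set_lebesgue_integral_def lborel_prod)
  finally show ?thesis by simp
qed

lemma borel_measurable_cells:
  fixes A :: "'i::countable \<Rightarrow> 'a::euclidean_space set" and f :: "'a \<Rightarrow> real"
  assumes "\<And>i. A i \<in> sets borel" and "(\<Union>i. A i) = UNIV"
    and "\<And>i. F i \<in> borel_measurable borel" and "\<And>i x. x \<in> A i \<Longrightarrow> f x = F i x"
  shows "f \<in> borel_measurable borel"
proof (rule measurable_piecewise_restrict2[where A = "\<lambda>n. A (from_nat n)"])
  show "space borel = (\<Union>n. A (from_nat n))" using assms(2) by (auto simp: set_eq_iff) (metis from_nat_to_nat)
qed (use assms in auto)

lemma integral_periodic:
  fixes F :: "real \<Rightarrow> real"
  assumes F: "bounded_borel F" and per: "\<And>x. F (x + P) = F x" and "0 \<le> P"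
  shows "integral {a..a + P} F = integral {b..b + P} F"
proof -
  have *: "integral {a..a + P} F = integral {b..b + P} F" if "a \<le> b" for a b
  proof -
    have i: "F integrable_on {u..v}" for u v using F by (rule bounded_borel_integrable_real)
    have "integral {a..a + P} F + integral {a + P..b + P} F = integral {a..b + P} F"
      using that \<open>0 \<le> P\<close> i by (intro hk_integral_combine) auto
    moreover have "integral {a..b} F + integral {b..b + P} F = integral {a..b + P} F"
      using that \<open>0 \<le> P\<close> i by (intro hk_integral_combine) auto
    moreover have "integral {a + P..b + P} F = integral {a..b} F"
      using integral_shift_Icc_real[of a b F P] per by (simp add: o_def add.commute)
    ultimately show ?thesis by simp
  qed
  show ?thesis
  proof (cases "a \<le> b")
    case False
    then show ?thesis using *[of b a] by linarith
  qed (rule *)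
qed

lemma filtermap_at_left_shift: "filtermap (\<lambda>x. x - d) (at_left a) = at_left (a - d)" for a d :: real
  by (simp add: filter_eq_iff eventually_filtermap eventually_at_filter filtermap_nhds_shift[symmetric])

text \<open>The two filters are translates of each other, so the same values are limits on both
  sides, and \<open>Lim\<close>, being a description, agrees whether or not a limit exists.\<close>

lemma Lim_at_left_shift:
  fixes v :: "real \<Rightarrow> real"
  assumes "\<And>x. v (x + P) = v x"
  shows "Lim (at_left (x + P)) v = Lim (at_left x) v"
proof -
  have "at_left x = filtermap (\<lambda>t. t - P) (at_left (x + P))"
    using filtermap_at_left_shift[of P "x + P"] by simp
  moreover have "v (t - P) = v t" for t using assms[of "t - P"] by simp
  ultimately have "(v \<longlongrightarrow> l) (at_left x) \<longleftrightarrow> (v \<longlongrightarrow> l) (at_left (x + P))" for l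
    by (simp only: filterlim_filtermap)
  then show ?thesis unfolding t2_space_class.Lim_def by simp
qed

lemma deriv_shift:
  fixes v :: "real \<Rightarrow> real"
  assumes "\<And>x. v (x + P) = v x"
  shows "deriv v (x + P) = deriv v x"
proof -
  have "(v has_field_derivative D) (at (x + P)) = (v has_field_derivative D) (at x)" for D
    using DERIV_shift[of v D x P] assms by simp
  then show ?thesis unfolding deriv_def by simp
qed

section \<open>The advection form on staggered periodic meshes\<close>

lemma integral_interior_cong:
  fixes f h :: "real \<Rightarrow> real"
  assumes "\<And>t. a < t \<Longrightarrow> t < b \<Longrightarrow> f t = h t"
  shows "integral {a..b} f = integral {a..b} h"
  by (rule integral_spike[of "{a, b}"]) (use assms in auto)

text \<open>Integration by parts on a half cell. The integrand is prescribed only in the interior,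
  because node values of slopes are artificial.\<close>

lemma integral_poly_product_rule:
  fixes p q :: "real poly"
  assumes "a \<le> b" and "\<And>t. a < t \<Longrightarrow> t < b \<Longrightarrow> Z t = poly p t * poly (pderiv q) t + poly q t * poly (pderiv p) t"
  shows "integral {a..b} Z = poly p b * poly q b - poly p a * poly q a"
proof -
  have "((\<lambda>t. poly (pderiv (p * q)) t) has_integral poly (p * q) b - poly (p * q) a) {a..b}"
  proof (rule fundamental_theorem_of_calculus[OF assms(1)])
    fix t
    show "(poly (p * q) has_vector_derivative poly (pderiv (p * q)) t) (at t within {a..b})"
      by (rule has_vector_derivative_at_within)
        (use poly_DERIV[of "p * q" t] in \<open>simp only: has_real_derivative_iff_has_vector_derivative\<close>)
  qed
  moreover have "integral {a..b} Z = integral {a..b} (\<lambda>t. poly (pderiv (p * q)) t)"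
    by (rule integral_interior_cong) (use assms in \<open>simp add: pderiv_mult\<close>)
  ultimately show ?thesis by (simp add: integral_unique)
qed

text \<open>At the nodes \<^const>\<open>deriv\<close> is unspecified; the value 0 keeps the slope bounded and measurable.\<close>

definition slope :: "(int \<Rightarrow> real) \<Rightarrow> (real \<Rightarrow> real) \<Rightarrow> real \<Rightarrow> real" where
  "slope g v x = (if x \<in> range g then 0 else deriv v x)"

text \<open>Fixes one constant per degree, so that it can be named in bounds that have to hold for
  all meshes.\<close>

definition inv_const :: "nat \<Rightarrow> real" where
  "inv_const k = (SOME C. C > 0 \<and> (\<forall>p \<alpha> \<beta> x. degree p \<le> k \<and> \<alpha> < \<beta> \<and> x \<in> {\<alpha>..\<beta>} \<longrightarrow>
     (poly p x :: real)\<^sup>2 \<le> C / (\<beta> - \<alpha>) * integral {\<alpha>..\<beta>} (\<lambda>x. (poly p x)\<^sup>2) \<and>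
     (poly (pderiv p) x)\<^sup>2 \<le> C / (\<beta> - \<alpha>) ^ 3 * integral {\<alpha>..\<beta>} (\<lambda>x. (poly p x)\<^sup>2)))"

lemma inv_const:
  shows "0 < inv_const k"
    and "degree p \<le> k \<Longrightarrow> \<alpha> < \<beta> \<Longrightarrow> x \<in> {\<alpha>..\<beta>} \<Longrightarrow>
      (poly p x)\<^sup>2 \<le> inv_const k / (\<beta> - \<alpha>) * integral {\<alpha>..\<beta>} (\<lambda>x. (poly p x)\<^sup>2)"
    and "degree p \<le> k \<Longrightarrow> \<alpha> < \<beta> \<Longrightarrow> x \<in> {\<alpha>..\<beta>} \<Longrightarrow>
      (poly (pderiv p) x)\<^sup>2 \<le> inv_const k / (\<beta> - \<alpha>) ^ 3 * integral {\<alpha>..\<beta>} (\<lambda>x. (poly p x)\<^sup>2)"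
proof -
  note * = someI_ex[OF poly_inverse_inequality[of k], folded inv_const_def]
  show "0 < inv_const k" using * by (rule conjunct1)
  show "degree p \<le> k \<Longrightarrow> \<alpha> < \<beta> \<Longrightarrow> x \<in> {\<alpha>..\<beta>} \<Longrightarrow>
      (poly p x)\<^sup>2 \<le> inv_const k / (\<beta> - \<alpha>) * integral {\<alpha>..\<beta>} (\<lambda>x. (poly p x)\<^sup>2)"
    "degree p \<le> k \<Longrightarrow> \<alpha> < \<beta> \<Longrightarrow> x \<in> {\<alpha>..\<beta>} \<Longrightarrow>
      (poly (pderiv p) x)\<^sup>2 \<le> inv_const k / (\<beta> - \<alpha>) ^ 3 * integral {\<alpha>..\<beta>} (\<lambda>x. (poly p x)\<^sup>2)"
    using conjunct2[OF *] by blast+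
qed

text \<open>No base point is prescribed, so the cell centres and index shifts of the nodes are
  instances too; integrals over a period do not depend on where it starts.\<close>

locale pmesh =
  fixes k N :: nat and P :: real and g :: "int \<Rightarrow> real"
  assumes N_pos: "0 < N" and mono: "strict_mono g" and per: "\<And>i. g (i + int N) = g i + P"
begin

abbreviation "V \<equiv> dg_space1 k P g"

lemma g_less: "g i < g (i + 1)"
  using mono by (simp add: strict_mono_def)

lemma P_pos: "0 < P"
proof -
  have "g 0 < g (0 + int N)" using mono N_pos by (simp add: strict_mono_def)
  then show ?thesis using per[of 0] by simp
qed

lemma per_mult_nat: "g (i + int n * int N) = g i + real n * P"
proof (induction n)
  case (Suc n)
  then show ?case using per[of "i + int n * int N"] by (simp add: algebra_simps)
qed simp

lemma per_mult: "g (i + j * int N) = g i + of_int j * P"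
proof (cases "0 \<le> j")
  case True
  then show ?thesis using per_mult_nat[of i "nat j"] by simp
next
  case False
  then show ?thesis using per_mult_nat[of "i + j * int N" "nat (- j)"] by (simp add: algebra_simps)
qed

text \<open>Within the period containing \<open>x\<close>, take the last node not exceeding it. The
  end of the period lies beyond \<open>x\<close>, so a following node not exceeding \<open>x\<close>
  would still belong to the same index range.\<close>

lemma cover: "\<exists>i. g i \<le> x \<and> x < g (i + 1)"
proof -
  define j where "j = \<lfloor>(x - g 0) / P\<rfloor>"
  have "of_int j \<le> (x - g 0) / P" "(x - g 0) / P < of_int j + 1" unfolding j_def by linarith+
  then have lo: "g 0 + of_int j * P \<le> x" and hi: "x < g 0 + (of_int j + 1) * P"
    using P_pos by (simp_all add: field_simps)
  define I where "I = {i \<in> {j * int N..<(j + 1) * int N}. g i \<le> x}"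
  have I: "finite I" unfolding I_def by (rule finite_subset[of _ "{j * int N..<(j + 1) * int N}"]) auto
  have jI: "j * int N \<in> I" using lo N_pos per_mult[of 0 j] by (auto simp: I_def algebra_simps)
  define i where "i = Max I"
  have i: "i \<in> I" unfolding i_def using I jI by (intro Max_in) auto
  have "x < g (i + 1)"
  proof (rule ccontr)
    assume "\<not> x < g (i + 1)"
    moreover have "i + 1 \<noteq> (j + 1) * int N"
      using calculation hi per_mult[of 0 "j + 1"] by auto
    ultimately have "i + 1 \<in> I" using i by (auto simp: I_def)
    then have "i + 1 \<le> i" unfolding i_def using I by (intro Max_ge) auto
    then show False by simp
  qed
  then show ?thesis using i by (auto simp: I_def)
qed

lemma cell_not_node: "g i < x \<Longrightarrow> x < g (i + 1) \<Longrightarrow> x \<notin> range g"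
proof
  assume x: "g i < x" "x < g (i + 1)" and "x \<in> range g"
  then obtain j where "x = g j" by auto
  then have "i < j" "j < i + 1" using x strict_mono_less[OF mono] by auto
  then show False by simp
qed

lemma negligible_nodes: "negligible (range g)"
  by (simp add: negligible_iff_null_sets countable_imp_null_set_lborel null_sets_completionI)

lemma periodic_int:
  assumes "\<And>x. v (x + P) = v x" shows "v (x + of_int j * P) = v x"
proof -
  have n: "v (x + real n * P) = v x" for x n
  proof (induction n)
    case (Suc n)
    then show ?case using assms[of "x + real n * P"] by (simp add: algebra_simps)
  qed simp
  show ?thesis
  proof (cases "0 \<le> j")
    case True
    then show ?thesis using n[of x "nat j"] by simp
  next
    case False
    then show ?thesis using n[of "x + of_int j * P" "nat (- j)"] by (simp add: algebra_simps)
  qed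
qed

lemma cell_reduce: "\<exists>i\<in>{0..<int N}. \<exists>j. g i \<le> x - of_int j * P \<and> x - of_int j * P < g (i + 1)"
proof -
  obtain i where i: "g i \<le> x" "x < g (i + 1)" using cover by blast
  define j where "j = i div int N"
  have e: "i = i mod int N + j * int N" by (simp add: j_def)
  have "g i = g (i mod int N) + of_int j * P" "g (i + 1) = g (i mod int N + 1) + of_int j * P"
    using per_mult[of "i mod int N" j] per_mult[of "i mod int N + 1" j] e by (simp_all add: algebra_simps)
  then show ?thesis using i N_pos by (intro bexI[of _ "i mod int N"] exI[of _ j]) auto
qed

lemma width_eq: "g (i + 1) - g i = g (i mod int N + 1) - g (i mod int N)"
proof -
  have e: "i = i mod int N + i div int N * int N" by simp
  have "g i = g (i mod int N) + of_int (i div int N) * P"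
    "g (i + 1) = g (i mod int N + 1) + of_int (i div int N) * P"
    using per_mult[of "i mod int N" "i div int N"] per_mult[of "i mod int N + 1" "i div int N"] e
    by (simp_all add: algebra_simps)
  then show ?thesis by simp
qed

lemma width_min: "\<exists>\<delta>>0. \<forall>i. \<delta> \<le> g (i + 1) - g i"
proof (intro exI conjI allI)
  let ?W = "(\<lambda>i. g (i + 1) - g i) ` {0..<int N}"
  have W: "finite ?W" "?W \<noteq> {}" using N_pos by auto
  show "0 < Min ?W" using W g_less by (subst Min_gr_iff) auto
  show "Min ?W \<le> g (i + 1) - g i" for i
    unfolding width_eq[of i] using W N_pos by (intro Min_le) auto
qed

definition piece :: "(real \<Rightarrow> real) \<Rightarrow> int \<Rightarrow> real poly" where
  "piece v i = (SOME p. degree p \<le> k \<and> (\<forall>x\<in>{g i..<g (i+1)}. v x = poly p x))"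

lemma piece:
  assumes "v \<in> V"
  shows "degree (piece v i) \<le> k" and "g i \<le> x \<Longrightarrow> x < g (i + 1) \<Longrightarrow> v x = poly (piece v i) x"
proof -
  have "\<exists>p. degree p \<le> k \<and> (\<forall>x\<in>{g i..<g (i+1)}. v x = poly p x)"
    using assms by (simp add: dg_space1_def pw_poly1_def)
  from someI_ex[OF this, folded piece_def]
  show "degree (piece v i) \<le> k" and "g i \<le> x \<Longrightarrow> x < g (i + 1) \<Longrightarrow> v x = poly (piece v i) x" by auto
qed

lemma V_periodic: "v \<in> V \<Longrightarrow> v (x + P) = v x"
  by (simp add: dg_space1_def)

lemma left_limit:
  assumes "v \<in> V" shows "(v \<longlongrightarrow> poly (piece v i) (g (i + 1))) (at_left (g (i + 1)))"
proof -
  have "eventually (\<lambda>x. poly (piece v i) x = v x) (at_left (g (i + 1)))"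
    unfolding eventually_at_left_field
    using g_less[of i] piece(2)[OF assms, of i] by (intro exI[of _ "g i"]) auto
  then show ?thesis by (rule Lim_transform_eventually[rotated]) (intro tendsto_intros)
qed

lemma Lim_left: "v \<in> V \<Longrightarrow> Lim (at_left (g (i + 1))) v = poly (piece v i) (g (i + 1))"
  by (intro tendsto_Lim left_limit) simp

text \<open>Cells are half-open to the right, so the polynomial of cell \<open>i\<close> also gives
  the value at its left node; left traces, by contrast, need the polynomial itself.\<close>

lemma Lim_right:
  assumes "v \<in> V" shows "Lim (at_right (g i)) v = v (g i)"
proof -
  have "eventually (\<lambda>x. poly (piece v i) x = v x) (at_right (g i))"
    unfolding eventually_at_right_field
    using g_less[of i] piece(2)[OF assms, of i] by (intro exI[of _ "g (i + 1)"]) auto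
  then have "(v \<longlongrightarrow> poly (piece v i) (g i)) (at_right (g i))"
    by (rule Lim_transform_eventually[rotated]) (intro tendsto_intros)
  then show ?thesis using piece(2)[OF assms, of i "g i"] g_less[of i] by (simp add: tendsto_Lim)
qed

lemma piece_derivative:
  assumes "v \<in> V" "g i < x" "x < g (i + 1)"
  shows "(v has_field_derivative poly (pderiv (piece v i)) x) (at x)"
  by (rule has_field_derivative_transform_within_open[where S = "{g i<..<g (i + 1)}", OF poly_DERIV])
    (use assms piece(2)[OF assms(1), of i] in auto)

lemma slope_piece:
  assumes "v \<in> V" "g i < x" "x < g (i + 1)" shows "slope g v x = poly (pderiv (piece v i)) x"
  using DERIV_imp_deriv[OF piece_derivative[OF assms]] cell_not_node[OF assms(2,3)] by (simp add: slope_def)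

lemma slope_periodic:
  assumes "\<And>x. v (x + P) = v x" shows "slope g v (x + P) = slope g v x"
proof -
  have "x + P \<in> range g \<longleftrightarrow> x \<in> range g"
  proof
    assume "x + P \<in> range g"
    then obtain i where "x + P = g i" by auto
    then have "x = g (i - int N)" using per[of "i - int N"] by simp
    then show "x \<in> range g" by simp
  next
    assume "x \<in> range g"
    then obtain i where "x = g i" by auto
    then have "x + P = g (i + int N)" using per[of i] by simp
    then show "x + P \<in> range g" by (metis rangeI)
  qed
  then show ?thesis using deriv_shift[of v P x] assms by (simp add: slope_def)
qed

lemma V_slope_periodic: "v \<in> V \<Longrightarrow> slope g v (x + P) = slope g v x"
  using slope_periodic[of v] V_periodic by blast

lemma V_bounded:
  assumes v: "v \<in> V" shows "\<exists>M. \<forall>x. \<bar>v x\<bar> \<le> M"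
proof -
  have "\<exists>M. \<forall>x\<in>{g i..g (i + 1)}. \<bar>poly (piece v i) x\<bar> \<le> M" for i
    by (intro compact_abs_bound compact_Icc continuous_intros)
  then obtain M where M: "\<And>i x. x \<in> {g i..g (i + 1)} \<Longrightarrow> \<bar>poly (piece v i) x\<bar> \<le> M i" by metis
  have "\<bar>v x\<bar> \<le> (\<Sum>i\<in>{0..<int N}. \<bar>M i\<bar>)" for x
  proof -
    obtain i j where ij: "i \<in> {0..<int N}" "g i \<le> x - of_int j * P" "x - of_int j * P < g (i + 1)"
      using cell_reduce by blast
    have "v x = v (x - of_int j * P)" using periodic_int[of v x "- j"] V_periodic[OF v] by simp
    also have "\<bar>\<dots>\<bar> \<le> M i" using piece(2)[OF v ij(2,3)] M[of "x - of_int j * P" i] ij by simp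
    also have "\<dots> \<le> \<bar>M i\<bar>" by simp
    also have "\<dots> \<le> (\<Sum>i\<in>{0..<int N}. \<bar>M i\<bar>)" using ij(1) by (intro member_le_sum) auto
    finally show ?thesis .
  qed
  then show ?thesis by blast
qed

lemma UN_cells: "(\<Union>i. {g i..<g (i + 1)}) = UNIV"
  using cover by fastforce

lemma V_bounded_borel: "v \<in> V \<Longrightarrow> bounded_borel v"
  unfolding bounded_borel_def
proof
  assume v: "v \<in> V"
  show "v \<in> borel_measurable borel"
    by (rule borel_measurable_cells[OF _ UN_cells, where F = "\<lambda>i. poly (piece v i)"])
      (use piece(2)[OF v] in \<open>auto intro!: borel_measurable_continuous_onI continuous_intros\<close>)
qed (rule V_bounded)

text \<open>The inverse inequality on one cell, with the integral estimated by length times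
  \<open>M\<^sup>2\<close>. The bound sees \<open>v\<close> only through \<open>M\<close>, and so
  holds for all slices of a function of two variables at once.\<close>

lemma slope_bound:
  assumes v: "v \<in> V" and M: "\<And>x. \<bar>v x\<bar> \<le> M" and \<delta>: "0 < \<delta>" "\<And>i. \<delta> \<le> g (i + 1) - g i"
  shows "\<bar>slope g v x\<bar> \<le> sqrt (inv_const k) * M / \<delta>"
proof (cases "x \<in> range g")
  case True
  have "0 \<le> M" using M[of 0] by simp
  then show ?thesis using True \<delta> inv_const(1)[of k] by (simp add: slope_def)
next
  case False
  obtain i where "g i \<le> x" "x < g (i + 1)" using cover by blast
  then have x: "g i < x" "x < g (i + 1)" using False by (auto simp: less_le)
  define L where "L = g (i + 1) - g i"
  have L: "0 < L" "\<delta> \<le> L" using g_less \<delta> by (auto simp: L_def)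
  have M0: "0 \<le> M" using M[of 0] by simp
  have "integral {g i..g (i + 1)} (\<lambda>x. (poly (piece v i) x)\<^sup>2) = integral {g i..g (i + 1)} (\<lambda>x. (v x)\<^sup>2)"
    by (rule integral_interior_cong) (simp add: piece(2)[OF v, of i])
  also have "\<dots> \<le> integral {g i..g (i + 1)} (\<lambda>x. M\<^sup>2)"
    using V_bounded_borel[OF v] M power_mono[OF M, of _ 2]
    by (intro integral_le bounded_borel_integrable_real bounded_borel_intros) auto
  also have "\<dots> = L * M\<^sup>2" using L by (simp add: L_def)
  finally have I: "integral {g i..g (i + 1)} (\<lambda>x. (poly (piece v i) x)\<^sup>2) \<le> L * M\<^sup>2" .
  have "(slope g v x)\<^sup>2 \<le> inv_const k / L ^ 3 * integral {g i..g (i + 1)} (\<lambda>x. (poly (piece v i) x)\<^sup>2)"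
    using inv_const(3)[OF piece(1)[OF v, of i] g_less[of i], of x] x slope_piece[OF v x] by (simp add: L_def)
  also have "\<dots> \<le> inv_const k / L ^ 3 * (L * M\<^sup>2)"
    using I inv_const(1)[of k] L by (intro mult_left_mono) auto
  also have "\<dots> = inv_const k * M\<^sup>2 / L\<^sup>2" using L by (simp add: power3_eq_cube power2_eq_square)
  also have "\<dots> \<le> inv_const k * M\<^sup>2 / \<delta>\<^sup>2"
    using L \<delta> inv_const(1)[of k] by (intro divide_left_mono power_mono) auto
  finally have "sqrt ((slope g v x)\<^sup>2) \<le> sqrt (inv_const k * M\<^sup>2 / \<delta>\<^sup>2)" by (rule real_sqrt_le_mono)
  then show ?thesis using M0 \<delta> by (simp add: real_sqrt_mult real_sqrt_divide)
qed

lemma slope_bounded_borel: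
  assumes v: "v \<in> V" shows "bounded_borel (slope g v)"
proof -
  obtain M where M: "\<And>x. \<bar>v x\<bar> \<le> M" using V_bounded[OF v] by blast
  obtain \<delta> where "0 < \<delta>" "\<And>i. \<delta> \<le> g (i + 1) - g i" using width_min by blast
  then have "\<bar>slope g v x\<bar> \<le> sqrt (inv_const k) * M / \<delta>" for x using slope_bound[OF v M] by blast
  moreover have "slope g v \<in> borel_measurable borel"
  proof (rule borel_measurable_cells[OF _ UN_cells, where F = "\<lambda>i x. if x = g i then 0 else poly (pderiv (piece v i)) x"])
    show "(\<lambda>x. if x = g i then 0 else poly (pderiv (piece v i)) x) \<in> borel_measurable borel" for i
      by (intro measurable_If borel_measurable_continuous_onI continuous_intros) auto
    show "slope g v x = (if x = g i then 0 else poly (pderiv (piece v i)) x)" if "x \<in> {g i..<g (i + 1)}" for i x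
      using slope_piece[OF v, of i x] that by (auto simp: slope_def)
  qed simp
  ultimately show ?thesis unfolding bounded_borel_def by blast
qed

text \<open>The offset \<open>c\<close> lets cells be counted from any index: from the left
  neighbour for right traces, from the cell of a given point for sup bounds.\<close>

lemma integral_cells_base:
  assumes "bounded_borel F"
  shows "(\<Sum>i\<in>{0..<int N}. integral {g (i + c)..g (i + c + 1)} F) = integral {g c..g c + P} F"
proof -
  have "(\<Sum>i\<in>{0..<int n}. integral {g (i + c)..g (i + c + 1)} F) = integral {g c..g (int n + c)} F" for n
  proof (induction n)
    case (Suc n)
    have e: "{0..<int (Suc n)} = insert (int n) {0..<int n}" by auto
    have "integral {g c..g (int n + c)} F + integral {g (int n + c)..g (int n + c + 1)} F = integral {g c..g (int n + c + 1)} F"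
      using strict_mono_less_eq[OF mono] bounded_borel_integrable_real[OF assms]
      by (intro hk_integral_combine) auto
    then show ?case unfolding e using Suc by (simp add: algebra_simps)
  qed simp
  from this[of N] show ?thesis using per[of c] by (simp add: add.commute)
qed

lemma integral_cells:
  assumes F: "bounded_borel F" and "\<And>x. F (x + P) = F x"
  shows "(\<Sum>i\<in>{0..<int N}. integral {g (i + c)..g (i + c + 1)} F) = integral {a..a + P} F"
  unfolding integral_cells_base[OF F] using assms P_pos by (intro integral_periodic) auto

lemma cell_integral_piece:
  assumes "v \<in> V"
  shows "integral {g i..g (i + 1)} (\<lambda>x. (poly (piece v i) x)\<^sup>2) = integral {g i..g (i + 1)} (\<lambda>x. (v x)\<^sup>2)"
  by (rule integral_interior_cong) (simp add: piece(2)[OF assms, of i])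

lemma cell_integral_nonneg: "v \<in> V \<Longrightarrow> 0 \<le> integral {b..c} (\<lambda>x. (v x)\<^sup>2)"
  by (intro integral_nonneg bounded_borel_integrable_real bounded_borel_intros V_bounded_borel) auto

lemma piece_pointwise:
  assumes v: "v \<in> V" and \<delta>: "0 < \<delta>" "\<And>i. \<delta> \<le> g (i + 1) - g i" and x: "g i \<le> x" "x \<le> g (i + 1)"
  shows "(poly (piece v i) x)\<^sup>2 \<le> inv_const k / \<delta> * integral {g i..g (i + 1)} (\<lambda>x. (v x)\<^sup>2)"
proof -
  have "(poly (piece v i) x)\<^sup>2 \<le> inv_const k / (g (i + 1) - g i) * integral {g i..g (i + 1)} (\<lambda>x. (v x)\<^sup>2)"
    using inv_const(2)[OF piece(1)[OF v, of i] g_less[of i], of x] x cell_integral_piece[OF v] by simp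
  also have "\<dots> \<le> inv_const k / \<delta> * integral {g i..g (i + 1)} (\<lambda>x. (v x)\<^sup>2)"
    using \<delta> inv_const(1)[of k] cell_integral_nonneg[OF v] g_less[of i]
    by (intro mult_right_mono divide_left_mono) auto
  finally show ?thesis .
qed

lemma V_sq_periodic: "v \<in> V \<Longrightarrow> (v (x + P))\<^sup>2 = (v x)\<^sup>2"
  by (simp add: V_periodic)

text \<open>Counting starts at the cell of \<open>x\<close> itself, wherever it lies relative to
  \<open>a\<close>, so the integral over that cell is one summand of the integral over a period.
  This boundedness of point evaluation is the source of finite dimension.\<close>

lemma V_pointwise:
  assumes v: "v \<in> V" and \<delta>: "0 < \<delta>" "\<And>i. \<delta> \<le> g (i + 1) - g i"
  shows "(v x)\<^sup>2 \<le> inv_const k / \<delta> * integral {a..a + P} (\<lambda>x. (v x)\<^sup>2)"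
proof -
  obtain i where i: "g i \<le> x" "x < g (i + 1)" using cover by blast
  have "(v x)\<^sup>2 \<le> inv_const k / \<delta> * integral {g i..g (i + 1)} (\<lambda>x. (v x)\<^sup>2)"
    using piece_pointwise[OF v \<delta>, of i x] piece(2)[OF v i] i by simp
  also have "\<dots> \<le> inv_const k / \<delta> * (\<Sum>j\<in>{0..<int N}. integral {g (j + i)..g (j + i + 1)} (\<lambda>x. (v x)\<^sup>2))"
    using member_le_sum[of 0 "{0..<int N}" "\<lambda>j. integral {g (j + i)..g (j + i + 1)} (\<lambda>x. (v x)\<^sup>2)"]
      N_pos cell_integral_nonneg[OF v] \<delta>(1) inv_const(1)[of k] by (intro mult_left_mono) auto
  also have "(\<Sum>j\<in>{0..<int N}. integral {g (j + i)..g (j + i + 1)} (\<lambda>x. (v x)\<^sup>2)) = integral {a..a + P} (\<lambda>x. (v x)\<^sup>2)"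
    using v by (intro integral_cells bounded_borel_intros V_bounded_borel V_sq_periodic)
  finally show ?thesis .
qed

text \<open>The pointwise bound has the third power of the cell length in the denominator;
  integrating it over the cell removes one power.\<close>

lemma slope_L2:
  assumes v: "v \<in> V" and \<delta>: "0 < \<delta>" "\<And>i. \<delta> \<le> g (i + 1) - g i"
  shows "integral {a..a + P} (\<lambda>x. (slope g v x)\<^sup>2) \<le> inv_const k / \<delta>\<^sup>2 * integral {a..a + P} (\<lambda>x. (v x)\<^sup>2)"
proof -
  have "integral {g (i + 0)..g (i + 0 + 1)} (\<lambda>x. (slope g v x)\<^sup>2) \<le> inv_const k / \<delta>\<^sup>2 * integral {g (i + 0)..g (i + 0 + 1)} (\<lambda>x. (v x)\<^sup>2)" for i
  proof -
    define L where "L = g (i + 1) - g i"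
    define I where "I = integral {g i..g (i + 1)} (\<lambda>x. (v x)\<^sup>2)"
    have L: "0 < L" "\<delta> \<le> L" using g_less \<delta> by (auto simp: L_def)
    have I: "0 \<le> I" unfolding I_def by (rule cell_integral_nonneg[OF v])
    have "integral {g i..g (i + 1)} (\<lambda>x. (slope g v x)\<^sup>2) = integral {g i..g (i + 1)} (\<lambda>x. (poly (pderiv (piece v i)) x)\<^sup>2)"
      by (rule integral_interior_cong) (simp add: slope_piece[OF v])
    also have "\<dots> \<le> integral {g i..g (i + 1)} (\<lambda>x. inv_const k / L ^ 3 * I)"
      unfolding L_def I_def cell_integral_piece[OF v, symmetric]
      by (intro integral_le integrable_continuous_interval continuous_intros inv_const(3) piece(1) v g_less) auto
    also have "\<dots> = inv_const k / L\<^sup>2 * I" using L g_less[of i] by (simp add: L_def[symmetric] power3_eq_cube power2_eq_square)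
    also have "\<dots> \<le> inv_const k / \<delta>\<^sup>2 * I"
      using L \<delta> inv_const(1)[of k] I by (intro mult_right_mono divide_left_mono power_mono) auto
    finally show ?thesis by (simp add: I_def)
  qed
  then have "(\<Sum>i\<in>{0..<int N}. integral {g (i + 0)..g (i + 0 + 1)} (\<lambda>x. (slope g v x)\<^sup>2))
      \<le> (\<Sum>i\<in>{0..<int N}. inv_const k / \<delta>\<^sup>2 * integral {g (i + 0)..g (i + 0 + 1)} (\<lambda>x. (v x)\<^sup>2))"
    by (intro sum_mono)
  then show ?thesis
    unfolding sum_distrib_left[symmetric]
    using integral_cells[of "\<lambda>x. (slope g v x)\<^sup>2" 0 a] integral_cells[of "\<lambda>x. (v x)\<^sup>2" 0 a]
      V_slope_periodic[OF v] V_periodic[OF v]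
      bounded_borel_power2[OF slope_bounded_borel[OF v]] bounded_borel_power2[OF V_bounded_borel[OF v]]
    by simp
qed

lemma shifted: "pmesh N P (\<lambda>i. g (i + c))"
proof
  show "strict_mono (\<lambda>i. g (i + c))" using mono by (simp add: strict_mono_def)
  show "g (i + int N + c) = g (i + c) + P" for i using per[of "i + c"] by (simp add: algebra_simps)
qed (rule N_pos)

lemma shifted_space: "dg_space1 k P (\<lambda>i. g (i + c)) = V"
proof -
  have "(\<forall>i. Q (i + c)) \<longleftrightarrow> (\<forall>i. Q i)" for Q :: "int \<Rightarrow> bool"
    by (metis diff_add_cancel)
  from this[of "\<lambda>i. \<exists>p. degree p \<le> k \<and> (\<forall>x\<in>{g i..<g (i+1)}. _ x = poly p x)"]
  show ?thesis unfolding dg_space1_def pw_poly1_def by (simp add: add.assoc add.commute[of c 1] add.left_commute)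
qed

end

text \<open>One of the two coupled advection terms, for unit velocity. The nodes \<open>g i\<close>
  are interior to the cells of the other mesh, on which \<open>w\<close> lives, so \<open>w\<close>
  is single-valued there and only \<open>v\<close> needs traces.\<close>

definition advform :: "real \<Rightarrow> real \<Rightarrow> nat \<Rightarrow> (int \<Rightarrow> real) \<Rightarrow> (real \<Rightarrow> real) \<Rightarrow> (real \<Rightarrow> real) \<Rightarrow> real" where
  "advform a P N g w v = integral {a..a + P} (\<lambda>t. w t * deriv v t)
     - (\<Sum>i\<in>{0..<int N}. w (g (i + 1)) * Lim (at_left (g (i + 1))) v - w (g i) * Lim (at_right (g i)) v)"

lemma abs_mult_le_of_squares:
  fixes p q A B C :: real
  assumes "p\<^sup>2 \<le> C * A" "q\<^sup>2 \<le> C * B"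
  shows "\<bar>p * q\<bar> \<le> C * (A + B)"
proof -
  have "0 \<le> (\<bar>p\<bar> - \<bar>q\<bar>)\<^sup>2" by simp
  then have "2 * \<bar>p * q\<bar> \<le> p\<^sup>2 + q\<^sup>2" by (simp add: power2_diff abs_mult)
  moreover have "0 \<le> p\<^sup>2 + q\<^sup>2" by simp
  ultimately have "\<bar>p * q\<bar> \<le> p\<^sup>2 + q\<^sup>2" by linarith
  then show ?thesis using assms by (simp add: distrib_left)
qed

locale interlaced = G: pmesh k N P g + X: pmesh k N P x
  for k N :: nat and P :: real and g x :: "int \<Rightarrow> real" +
  assumes gx: "g i < x i" and xg: "x i < g (i + 1)"
begin

lemma advform_slope:
  "advform a P N g w v = integral {a..a + P} (\<lambda>t. w t * slope g v t)
     - (\<Sum>i\<in>{0..<int N}. w (g (i + 1)) * Lim (at_left (g (i + 1))) v - w (g i) * Lim (at_right (g i)) v)"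
proof -
  have "integral {a..a + P} (\<lambda>t. w t * slope g v t) = integral {a..a + P} (\<lambda>t. w t * deriv v t)"
    by (rule integral_spike[OF G.negligible_nodes]) (auto simp: slope_def)
  then show ?thesis by (simp add: advform_def)
qed

text \<open>Dual nodes are interlaced with the primal nodes shifted by one index, so each fact about
  primal test functions is available for dual ones as well.\<close>

lemma dual: "interlaced N P x (\<lambda>i. g (i + 1))"
  by (intro interlaced.intro interlaced_axioms.intro X.pmesh_axioms G.shifted) (use gx[of "_ + 1"] xg in auto)

text \<open>Young's inequality with weights 1/\<delta> and \<delta> balances the slope, whose
  squared norm costs 1/\<delta>^2. The slope and the two trace sums contribute
  \<open>inv_const k\<close> over \<delta> each, hence the 3; the 1 is the weight on
  \<open>w\<close>.\<close>

lemma advform_bound: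
  assumes v: "v \<in> G.V" and w: "w \<in> X.V"
    and \<delta>: "0 < \<delta>" "\<And>i. \<delta> \<le> g (i + 1) - g i" "\<And>i. \<delta> \<le> x (i + 1) - x i"
  shows "\<bar>advform a P N g w v\<bar> \<le> (3 * inv_const k + 1) / \<delta> * (integral {a..a + P} (\<lambda>t. (w t)\<^sup>2) + integral {a..a + P} (\<lambda>t. (v t)\<^sup>2))"
proof -
  define C where "C = inv_const k / \<delta>"
  define Iv where "Iv = integral {a..a + P} (\<lambda>t. (v t)\<^sup>2)"
  define Iw where "Iw = integral {a..a + P} (\<lambda>t. (w t)\<^sup>2)"
  have nn: "0 \<le> Iv" "0 \<le> Iw" unfolding Iv_def Iw_def by (rule G.cell_integral_nonneg[OF v] X.cell_integral_nonneg[OF w])+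
  have bb: "bounded_borel v" "bounded_borel w" "bounded_borel (slope g v)"
    using G.V_bounded_borel[OF v] X.V_bounded_borel[OF w] G.slope_bounded_borel[OF v] by auto
  have "\<bar>integral {a..a + P} (\<lambda>t. w t * slope g v t)\<bar> \<le> integral {a..a + P} (\<lambda>t. 1 / \<delta> * (w t)\<^sup>2 + \<delta> * (slope g v t)\<^sup>2)"
  proof -
    have "norm (integral {a..a + P} (\<lambda>t. w t * slope g v t)) \<le> integral {a..a + P} (\<lambda>t. 1 / \<delta> * (w t)\<^sup>2 + \<delta> * (slope g v t)\<^sup>2)"
    proof (rule integral_norm_bound_integral)
      fix t
      have "\<bar>w t * slope g v t\<bar> \<le> 1 * ((1 / \<delta> * (w t)\<^sup>2) + \<delta> * (slope g v t)\<^sup>2)"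
      proof -
        have "\<bar>(w t / sqrt \<delta>) * (sqrt \<delta> * slope g v t)\<bar> \<le> 1 * ((1 / \<delta> * (w t)\<^sup>2) + \<delta> * (slope g v t)\<^sup>2)"
          by (rule abs_mult_le_of_squares) (use \<delta>(1) in \<open>auto simp: power_divide power_mult_distrib\<close>)
        then show ?thesis using \<delta>(1) by simp
      qed
      then show "norm (w t * slope g v t) \<le> 1 / \<delta> * (w t)\<^sup>2 + \<delta> * (slope g v t)\<^sup>2" by simp
    qed (intro bounded_borel_integrable_real bounded_borel_intros bb)+
    then show ?thesis by simp
  qed
  also have "\<dots> = 1 / \<delta> * Iw + \<delta> * integral {a..a + P} (\<lambda>t. (slope g v t)\<^sup>2)"
  proof -
    have "integral {a..a + P} (\<lambda>t. 1 / \<delta> * (w t)\<^sup>2 + \<delta> * (slope g v t)\<^sup>2)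
        = integral {a..a + P} (\<lambda>t. 1 / \<delta> * (w t)\<^sup>2) + integral {a..a + P} (\<lambda>t. \<delta> * (slope g v t)\<^sup>2)"
      by (intro hk_integral_add bounded_borel_integrable_real bounded_borel_intros bb)
    then show ?thesis by (simp add: Iw_def)
  qed
  also have "\<dots> \<le> 1 / \<delta> * Iw + \<delta> * (inv_const k / \<delta>\<^sup>2 * Iv)"
    using G.slope_L2[OF v \<delta>(1,2)] \<delta>(1) unfolding Iv_def by (intro add_left_mono mult_left_mono) auto
  also have "\<dots> = 1 / \<delta> * Iw + C * Iv" using \<delta>(1) by (simp add: C_def power2_eq_square)
  finally have 1: "\<bar>integral {a..a + P} (\<lambda>t. w t * slope g v t)\<bar> \<le> 1 / \<delta> * Iw + C * Iv" .
  note cv = G.integral_cells[where F = "\<lambda>t. (v t)\<^sup>2" and a = a, OF bounded_borel_power2[OF bb(1)] G.V_sq_periodic[OF v]]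
  note cw = X.integral_cells[where F = "\<lambda>t. (w t)\<^sup>2" and a = a, OF bounded_borel_power2[OF bb(2)] X.V_sq_periodic[OF w]]
  have "\<bar>\<Sum>i\<in>{0..<int N}. w (g (i + 1)) * Lim (at_left (g (i + 1))) v\<bar>
      \<le> (\<Sum>i\<in>{0..<int N}. C * (integral {x (i + 0)..x (i + 0 + 1)} (\<lambda>t. (w t)\<^sup>2) + integral {g (i + 0)..g (i + 0 + 1)} (\<lambda>t. (v t)\<^sup>2)))"
  proof (intro order_trans[OF sum_abs] sum_mono abs_mult_le_of_squares)
    fix i
    show "(w (g (i + 1)))\<^sup>2 \<le> C * integral {x (i + 0)..x (i + 0 + 1)} (\<lambda>t. (w t)\<^sup>2)"
      using X.piece_pointwise[OF w \<delta>(1,3), of i "g (i + 1)"] X.piece(2)[OF w, of i "g (i + 1)"] gx[of "i + 1"] xg[of i]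
      by (simp add: C_def)
    show "(Lim (at_left (g (i + 1))) v)\<^sup>2 \<le> C * integral {g (i + 0)..g (i + 0 + 1)} (\<lambda>t. (v t)\<^sup>2)"
      using G.piece_pointwise[OF v \<delta>(1,2), of i "g (i + 1)"] G.Lim_left[OF v, of i] G.g_less[of i]
      by (simp add: C_def)
  qed
  also have "\<dots> = C * (Iw + Iv)"
    unfolding sum_distrib_left[symmetric] sum.distrib cv cw Iv_def Iw_def ..
  finally have 2: "\<bar>\<Sum>i\<in>{0..<int N}. w (g (i + 1)) * Lim (at_left (g (i + 1))) v\<bar> \<le> C * (Iw + Iv)" .
  have "\<bar>\<Sum>i\<in>{0..<int N}. w (g i) * Lim (at_right (g i)) v\<bar>
      \<le> (\<Sum>i\<in>{0..<int N}. C * (integral {x (i + (-1))..x (i + (-1) + 1)} (\<lambda>t. (w t)\<^sup>2) + integral {g (i + 0)..g (i + 0 + 1)} (\<lambda>t. (v t)\<^sup>2)))"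
  proof (intro order_trans[OF sum_abs] sum_mono abs_mult_le_of_squares)
    fix i
    show "(w (g i))\<^sup>2 \<le> C * integral {x (i + (-1))..x (i + (-1) + 1)} (\<lambda>t. (w t)\<^sup>2)"
      using X.piece_pointwise[OF w \<delta>(1,3), of "i - 1" "g i"] X.piece(2)[OF w, of "i - 1" "g i"] gx[of i] xg[of "i - 1"]
      by (simp add: C_def)
    show "(Lim (at_right (g i)) v)\<^sup>2 \<le> C * integral {g (i + 0)..g (i + 0 + 1)} (\<lambda>t. (v t)\<^sup>2)"
      using G.piece_pointwise[OF v \<delta>(1,2), of i "g i"] G.piece(2)[OF v, of i "g i"] G.Lim_right[OF v, of i] G.g_less[of i]
      by (simp add: C_def)
  qed
  also have "\<dots> = C * (Iw + Iv)"
    unfolding sum_distrib_left[symmetric] sum.distrib cv cw Iv_def Iw_def ..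
  finally have 3: "\<bar>\<Sum>i\<in>{0..<int N}. w (g i) * Lim (at_right (g i)) v\<bar> \<le> C * (Iw + Iv)" .
  have C0: "0 \<le> C" using inv_const(1)[of k] \<delta>(1) by (simp add: C_def)
  have "\<bar>advform a P N g w v\<bar> \<le> 1 / \<delta> * Iw + C * Iv + 2 * (C * (Iw + Iv))"
    using 1 2 3 unfolding advform_slope sum_subtractf by linarith
  also have "\<dots> \<le> 1 / \<delta> * (Iw + Iv) + 3 * (C * (Iw + Iv))"
  proof -
    have "C * Iv \<le> C * (Iw + Iv)" using C0 nn by (intro mult_left_mono) auto
    moreover have "1 / \<delta> * Iw \<le> 1 / \<delta> * (Iw + Iv)" using \<delta>(1) nn by (intro mult_left_mono) auto
    ultimately show ?thesis by linarith
  qed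
  also have "\<dots> = (3 * inv_const k + 1) / \<delta> * (Iw + Iv)"
    using \<delta>(1) by (simp add: C_def field_simps)
  finally show ?thesis by (simp add: Iv_def Iw_def)
qed

text \<open>On every half cell both functions are polynomials; integrating by parts there, the boundary
  terms at the primal nodes cancel and those at the dual nodes telescope over a period.\<close>

lemma advform_skew:
  assumes v: "v \<in> G.V" and w: "w \<in> X.V"
  shows "advform a P N g w v + advform a P N x v w = 0"
proof -
  interpret XG: interlaced k N P x "\<lambda>i. g (i + 1)"
    by (rule dual)
  have bb: "bounded_borel v" "bounded_borel w" "bounded_borel (slope g v)" "bounded_borel (slope x w)"
    using G.V_bounded_borel[OF v] X.V_bounded_borel[OF w] G.slope_bounded_borel[OF v] X.slope_bounded_borel[OF w] by auto
  \<comment> \<open>Off the nodes of both meshes this is the derivative of the product of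
    \<open>w\<close> and \<open>v\<close>.\<close>
  define Z where "Z t = w t * slope g v t + v t * slope x w t" for t
  have bZ: "bounded_borel Z" unfolding Z_def by (intro bounded_borel_intros bb)
  have pZ: "Z (t + P) = Z t" for t
    unfolding Z_def using G.V_periodic[OF v] X.V_periodic[OF w] G.V_slope_periodic[OF v] X.V_slope_periodic[OF w]
    by simp
  define wl where "wl i = Lim (at_left (x i)) w" for i
  define vl where "vl i = Lim (at_left (g i)) v" for i
  have wl: "wl i = poly (X.piece w (i - 1)) (x i)" for i using X.Lim_left[OF w, of "i - 1"] by (simp add: wl_def)
  have vl: "vl (i + 1) = poly (G.piece v i) (g (i + 1))" for i using G.Lim_left[OF v, of i] by (simp add: vl_def)
  \<comment> \<open>On the left half of primal cell \<open>i\<close>, \<open>w\<close> still belongs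
    to dual cell \<open>i - 1\<close>; its value at \<open>x i\<close> is therefore the left trace
    \<open>wl i\<close>, not \<open>w (x i)\<close>.\<close>
  have first: "integral {g i..x i} Z = wl i * v (x i) - w (g i) * v (g i)" for i
  proof -
    have "integral {g i..x i} Z = poly (X.piece w (i - 1)) (x i) * poly (G.piece v i) (x i)
        - poly (X.piece w (i - 1)) (g i) * poly (G.piece v i) (g i)"
    proof (rule integral_poly_product_rule)
      show "g i \<le> x i" using gx[of i] by simp
      fix t assume t: "g i < t" "t < x i"
      have "x (i - 1) < t" "t < x (i - 1 + 1)" "g i < t" "t < g (i + 1)" using t xg[of "i - 1"] xg[of i] by auto
      then show "Z t = poly (X.piece w (i - 1)) t * poly (pderiv (G.piece v i)) t + poly (G.piece v i) t * poly (pderiv (X.piece w (i - 1))) t"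
        unfolding Z_def using X.piece(2)[OF w, of "i - 1" t] G.piece(2)[OF v, of i t] X.slope_piece[OF w, of "i - 1" t] G.slope_piece[OF v, of i t]
        by simp
    qed
    then show ?thesis
      using X.piece(2)[OF w, of "i - 1" "g i"] G.piece(2)[OF v, of i "g i"] G.piece(2)[OF v, of i "x i"] gx[of i] xg[of i] xg[of "i - 1"]
      by (simp add: wl)
  qed
  have second: "integral {x i..g (i + 1)} Z = w (g (i + 1)) * vl (i + 1) - w (x i) * v (x i)" for i
  proof -
    have "integral {x i..g (i + 1)} Z = poly (X.piece w i) (g (i + 1)) * poly (G.piece v i) (g (i + 1))
        - poly (X.piece w i) (x i) * poly (G.piece v i) (x i)"
    proof (rule integral_poly_product_rule)
      show "x i \<le> g (i + 1)" using xg[of i] by simp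
      fix t assume t: "x i < t" "t < g (i + 1)"
      have "x i < t" "t < x (i + 1)" "g i < t" "t < g (i + 1)" using t gx[of "i + 1"] gx[of i] by auto
      then show "Z t = poly (X.piece w i) t * poly (pderiv (G.piece v i)) t + poly (G.piece v i) t * poly (pderiv (X.piece w i)) t"
        unfolding Z_def using X.piece(2)[OF w, of i t] G.piece(2)[OF v, of i t] X.slope_piece[OF w, of i t] G.slope_piece[OF v, of i t]
        by simp
    qed
    then show ?thesis
      using X.piece(2)[OF w, of i "g (i + 1)"] X.piece(2)[OF w, of i "x i"] G.piece(2)[OF v, of i "x i"] gx[of i] xg[of i] gx[of "i + 1"]
      by (simp add: vl)
  qed
  have "integral {a..a + P} Z = (\<Sum>i\<in>{0..<int N}. integral {g (i + 0)..g (i + 0 + 1)} Z)"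
    using G.integral_cells[of Z 0 a, OF bZ pZ] by simp
  also have "\<dots> = (\<Sum>i\<in>{0..<int N}. (w (g (i + 1)) * vl (i + 1) - w (g i) * v (g i)) + (wl i * v (x i) - w (x i) * v (x i)))"
  proof (intro sum.cong refl)
    fix i
    have "integral {g i..x i} Z + integral {x i..g (i + 1)} Z = integral {g i..g (i + 1)} Z"
      using gx[of i] xg[of i] bounded_borel_integrable_real[OF bZ]
      by (intro hk_integral_combine) auto
    then show "integral {g (i + 0)..g (i + 0 + 1)} Z = (w (g (i + 1)) * vl (i + 1) - w (g i) * v (g i)) + (wl i * v (x i) - w (x i) * v (x i))"
      using first[of i] second[of i] by simp
  qed
  \<comment> \<open>The first sum is the flux sum at the primal nodes and cancels in the total. The
    second, combined with the dual flux sum, leaves the differences of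
    \<open>v (x i) * wl i\<close>, which telescope to zero by periodicity.\<close>
  finally have IZ: "integral {a..a + P} Z = (\<Sum>i\<in>{0..<int N}. w (g (i + 1)) * vl (i + 1) - w (g i) * v (g i)) + (\<Sum>i\<in>{0..<int N}. wl i * v (x i) - w (x i) * v (x i))"
    by (simp only: sum.distrib)
  have tele: "(\<Sum>i\<in>{0..<int n}. v (x (i + 1)) * wl (i + 1) - v (x i) * wl i) = v (x (int n)) * wl (int n) - v (x 0) * wl 0" for n
  proof (induction n)
    case (Suc n)
    have e: "{0..<int (Suc n)} = insert (int n) {0..<int n}" by auto
    show ?case unfolding e using Suc by (simp add: algebra_simps)
  qed simp
  have "x (int N) = x 0 + P" using X.per[of 0] by simp
  then have "v (x (int N)) * wl (int N) = v (x 0) * wl 0"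
    using G.V_periodic[OF v] Lim_at_left_shift[of w P "x 0"] X.V_periodic[OF w] by (simp add: wl_def)
  then have T: "(\<Sum>i\<in>{0..<int N}. v (x (i + 1)) * wl (i + 1) - v (x i) * wl i) = 0" using tele[of N] by simp
  have "integral {a..a + P} Z = integral {a..a + P} (\<lambda>t. w t * slope g v t) + integral {a..a + P} (\<lambda>t. v t * slope x w t)"
    unfolding Z_def
    by (intro hk_integral_add bounded_borel_integrable_real bounded_borel_intros bb)
  then have "advform a P N g w v + advform a P N x v w
      = integral {a..a + P} Z - (\<Sum>i\<in>{0..<int N}. w (g (i + 1)) * vl (i + 1) - w (g i) * v (g i))
        - (\<Sum>i\<in>{0..<int N}. v (x (i + 1)) * wl (i + 1) - v (x i) * w (x i))"
    unfolding advform_slope XG.advform_slope vl_def wl_def G.Lim_right[OF v] X.Lim_right[OF w] by simp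
  also have "\<dots> = (\<Sum>i\<in>{0..<int N}. (wl i * v (x i) - w (x i) * v (x i)) - (v (x (i + 1)) * wl (i + 1) - v (x i) * w (x i)))"
    unfolding IZ sum_subtractf by simp
  also have "\<dots> = - (\<Sum>i\<in>{0..<int N}. v (x (i + 1)) * wl (i + 1) - v (x i) * wl i)"
    unfolding sum_negf[symmetric] by (intro sum.cong) auto
  finally show ?thesis using T by simp
qed

end

section \<open>Pairs of primal and dual functions\<close>

definition pcomb :: "real \<Rightarrow> ('z \<Rightarrow> real) \<times> ('z \<Rightarrow> real) \<Rightarrow> ('z \<Rightarrow> real) \<times> ('z \<Rightarrow> real) \<Rightarrow> ('z \<Rightarrow> real) \<times> ('z \<Rightarrow> real)" where
  "pcomb c u v = ((\<lambda>z. fst u z + c * fst v z), (\<lambda>z. snd u z + c * snd v z))"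

definition pip :: "'z::euclidean_space set \<Rightarrow> ('z \<Rightarrow> real) \<times> ('z \<Rightarrow> real) \<Rightarrow> ('z \<Rightarrow> real) \<times> ('z \<Rightarrow> real) \<Rightarrow> real" where
  "pip \<Omega> u v = integral \<Omega> (\<lambda>z. fst u z * fst v z + snd u z * snd v z)"

lemma pip_split:
  assumes "bounded_borel (fst u)" "bounded_borel (snd u)"
  shows "pip (cbox a b) u u = integral (cbox a b) (\<lambda>z. (fst u z)\<^sup>2) + integral (cbox a b) (\<lambda>z. (snd u z)\<^sup>2)"
  unfolding pip_def power2_eq_square
  by (intro hk_integral_add bounded_borel_integrable bounded_borel_mult assms)

text \<open>\<open>S_pointwise\<close> serves finite dimension and does not enter the energy
  constant, so \<open>C\<close> may grow under refinement.\<close>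

locale pair_space =
  fixes S :: "(('z::euclidean_space \<Rightarrow> real) \<times> ('z \<Rightarrow> real)) set" and a b :: 'z and C :: real
  assumes S_fst: "u \<in> S \<Longrightarrow> bounded_borel (fst u)" and S_snd: "u \<in> S \<Longrightarrow> bounded_borel (snd u)"
    and S_comb: "u \<in> S \<Longrightarrow> v \<in> S \<Longrightarrow> pcomb c u v \<in> S"
    and S_pointwise: "u \<in> S \<Longrightarrow> (fst u z)\<^sup>2 + (snd u z)\<^sup>2 \<le> C * pip (cbox a b) u u"
    and C_nonneg: "0 \<le> C"
begin

abbreviation ipc where "ipc \<equiv> pip (cbox a b)"

sublocale ip_space S pcomb ipc
proof
  show "ipc (pcomb c u v) w = ipc u w + c * ipc v w" if "u \<in> S" "v \<in> S" "w \<in> S" for u v w c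
  proof -
    have "ipc (pcomb c u v) w = integral (cbox a b) (\<lambda>z. (fst u z * fst w z + snd u z * snd w z) + c * (fst v z * fst w z + snd v z * snd w z))"
      unfolding pip_def pcomb_def by (simp add: algebra_simps)
    also have "\<dots> = ipc u w + integral (cbox a b) (\<lambda>z. c * (fst v z * fst w z + snd v z * snd w z))"
      unfolding pip_def
      by (intro hk_integral_add bounded_borel_integrable bounded_borel_intros) (use that S_fst S_snd in auto)
    finally show ?thesis by (simp add: pip_def)
  qed
  show "ipc u v = ipc v u" for u v by (simp add: pip_def mult.commute)
  show "0 \<le> ipc u u" if "u \<in> S" for u
    unfolding pip_def
    by (intro integral_nonneg bounded_borel_integrable bounded_borel_intros) (use that S_fst S_snd in auto)
qed (rule S_comb)

lemma pip_self: "ipc u u = integral (cbox a b) (\<lambda>z. (fst u z)\<^sup>2 + (snd u z)\<^sup>2)"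
  by (simp add: pip_def power2_eq_square)

text \<open>Point evaluations are bounded functionals; integrating Bessel's inequality for them over the
  domain bounds the size of an orthonormal family.\<close>

lemma finite_dimension: "\<exists>n0. \<forall>n e. orthonormal n e \<longrightarrow> n \<le> n0"
proof (intro exI allI impI)
  fix n and e :: "nat \<Rightarrow> ('z \<Rightarrow> real) \<times> ('z \<Rightarrow> real)" assume e: "orthonormal n e"
  have eS: "e i \<in> S" if "i < n" for i using e that by (simp add: orthonormal_def)
  have le: "(fst u z)\<^sup>2 \<le> C * ipc u u" "(snd u z)\<^sup>2 \<le> C * ipc u u" if "u \<in> S" for u z
    using S_pointwise[OF that, of z] zero_le_power2[of "fst u z"] zero_le_power2[of "snd u z"] by linarith+
  have B: "(\<Sum>i<n. (fst (e i) z)\<^sup>2) \<le> C" "(\<Sum>i<n. (snd (e i) z)\<^sup>2) \<le> C" for z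
    by (rule bessel[OF e, where F = "\<lambda>u. fst u z"]; use le C_nonneg in \<open>simp add: pcomb_def\<close>)
      (rule bessel[OF e, where F = "\<lambda>u. snd u z"]; use le C_nonneg in \<open>simp add: pcomb_def\<close>)
  have b: "(\<Sum>i<n. (fst (e i) z)\<^sup>2 + (snd (e i) z)\<^sup>2) \<le> 2 * C" for z
    unfolding sum.distrib using B[of z] by linarith
  have "real n = (\<Sum>i<n. ipc (e i) (e i))" using e by (simp add: orthonormal_def)
  also have "\<dots> = integral (cbox a b) (\<lambda>z. \<Sum>i<n. (fst (e i) z)\<^sup>2 + (snd (e i) z)\<^sup>2)"
    unfolding pip_self
    by (intro hk_integral_sum[symmetric] bounded_borel_integrable bounded_borel_intros) (use eS S_fst S_snd in auto)
  also have "\<dots> \<le> integral (cbox a b) (\<lambda>z. 2 * C)"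
    by (intro integral_le bounded_borel_integrable bounded_borel_intros b) (use eS S_fst S_snd in auto)
  finally show "n \<le> nat \<lceil>integral (cbox a b) (\<lambda>z. 2 * C)\<rceil>" by linarith
qed

text \<open>\<open>A\<close> is skew and conserves energy; the other term is minus \<theta> times
  the squared jump and dissipates it. In both dimensions \<theta> is 1/\<tau>max, of order 1/h like
  \<open>K'\<close>, so their sum is an admissible energy constant.\<close>

lemma energy_space_of_split:
  fixes A :: "('z \<Rightarrow> real) \<times> ('z \<Rightarrow> real) \<Rightarrow> ('z \<Rightarrow> real) \<times> ('z \<Rightarrow> real) \<Rightarrow> real"
  assumes H: "\<And>u v. u \<in> S \<Longrightarrow> v \<in> S \<Longrightarrow>
      H u v = A u v - \<theta> * integral (cbox a b) (\<lambda>z. (fst u z - snd u z) * (fst v z - snd v z))"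
    and Al: "\<And>u v w c. u \<in> S \<Longrightarrow> v \<in> S \<Longrightarrow> w \<in> S \<Longrightarrow> A (pcomb c u v) w = A u w + c * A v w"
    and Ar: "\<And>u v w c. u \<in> S \<Longrightarrow> v \<in> S \<Longrightarrow> w \<in> S \<Longrightarrow> A w (pcomb c u v) = A w u + c * A w v"
    and A0: "\<And>u. u \<in> S \<Longrightarrow> A u u = 0"
    and Ab: "\<And>u v. u \<in> S \<Longrightarrow> v \<in> S \<Longrightarrow> \<bar>A u v\<bar> \<le> K' * (ipc u u + ipc v v)"
    and \<theta>: "0 \<le> \<theta>" and K: "0 < K" "K' + \<theta> \<le> K"
  shows "energy_space S pcomb ipc H K"
proof
  define J where "J u v = integral (cbox a b) (\<lambda>z. (fst u z - snd u z) * (fst v z - snd v z))"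
    for u v :: "('z \<Rightarrow> real) \<times> ('z \<Rightarrow> real)"
  note H = H[folded J_def]
  have int: "(\<lambda>z. (fst u z - snd u z) * (fst v z - snd v z)) integrable_on cbox a b" if "u \<in> S" "v \<in> S" for u v
    by (intro bounded_borel_integrable bounded_borel_intros) (use that S_fst S_snd in auto)
  have Jl: "J (pcomb c u v) w = J u w + c * J v w" if "u \<in> S" "v \<in> S" "w \<in> S" for u v w c
  proof -
    have "J (pcomb c u v) w = integral (cbox a b) (\<lambda>z. (fst u z - snd u z) * (fst w z - snd w z) + c * ((fst v z - snd v z) * (fst w z - snd w z)))"
      unfolding J_def pcomb_def by (simp add: algebra_simps)
    also have "\<dots> = J u w + integral (cbox a b) (\<lambda>z. c * ((fst v z - snd v z) * (fst w z - snd w z)))"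
      unfolding J_def by (intro hk_integral_add integrable_on_mult_right int that)
    finally show ?thesis by (simp add: J_def)
  qed
  have Js: "J u v = J v u" for u v unfolding J_def by (simp add: mult.commute)
  show "H (pcomb c u v) w = H u w + c * H v w" if "u \<in> S" "v \<in> S" "w \<in> S" for u v w c
    by (simp only: H[OF S_comb[OF that(1,2)] that(3)] H[OF that(1,3)] H[OF that(2,3)] Al[OF that] Jl[OF that])
      (simp add: algebra_simps)
  show "H w (pcomb c u v) = H w u + c * H w v" if "u \<in> S" "v \<in> S" "w \<in> S" for u v w c
    by (simp only: H[OF that(3) S_comb[OF that(1,2)]] H[OF that(3,1)] H[OF that(3,2)] Ar[OF that] Js[of w] Jl[OF that])
      (simp add: algebra_simps)
  show "H u u \<le> 0" if "u \<in> S" for u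
  proof -
    have "0 \<le> J u u" unfolding J_def using int[OF that that] by (intro integral_nonneg) auto
    then show ?thesis using H[OF that that] A0[OF that] \<theta> by simp
  qed
  show "\<bar>H u v\<bar> \<le> K * (ipc u u + ipc v v)" if "u \<in> S" "v \<in> S" for u v
  proof -
    have "norm (J u v) \<le> integral (cbox a b) (\<lambda>z. ((fst u z)\<^sup>2 + (snd u z)\<^sup>2) + ((fst v z)\<^sup>2 + (snd v z)\<^sup>2))"
      unfolding J_def
    proof (rule integral_norm_bound_integral[OF int[OF that]])
      show "(\<lambda>z. ((fst u z)\<^sup>2 + (snd u z)\<^sup>2) + ((fst v z)\<^sup>2 + (snd v z)\<^sup>2)) integrable_on cbox a b"
        by (intro bounded_borel_integrable bounded_borel_intros) (use that S_fst S_snd in auto)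
      fix z
      \<comment> \<open>The loss of a factor 2 in the square of a difference is made up by the 1/2
        in the product estimate, so the jump term has bound 1.\<close>
      have "2 * \<bar>p * q\<bar> \<le> p\<^sup>2 + q\<^sup>2" for p q :: real
        using zero_le_power2[of "\<bar>p\<bar> - \<bar>q\<bar>"] by (simp add: power2_diff abs_mult)
      moreover have "(p - q)\<^sup>2 \<le> 2 * (p\<^sup>2 + q\<^sup>2)" for p q :: real
        using zero_le_power2[of "p + q"] by (simp add: power2_eq_square algebra_simps)
      ultimately show "norm ((fst u z - snd u z) * (fst v z - snd v z)) \<le> ((fst u z)\<^sup>2 + (snd u z)\<^sup>2) + ((fst v z)\<^sup>2 + (snd v z)\<^sup>2)"
        by (smt (verit) real_norm_def)
    qed
    also have "\<dots> = ipc u u + ipc v v"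
      unfolding pip_self
      by (intro hk_integral_add bounded_borel_integrable bounded_borel_intros) (use that S_fst S_snd in auto)
    finally have "\<theta> * \<bar>J u v\<bar> \<le> \<theta> * (ipc u u + ipc v v)" using \<theta> by (intro mult_left_mono) auto
    moreover have "\<bar>H u v\<bar> \<le> \<bar>A u v\<bar> + \<theta> * \<bar>J u v\<bar>"
      unfolding H[OF that] using \<theta> by (intro order_trans[OF abs_triangle_ineq4]) (simp add: abs_mult)
    ultimately have "\<bar>H u v\<bar> \<le> (K' + \<theta>) * (ipc u u + ipc v v)"
      using Ab[OF that] by (simp add: algebra_simps)
    also have "\<dots> \<le> K * (ipc u u + ipc v v)"
      using K ip_nonneg[OF that(1)] ip_nonneg[OF that(2)] by (intro mult_right_mono) auto
    finally show ?thesis .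
  qed
qed (use K finite_dimension in auto)

end

lemma dg_space1_comb:
  assumes "u \<in> dg_space1 k P g" "v \<in> dg_space1 k P g"
  shows "(\<lambda>x. u x + c * v x) \<in> dg_space1 k P g"
proof -
  have "\<exists>p. degree p \<le> k \<and> (\<forall>x\<in>{g i..<g (i + 1)}. u x + c * v x = poly p x)" for i
  proof -
    obtain p q where "degree p \<le> k" "\<forall>x\<in>{g i..<g (i + 1)}. u x = poly p x"
      "degree q \<le> k" "\<forall>x\<in>{g i..<g (i + 1)}. v x = poly q x"
      using assms unfolding dg_space1_def pw_poly1_def by blast
    then show ?thesis
      by (intro exI[of _ "p + smult c q"]) (auto intro!: degree_add_le order_trans[OF degree_smult_le])
  qed
  then show ?thesis using assms by (simp add: dg_space1_def pw_poly1_def)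
qed

context pmesh
begin

lemma has_slope:
  assumes "v \<in> V" "t \<notin> range g" shows "(v has_field_derivative slope g v t) (at t)"
proof -
  obtain i where "g i \<le> t" "t < g (i + 1)" using cover by blast
  then have t: "g i < t" "t < g (i + 1)" using assms(2) by (auto simp: less_le)
  show ?thesis unfolding slope_piece[OF assms(1) t] by (rule piece_derivative[OF assms(1) t])
qed

text \<open>Additivity of \<open>deriv\<close> needs differentiability. This holds off the nodes,
  and at the nodes the default value 0 makes both sides vanish.\<close>

lemma slope_comb:
  assumes "u \<in> V" "v \<in> V"
  shows "slope g (\<lambda>x. u x + c * v x) t = slope g u t + c * slope g v t"
proof (cases "t \<in> range g")
  case False
  have "((\<lambda>x. u x + c * v x) has_field_derivative slope g u t + c * slope g v t) (at t)"
    using False assms by (auto intro!: derivative_eq_intros has_slope)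
  then show ?thesis using False by (simp add: slope_def DERIV_imp_deriv)
qed (simp add: slope_def)

lemma left_tendsto:
  assumes "v \<in> V" shows "(v \<longlongrightarrow> Lim (at_left (g i)) v) (at_left (g i))"
  using left_limit[OF assms, of "i - 1"] Lim_left[OF assms, of "i - 1"] by simp

lemma Lim_left_comb:
  assumes "u \<in> V" "v \<in> V"
  shows "Lim (at_left (g i)) (\<lambda>x. u x + c * v x) = Lim (at_left (g i)) u + c * Lim (at_left (g i)) v"
  by (intro tendsto_Lim tendsto_intros left_tendsto assms) simp

lemma centres_interlaced: "interlaced N P g (centres g)"
proof (intro interlaced.intro interlaced_axioms.intro)
  show "pmesh N P (centres g)"
  proof
    show "strict_mono (centres g)"
    proof (rule strict_monoI)
      fix i j :: int assume "i < j"
      then show "centres g i < centres g j"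
        using strict_mono_less[OF mono, of i j] strict_mono_less[OF mono, of "i + 1" "j + 1"] by (simp add: centres_def)
    qed
    show "centres g (i + int N) = centres g i + P" for i
      using per[of i] per[of "i + 1"] by (simp add: centres_def algebra_simps)
  qed (rule N_pos)
  show "g i < centres g i" "centres g i < g (i + 1)" for i using g_less[of i] by (auto simp: centres_def)
qed (rule pmesh_axioms)

text \<open>A dual width is the mean of two neighbouring primal widths, so a lower bound carries
  over unchanged.\<close>

lemma centres_width:
  assumes "\<And>i. \<delta> \<le> g (i + 1) - g i" shows "\<delta> \<le> centres g (i + 1) - centres g i"
  using assms[of i] assms[of "i + 1"] by (simp add: centres_def field_simps)

end

context interlaced
begin

lemma advform_comb_left:
  assumes v: "v \<in> G.V" and w: "bounded_borel w1" "bounded_borel w2"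
  shows "advform a P N g (\<lambda>t. w1 t + c * w2 t) v = advform a P N g w1 v + c * advform a P N g w2 v"
proof -
  have bb: "bounded_borel (slope g v)" by (rule G.slope_bounded_borel[OF v])
  have "integral {a..a + P} (\<lambda>t. (w1 t + c * w2 t) * slope g v t)
      = integral {a..a + P} (\<lambda>t. w1 t * slope g v t + c * (w2 t * slope g v t))" by (simp add: algebra_simps)
  also have "\<dots> = integral {a..a + P} (\<lambda>t. w1 t * slope g v t) + integral {a..a + P} (\<lambda>t. c * (w2 t * slope g v t))"
    by (intro hk_integral_add bounded_borel_integrable_real bounded_borel_intros w bb)
  finally show ?thesis unfolding advform_slope
    by (simp add: sum.distrib sum_subtractf sum_distrib_left algebra_simps)
qed

lemma advform_comb_right:
  assumes w: "bounded_borel w" and v: "v1 \<in> G.V" "v2 \<in> G.V"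
  shows "advform a P N g w (\<lambda>t. v1 t + c * v2 t) = advform a P N g w v1 + c * advform a P N g w v2"
proof -
  have bb: "bounded_borel (slope g v1)" "bounded_borel (slope g v2)" using v by (auto intro: G.slope_bounded_borel)
  have "integral {a..a + P} (\<lambda>t. w t * slope g (\<lambda>t. v1 t + c * v2 t) t)
      = integral {a..a + P} (\<lambda>t. w t * slope g v1 t + c * (w t * slope g v2 t))"
    unfolding G.slope_comb[OF v] by (simp add: algebra_simps)
  also have "\<dots> = integral {a..a + P} (\<lambda>t. w t * slope g v1 t) + integral {a..a + P} (\<lambda>t. c * (w t * slope g v2 t))"
    by (intro hk_integral_add bounded_borel_integrable_real bounded_borel_intros w bb)
  finally show ?thesis
    unfolding advform_slope G.Lim_left_comb[OF v] G.Lim_right[OF dg_space1_comb[OF v]] G.Lim_right[OF v(1)] G.Lim_right[OF v(2)]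
    by (simp add: sum.distrib sum_subtractf sum_distrib_left algebra_simps)
qed

text \<open>\<open>H1\<close> is written with \<open>deriv\<close>, unspecified at nodes; these form
  a countable and hence negligible set.\<close>

lemma deriv_product_integrable:
  assumes "v \<in> G.V" "bounded_borel w"
  shows "(\<lambda>t. w t * deriv v t) integrable_on {b..c}"
proof (rule integrable_spike[OF _ G.negligible_nodes])
  show "(\<lambda>t. w t * slope g v t) integrable_on {b..c}"
    by (intro bounded_borel_integrable_real bounded_borel_intros assms G.slope_bounded_borel)
qed (simp add: slope_def)

end

section \<open>The one-dimensional operator\<close>

lemma mesh1_pmesh: "mesh1 a P \<mu> \<Longrightarrow> pmesh (fst \<mu>) P (snd \<mu>)"
  by (auto simp: mesh1_def pmesh_def)

text \<open>The first summand of \<open>K\<close> is the bound for the advection terms with all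
  widths at least \<open>\<sigma> * hmax1 \<mu>\<close>, the second is h/\<tau>max; both are cleared
  of the factor 1/h.\<close>

lemma energy_space_1d:
  fixes \<beta> Ccfl a P \<sigma> :: real and k :: nat
  assumes "\<beta> \<noteq> 0" "0 < Ccfl" "0 < \<sigma>"
  defines "K \<equiv> \<bar>\<beta>\<bar> * (3 * inv_const k + 1) / \<sigma> + \<bar>\<beta>\<bar> / Ccfl"
  assumes \<mu>: "\<mu> \<in> quasi_uniform_meshes1 a P \<sigma>"
  shows "0 < hmax1 \<mu>" and "energy_space (S1 k P \<mu>) pcomb (ip1 a P) (H1 \<beta> Ccfl a P \<mu>) (K / hmax1 \<mu>)"
proof -
  define N where "N = fst \<mu>"
  define g where "g = snd \<mu>"
  define x where "x = centres g"
  define h where "h = hmax1 \<mu>"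
  define \<delta> where "\<delta> = \<sigma> * h"
  have m: "mesh1 a P \<mu>" and qu: "\<sigma> * h \<le> hmin1 \<mu>" using \<mu> by (auto simp: quasi_uniform_meshes1_def h_def)
  interpret M: pmesh k N P g unfolding N_def g_def by (rule mesh1_pmesh[OF m])
  interpret I: interlaced k N P g x unfolding x_def by (rule M.centres_interlaced)
  interpret D: interlaced k N P x "\<lambda>i. g (i + 1)" by (rule I.dual)
  have fin: "finite ((\<lambda>i. g (i + 1) - g i) ` {0..<int N})" "(\<lambda>i. g (i + 1) - g i) ` {0..<int N} \<noteq> {}" using M.N_pos by auto
  have "g (0 + 1) - g 0 \<in> (\<lambda>i. g (i + 1) - g i) ` {0..<int N}"
    by (rule image_eqI[of _ _ 0]) (use M.N_pos in auto)
  then have "g (0 + 1) - g 0 \<le> h"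
    unfolding h_def hmax1_def N_def[symmetric] g_def[symmetric] using fin by (intro Max_ge) auto
  then have h: "0 < h" using M.g_less[of 0] by simp
  then show "0 < hmax1 \<mu>" by (simp add: h_def)
  have "hmin1 \<mu> \<le> g (i + 1) - g i" for i
    unfolding M.width_eq[of i] hmin1_def N_def[symmetric] g_def[symmetric] using M.N_pos fin by (intro Min_le) auto
  then have \<delta>g: "\<delta> \<le> g (i + 1) - g i" for i using qu unfolding \<delta>_def by (rule order_trans[rotated])
  then have \<delta>x: "\<delta> \<le> x (i + 1) - x i" for i unfolding x_def by (rule M.centres_width)
  have \<delta>g': "\<delta> \<le> g (i + 1 + 1) - g (i + 1)" for i by (rule \<delta>g)
  have \<delta>: "0 < \<delta>" using h \<open>0 < \<sigma>\<close> by (simp add: \<delta>_def)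
  have S: "S1 k P \<mu> = M.V \<times> I.X.V" by (simp add: S1_def g_def x_def)
  have SD: "u \<in> S1 k P \<mu> \<longleftrightarrow> fst u \<in> M.V \<and> snd u \<in> I.X.V" for u unfolding S mem_Times_iff ..
  have DV: "dg_space1 k P (\<lambda>i. g (i + 1)) = M.V" by (rule M.shifted_space)
  have ip: "ip1 a P = pip (cbox a (a + P))" by (simp add: ip1_def pip_def fun_eq_iff)
  note C0 = inv_const(1)[of k]
  interpret pair_space "S1 k P \<mu>" a "a + P" "inv_const k / \<delta>"
  proof
    show "bounded_borel (fst u)" "bounded_borel (snd u)" if "u \<in> S1 k P \<mu>" for u
      using that SD M.V_bounded_borel I.X.V_bounded_borel by blast+
    show "pcomb c u v \<in> S1 k P \<mu>" if "u \<in> S1 k P \<mu>" "v \<in> S1 k P \<mu>" for u v c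
      using that unfolding SD pcomb_def fst_conv snd_conv by (blast intro: dg_space1_comb)
    show "(fst u z)\<^sup>2 + (snd u z)\<^sup>2 \<le> inv_const k / \<delta> * pip (cbox a (a + P)) u u" if u: "u \<in> S1 k P \<mu>" for u z
    proof -
      have uV: "fst u \<in> M.V" "snd u \<in> I.X.V" using u SD by blast+
      have "bounded_borel (fst u)" "bounded_borel (snd u)"
        using M.V_bounded_borel[OF uV(1)] I.X.V_bounded_borel[OF uV(2)] .
      from pip_split[OF this, of a "a + P"]
      have "pip (cbox a (a + P)) u u = integral {a..a + P} (\<lambda>x. (fst u x)\<^sup>2) + integral {a..a + P} (\<lambda>x. (snd u x)\<^sup>2)"
        by simp
      then show ?thesis
        using M.V_pointwise[OF uV(1) \<delta> \<delta>g, of z a] I.X.V_pointwise[OF uV(2) \<delta> \<delta>x, of z a] by (simp add: distrib_left)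
    qed
    show "0 \<le> inv_const k / \<delta>" using C0 \<delta> by simp
  qed
  \<comment> \<open>The skew part: the primal and the dual term are not skew separately, but each is
    minus the other when tested with the solution itself.\<close>
  define A where "A u \<phi> = \<beta> * (advform a P N g (snd u) (fst \<phi>) + advform a P N x (fst u) (snd \<phi>))" for u \<phi>
  define c where "c = (3 * inv_const k + 1) / \<delta>"
  have pip2: "pip (cbox a (a + P)) u u = integral {a..a + P} (\<lambda>x. (fst u x)\<^sup>2) + integral {a..a + P} (\<lambda>x. (snd u x)\<^sup>2)"
    if "u \<in> S1 k P \<mu>" for u
    using pip_split[OF S_fst[OF that] S_snd[OF that], of a "a + P"] by simp
  show "energy_space (S1 k P \<mu>) pcomb (ip1 a P) (H1 \<beta> Ccfl a P \<mu>) (K / hmax1 \<mu>)"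
    unfolding ip h_def[symmetric]
  proof (rule energy_space_of_split[where A = A and \<theta> = "\<bar>\<beta>\<bar> / (Ccfl * h)" and K' = "\<bar>\<beta>\<bar> * c"])
    fix u \<phi> assume uS: "u \<in> S1 k P \<mu>" and \<phi>S: "\<phi> \<in> S1 k P \<mu>"
    then have V: "fst u \<in> M.V" "snd u \<in> I.X.V" "fst \<phi> \<in> M.V" "snd \<phi> \<in> I.X.V" using SD by blast+
    have bb: "bounded_borel (fst u)" "bounded_borel (snd u)" using uS S_fst S_snd by auto
    have i1: "(\<lambda>t. snd u t * deriv (fst \<phi>) t) integrable_on {a..a + P}" by (rule I.deriv_product_integrable[OF V(3) bb(2)])
    have i2: "(\<lambda>t. fst u t * deriv (snd \<phi>) t) integrable_on {a..a + P}" by (rule D.deriv_product_integrable[OF V(4) bb(1)])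
    have "integral {a..a + P} (\<lambda>y. \<beta> * snd u y * deriv (fst \<phi>) y + \<beta> * fst u y * deriv (snd \<phi>) y)
        = integral {a..a + P} (\<lambda>y. \<beta> * (snd u y * deriv (fst \<phi>) y)) + integral {a..a + P} (\<lambda>y. \<beta> * (fst u y * deriv (snd \<phi>) y))"
      unfolding mult.assoc by (intro hk_integral_add integrable_on_mult_right i1 i2)
    then have E: "integral {a..a + P} (\<lambda>y. \<beta> * snd u y * deriv (fst \<phi>) y + \<beta> * fst u y * deriv (snd \<phi>) y)
        = \<beta> * integral {a..a + P} (\<lambda>y. snd u y * deriv (fst \<phi>) y) + \<beta> * integral {a..a + P} (\<lambda>y. fst u y * deriv (snd \<phi>) y)"
      by simp
    show "H1 \<beta> Ccfl a P \<mu> u \<phi> = A u \<phi> - \<bar>\<beta>\<bar> / (Ccfl * h) * integral (cbox a (a + P)) (\<lambda>z. (fst u z - snd u z) * (fst \<phi> z - snd \<phi> z))"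
    proof -
      have F: "(\<Sum>i\<in>{0..<int N}. \<beta> * snd u (g (i + 1)) * Lim (at_left (g (i + 1))) (fst \<phi>) - \<beta> * snd u (g i) * Lim (at_right (g i)) (fst \<phi>)
            + \<beta> * fst u (x (i + 1)) * Lim (at_left (x (i + 1))) (snd \<phi>) - \<beta> * fst u (x i) * Lim (at_right (x i)) (snd \<phi>))
          = \<beta> * (\<Sum>i\<in>{0..<int N}. snd u (g (i + 1)) * Lim (at_left (g (i + 1))) (fst \<phi>) - snd u (g i) * Lim (at_right (g i)) (fst \<phi>))
          + \<beta> * (\<Sum>i\<in>{0..<int N}. fst u (x (i + 1)) * Lim (at_left (x (i + 1))) (snd \<phi>) - fst u (x i) * Lim (at_right (x i)) (snd \<phi>))"
        unfolding sum_distrib_left sum.distrib[symmetric] by (intro sum.cong refl) (simp add: algebra_simps)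
      have gen: "- (1 / (Ccfl * h / \<bar>\<beta>\<bar>)) * J + (\<beta> * I1 + \<beta> * I2) - (\<beta> * T1 + \<beta> * T2)
          = \<beta> * ((I1 - T1) + (I2 - T2)) - \<bar>\<beta>\<bar> / (Ccfl * h) * J" for J I1 I2 T1 T2 :: real
        by (simp add: algebra_simps)
      show ?thesis
        unfolding H1_def Let_def N_def[symmetric] g_def[symmetric] x_def[symmetric] h_def[symmetric] A_def advform_def E F cbox_interval
        by (rule gen)
    qed
    show "\<bar>A u \<phi>\<bar> \<le> \<bar>\<beta>\<bar> * c * (pip (cbox a (a + P)) u u + pip (cbox a (a + P)) \<phi> \<phi>)"
    proof -
      have "\<bar>advform a P N g (snd u) (fst \<phi>)\<bar> \<le> c * (integral {a..a + P} (\<lambda>t. (snd u t)\<^sup>2) + integral {a..a + P} (\<lambda>t. (fst \<phi> t)\<^sup>2))"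
        unfolding c_def by (rule I.advform_bound[OF V(3,2) \<delta> \<delta>g \<delta>x])
      moreover have "\<bar>advform a P N x (fst u) (snd \<phi>)\<bar> \<le> c * (integral {a..a + P} (\<lambda>t. (fst u t)\<^sup>2) + integral {a..a + P} (\<lambda>t. (snd \<phi> t)\<^sup>2))"
        unfolding c_def by (rule D.advform_bound[OF V(4) _ \<delta> \<delta>x \<delta>g']) (use V DV in simp)
      ultimately have "\<bar>advform a P N g (snd u) (fst \<phi>) + advform a P N x (fst u) (snd \<phi>)\<bar>
          \<le> c * (pip (cbox a (a + P)) u u + pip (cbox a (a + P)) \<phi> \<phi>)"
        unfolding pip2[OF uS] pip2[OF \<phi>S] by (simp add: algebra_simps)
      then show ?thesis unfolding A_def abs_mult by (simp add: mult.assoc mult_left_mono)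
    qed
  next
    fix u assume "u \<in> S1 k P \<mu>"
    then have "fst u \<in> M.V" "snd u \<in> I.X.V" using SD by blast+
    then show "A u u = 0" unfolding A_def using I.advform_skew by simp
  next
    fix u v w and c' :: real assume *: "u \<in> S1 k P \<mu>" "v \<in> S1 k P \<mu>" "w \<in> S1 k P \<mu>"
    then have V: "fst u \<in> M.V" "snd u \<in> I.X.V" "fst v \<in> M.V" "snd v \<in> I.X.V" "fst w \<in> M.V" "snd w \<in> I.X.V" using SD by blast+
    have bb: "bounded_borel (fst u)" "bounded_borel (snd u)" "bounded_borel (fst v)" "bounded_borel (snd v)" "bounded_borel (fst w)" "bounded_borel (snd w)"
      using * S_fst S_snd by auto
    have lin: "\<beta> * ((p + c' * q) + (r + c' * t)) = \<beta> * (p + r) + c' * (\<beta> * (q + t))" for p q r t :: real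
      by (simp add: algebra_simps)
    show "A (pcomb c' u v) w = A u w + c' * A v w"
      unfolding A_def pcomb_def fst_conv snd_conv I.advform_comb_left[OF V(5) bb(2,4)] D.advform_comb_left[OF V(6) bb(1,3)]
      by (rule lin)
    show "A w (pcomb c' u v) = A w u + c' * A w v"
      unfolding A_def pcomb_def fst_conv snd_conv I.advform_comb_right[OF bb(6) V(1,3)] D.advform_comb_right[OF bb(5) V(2,4)]
      by (rule lin)
  next
    show "0 \<le> \<bar>\<beta>\<bar> / (Ccfl * h)" using \<open>0 < Ccfl\<close> h by simp
    show "0 < K / h" unfolding K_def using assms(1-3) C0 h by (intro divide_pos_pos add_pos_pos mult_pos_pos) auto
    show "\<bar>\<beta>\<bar> * c + \<bar>\<beta>\<bar> / (Ccfl * h) \<le> K / h" 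
    proof -
      have "\<bar>\<beta>\<bar> * (q / (\<sigma> * h)) + \<bar>\<beta>\<bar> / (Ccfl * h) = (\<bar>\<beta>\<bar> * q / \<sigma> + \<bar>\<beta>\<bar> / Ccfl) / h" for q
        by (simp add: add_divide_distrib)
      then show ?thesis unfolding K_def c_def \<delta>_def by (intro eq_refl)
    qed
  qed
qed

section \<open>The two-dimensional operator\<close>

text \<open>The estimates only use the degree in each variable separately.\<close>

definition tensor_space :: "nat \<Rightarrow> real \<Rightarrow> real \<Rightarrow> (int \<Rightarrow> real) \<Rightarrow> (int \<Rightarrow> real) \<Rightarrow> (real \<times> real \<Rightarrow> real) set" where
  "tensor_space k P P' g y = {u. (\<forall>t s. u (t + P, s) = u (t, s) \<and> u (t, s + P') = u (t, s)) \<and>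
     (\<forall>i j. \<exists>cf. \<forall>z\<in>{g i..<g (i+1)} \<times> {y j..<y (j+1)}. u z = (\<Sum>p\<le>k. \<Sum>q\<le>k. cf p q * fst z ^ p * snd z ^ q))}"

lemma dg_space2_tensor: "u \<in> dg_space2 k P P' g y \<Longrightarrow> u \<in> tensor_space k P P' g y"
proof -
  assume u: "u \<in> dg_space2 k P P' g y"
  have "\<exists>cf. \<forall>z\<in>{g i..<g (i+1)} \<times> {y j..<y (j+1)}. u z = (\<Sum>p\<le>k. \<Sum>q\<le>k. cf p q * fst z ^ p * snd z ^ q)" for i j
  proof -
    obtain cf where cf: "\<And>z. z \<in> {g i..<g (i+1)} \<times> {y j..<y (j+1)} \<Longrightarrow> u z = (\<Sum>p\<le>k. \<Sum>q\<le>k - p. cf p q * fst z ^ p * snd z ^ q)"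
      using u unfolding dg_space2_def poly2_on_def by blast
    have "(\<Sum>q\<le>k - p. cf p q * fst z ^ p * snd z ^ q) = (\<Sum>q\<le>k. (if q \<le> k - p then cf p q else 0) * fst z ^ p * snd z ^ q)" for p and z :: "real \<times> real"
      by (rule sum.mono_neutral_cong_left) auto
    then show ?thesis using cf by (intro exI[of _ "\<lambda>p q. if q \<le> k - p then cf p q else 0"]) simp
  qed
  then show ?thesis using u by (simp add: tensor_space_def dg_space2_def)
qed

text \<open>Separate degree bounds are symmetric in the variables, so exchanging coordinates turns
  each result on the first direction into one on the second.\<close>

lemma tensor_space_swap:
  assumes "u \<in> tensor_space k P P' g y"
  shows "(\<lambda>z. u (snd z, fst z)) \<in> tensor_space k P' P y g"
proof -
  have "\<exists>cf. \<forall>z\<in>{y j..<y (j+1)} \<times> {g i..<g (i+1)}. u (snd z, fst z) = (\<Sum>p\<le>k. \<Sum>q\<le>k. cf p q * fst z ^ p * snd z ^ q)" for i j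
  proof -
    obtain cf where cf: "\<And>z. z \<in> {g i..<g (i+1)} \<times> {y j..<y (j+1)} \<Longrightarrow> u z = (\<Sum>p\<le>k. \<Sum>q\<le>k. cf p q * fst z ^ p * snd z ^ q)"
      using assms unfolding tensor_space_def by blast
    have "u (snd z, fst z) = (\<Sum>p\<le>k. \<Sum>q\<le>k. cf q p * fst z ^ p * snd z ^ q)" if "z \<in> {y j..<y (j+1)} \<times> {g i..<g (i+1)}" for z
      using that by (subst sum.swap, subst cf) (auto simp: mult_ac)
    then show ?thesis by (intro exI[of _ "\<lambda>p q. cf q p"]) simp
  qed
  then show ?thesis using assms by (simp add: tensor_space_def)
qed

lemma dg_space2_comb:
  assumes "u \<in> dg_space2 k P P' g y" "v \<in> dg_space2 k P P' g y"
  shows "(\<lambda>z. u z + c * v z) \<in> dg_space2 k P P' g y"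
proof -
  have "poly2_on k (\<lambda>z. u z + c * v z) ({g i..<g (i+1)} \<times> {y j..<y (j+1)})" for i j
  proof -
    obtain cf df where "\<forall>z\<in>{g i..<g (i+1)} \<times> {y j..<y (j+1)}. u z = (\<Sum>p\<le>k. \<Sum>q\<le>k - p. cf p q * fst z ^ p * snd z ^ q)"
      "\<forall>z\<in>{g i..<g (i+1)} \<times> {y j..<y (j+1)}. v z = (\<Sum>p\<le>k. \<Sum>q\<le>k - p. df p q * fst z ^ p * snd z ^ q)"
      using assms unfolding dg_space2_def poly2_on_def by blast
    then show ?thesis unfolding poly2_on_def
      by (intro exI[of _ "\<lambda>p q. cf p q + c * df p q"])
        (simp add: sum_distrib_left sum.distrib[symmetric] distrib_right mult.assoc)
  qed
  then show ?thesis using assms by (simp add: dg_space2_def)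
qed

text \<open>All points with second coordinate \<open>s\<close> lie in one row of cells; freezing
  \<open>s\<close> there collapses the coefficients to those of a polynomial in one
  variable.\<close>

lemma tensor_slice:
  assumes "pmesh N' P' y" and v: "v \<in> tensor_space k P P' g y"
  shows "(\<lambda>t. v (t, s)) \<in> dg_space1 k P g"
proof -
  interpret Y: pmesh k N' P' y by (rule assms(1))
  obtain j where j: "y j \<le> s" "s < y (j + 1)" using Y.cover by blast
  have "\<exists>p. degree p \<le> k \<and> (\<forall>x\<in>{g i..<g (i + 1)}. v (x, s) = poly p x)" for i
  proof -
    obtain cf where cf: "\<And>z. z \<in> {g i..<g (i+1)} \<times> {y j..<y (j+1)} \<Longrightarrow> v z = (\<Sum>p\<le>k. \<Sum>q\<le>k. cf p q * fst z ^ p * snd z ^ q)"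
      using v unfolding tensor_space_def by blast
    define p where "p = (\<Sum>p\<le>k. monom (\<Sum>q\<le>k. cf p q * s ^ q) p)"
    have "degree p \<le> k" unfolding p_def by (intro degree_sum_le) (auto intro: order_trans[OF degree_monom_le])
    moreover have "v (x, s) = poly p x" if "x \<in> {g i..<g (i + 1)}" for x
      using cf[of "(x, s)"] that j by (simp add: p_def poly_sum poly_monom sum_distrib_left sum_distrib_right mult_ac)
    ultimately show ?thesis by blast
  qed
  then show ?thesis using v by (simp add: dg_space1_def pw_poly1_def tensor_space_def)
qed

definition xform :: "real \<Rightarrow> real \<Rightarrow> real \<Rightarrow> real \<Rightarrow> nat \<Rightarrow> (int \<Rightarrow> real) \<Rightarrow> (real \<times> real \<Rightarrow> real) \<Rightarrow> (real \<times> real \<Rightarrow> real) \<Rightarrow> real" where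
  "xform a P a' P' N g w v = integral {a'..a' + P'} (\<lambda>s. advform a P N g (\<lambda>t. w (t, s)) (\<lambda>t. v (t, s)))"

locale pmesh2 = G: pmesh k N P g + Y: pmesh k N' P' y
  for k N :: nat and P :: real and g :: "int \<Rightarrow> real" and N' :: nat and P' :: real and y :: "int \<Rightarrow> real"
begin

abbreviation "T \<equiv> tensor_space k P P' g y"

lemma slice_x: "v \<in> T \<Longrightarrow> (\<lambda>t. v (t, s)) \<in> G.V"
  by (rule tensor_slice[OF Y.pmesh_axioms])

lemma slice_y: "v \<in> T \<Longrightarrow> (\<lambda>s. v (t, s)) \<in> Y.V"
  using tensor_slice[OF G.pmesh_axioms tensor_space_swap, of v k P' y t] by simp

lemma T_periodic: "v \<in> T \<Longrightarrow> v (t + P, s) = v (t, s)" "v \<in> T \<Longrightarrow> v (t, s + P') = v (t, s)"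
  by (auto simp: tensor_space_def)

definition cf :: "(real \<times> real \<Rightarrow> real) \<Rightarrow> int \<Rightarrow> int \<Rightarrow> nat \<Rightarrow> nat \<Rightarrow> real" where
  "cf v i j = (SOME cf. \<forall>z\<in>{g i..<g (i+1)} \<times> {y j..<y (j+1)}. v z = (\<Sum>p\<le>k. \<Sum>q\<le>k. cf p q * fst z ^ p * snd z ^ q))"

lemma cf:
  assumes "v \<in> T" "g i \<le> t" "t < g (i + 1)" "y j \<le> s" "s < y (j + 1)"
  shows "v (t, s) = (\<Sum>p\<le>k. \<Sum>q\<le>k. cf v i j p q * t ^ p * s ^ q)"
proof -
  have "\<exists>cf. \<forall>z\<in>{g i..<g (i+1)} \<times> {y j..<y (j+1)}. v z = (\<Sum>p\<le>k. \<Sum>q\<le>k. cf p q * fst z ^ p * snd z ^ q)"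
    using assms(1) unfolding tensor_space_def by blast
  from someI_ex[OF this, folded cf_def] have "\<forall>z\<in>{g i..<g (i+1)} \<times> {y j..<y (j+1)}. v z = (\<Sum>p\<le>k. \<Sum>q\<le>k. cf v i j p q * fst z ^ p * snd z ^ q)" .
  then show ?thesis using assms(2-) by auto
qed

lemma UN_cells2: "(\<Union>ij. {g (fst ij)..<g (fst ij + 1)} \<times> {y (snd ij)..<y (snd ij + 1)}) = UNIV"
proof (intro set_eqI iffI UNIV_I)
  fix z :: "real \<times> real"
  obtain i j where "g i \<le> fst z" "fst z < g (i + 1)" "y j \<le> snd z" "snd z < y (j + 1)"
    using G.cover[of "fst z"] Y.cover[of "snd z"] by blast
  then show "z \<in> (\<Union>ij. {g (fst ij)..<g (fst ij + 1)} \<times> {y (snd ij)..<y (snd ij + 1)})"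
    by (intro UN_I[of "(i, j)"]) (auto simp: mem_Times_iff)
qed

lemma T_bounded:
  assumes v: "v \<in> T" shows "\<exists>M. \<forall>z. \<bar>v z\<bar> \<le> M"
proof -
  have ex: "\<exists>M. \<forall>z\<in>cbox (g i, y j) (g (i + 1), y (j + 1)). \<bar>\<Sum>p\<le>k. \<Sum>q\<le>k. cf v i j p q * fst z ^ p * snd z ^ q\<bar> \<le> M" for i j
  proof -
    have "continuous_on (cbox (g i, y j) (g (i + 1), y (j + 1))) (\<lambda>z. \<Sum>p\<le>k. \<Sum>q\<le>k. cf v i j p q * fst z ^ p * snd z ^ q)"
      by (intro continuous_intros)
    then show ?thesis by (rule compact_abs_bound[OF compact_cbox])
  qed
  define M where "M i j = (SOME M. \<forall>z\<in>cbox (g i, y j) (g (i + 1), y (j + 1)). \<bar>\<Sum>p\<le>k. \<Sum>q\<le>k. cf v i j p q * fst z ^ p * snd z ^ q\<bar> \<le> M)" for i j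
  have M: "\<bar>\<Sum>p\<le>k. \<Sum>q\<le>k. cf v i j p q * fst z ^ p * snd z ^ q\<bar> \<le> M i j" if "z \<in> cbox (g i, y j) (g (i + 1), y (j + 1))" for i j z
    using someI_ex[OF ex[of i j], folded M_def] that by (rule bspec)
  have "\<bar>v (t, s)\<bar> \<le> (\<Sum>i\<in>{0..<int N}. \<Sum>j\<in>{0..<int N'}. \<bar>M i j\<bar>)" for t s
  proof -
    obtain i a where i: "i \<in> {0..<int N}" "g i \<le> t - of_int a * P" "t - of_int a * P < g (i + 1)"
      using G.cell_reduce by blast
    obtain j b where j: "j \<in> {0..<int N'}" "y j \<le> s - of_int b * P'" "s - of_int b * P' < y (j + 1)"
      using Y.cell_reduce by blast
    have "v (t, s) = v (t - of_int a * P, s)"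
      using G.periodic_int[of "\<lambda>t. v (t, s)" t "- a"] T_periodic[OF v] by simp
    also have "\<dots> = v (t - of_int a * P, s - of_int b * P')"
      using Y.periodic_int[of "\<lambda>s. v (t - of_int a * P, s)" s "- b"] T_periodic[OF v] by simp
    also have "\<bar>\<dots>\<bar> \<le> M i j"
      using M[of "(t - of_int a * P, s - of_int b * P')" i j] cf[OF v i(2,3) j(2,3)] i j by (simp add: cbox_Pair_iff)
    also have "\<dots> \<le> (\<Sum>j\<in>{0..<int N'}. \<bar>M i j\<bar>)"
      using member_le_sum[of j "{0..<int N'}" "\<lambda>j. \<bar>M i j\<bar>"] j by auto
    also have "\<dots> \<le> (\<Sum>i\<in>{0..<int N}. \<Sum>j\<in>{0..<int N'}. \<bar>M i j\<bar>)"
      using i by (intro member_le_sum[of i _ "\<lambda>i. \<Sum>j\<in>{0..<int N'}. \<bar>M i j\<bar>"]) (auto intro: sum_nonneg)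
    finally show ?thesis .
  qed
  then show ?thesis by (intro exI[of _ "\<Sum>i\<in>{0..<int N}. \<Sum>j\<in>{0..<int N'}. \<bar>M i j\<bar>"]) auto
qed

lemma cell_borel: "{a..<b} \<times> {c..<d} \<in> sets (borel :: (real \<times> real) measure)"
  unfolding borel_prod[symmetric] by simp

lemma T_bounded_borel:
  assumes v: "v \<in> T" shows "bounded_borel v"
  unfolding bounded_borel_def
proof
  show "v \<in> borel_measurable borel"
  proof (rule borel_measurable_cells[OF _ UN_cells2])
    show "(\<lambda>z. \<Sum>p\<le>k. \<Sum>q\<le>k. cf v (fst ij) (snd ij) p q * fst z ^ p * snd z ^ q) \<in> borel_measurable borel" for ij
      by (intro borel_measurable_continuous_onI continuous_intros)
    show "v z = (\<Sum>p\<le>k. \<Sum>q\<le>k. cf v (fst ij) (snd ij) p q * fst z ^ p * snd z ^ q)"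
      if "z \<in> {g (fst ij)..<g (fst ij + 1)} \<times> {y (snd ij)..<y (snd ij + 1)}" for ij z
      using cf[OF v, of "fst ij" "fst z" "snd ij" "snd z"] that by (simp add: mem_Times_iff)
  qed (rule cell_borel)
qed (rule T_bounded[OF v])

text \<open>Boundedness comes from the one-dimensional bound with a common \<open>M\<close>. Joint
  measurability, needed to pass between plane and iterated integrals, is read off from an explicit
  formula on every cell.\<close>

lemma slope2_bounded_borel:
  assumes v: "v \<in> T" shows "bounded_borel (\<lambda>z. slope g (\<lambda>t. v (t, snd z)) (fst z))"
proof -
  obtain M where M: "\<And>z. \<bar>v z\<bar> \<le> M" using T_bounded[OF v] by blast
  obtain \<delta> where "0 < \<delta>" "\<And>i. \<delta> \<le> g (i + 1) - g i" using G.width_min by blast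
  then have "\<bar>slope g (\<lambda>t. v (t, snd z)) (fst z)\<bar> \<le> sqrt (inv_const k) * M / \<delta>" for z
    using G.slope_bound[OF slice_x[OF v] M] by blast
  moreover have "(\<lambda>z. slope g (\<lambda>t. v (t, snd z)) (fst z)) \<in> borel_measurable borel"
  proof (rule borel_measurable_cells[OF _ UN_cells2])
    fix ij :: "int \<times> int"
    let ?F = "\<lambda>z. if fst z = g (fst ij) then 0 else \<Sum>p\<le>k. \<Sum>q\<le>k. cf v (fst ij) (snd ij) p q * (of_nat p * fst z ^ (p - 1)) * snd z ^ q"
    have "closed {z :: real \<times> real. fst z = g (fst ij)}" by (intro closed_Collect_eq continuous_intros)
    then have "{z \<in> space borel. fst z = g (fst ij)} \<in> sets (borel :: (real \<times> real) measure)" using borel_closed by simp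
    then show "?F \<in> borel_measurable borel"
      by (intro measurable_If borel_measurable_continuous_onI continuous_intros)
    fix z assume z: "z \<in> {g (fst ij)..<g (fst ij + 1)} \<times> {y (snd ij)..<y (snd ij + 1)}"
    show "slope g (\<lambda>t. v (t, snd z)) (fst z) = ?F z"
    proof (cases "fst z = g (fst ij)")
      case False
      then have t: "g (fst ij) < fst z" "fst z < g (fst ij + 1)" using z by (auto simp: mem_Times_iff)
      have "((\<lambda>t. v (t, snd z)) has_field_derivative (\<Sum>p\<le>k. \<Sum>q\<le>k. cf v (fst ij) (snd ij) p q * (of_nat p * fst z ^ (p - 1)) * snd z ^ q)) (at (fst z))"
      proof (rule has_field_derivative_transform_within_open[where S = "{g (fst ij)<..<g (fst ij + 1)}"])
        show "((\<lambda>t. \<Sum>p\<le>k. \<Sum>q\<le>k. cf v (fst ij) (snd ij) p q * t ^ p * snd z ^ q) has_field_derivative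
           (\<Sum>p\<le>k. \<Sum>q\<le>k. cf v (fst ij) (snd ij) p q * (of_nat p * fst z ^ (p - 1)) * snd z ^ q)) (at (fst z))"
          by (intro DERIV_sum) (auto intro!: derivative_eq_intros)
        show "(\<Sum>p\<le>k. \<Sum>q\<le>k. cf v (fst ij) (snd ij) p q * t ^ p * snd z ^ q) = v (t, snd z)" if "t \<in> {g (fst ij)<..<g (fst ij + 1)}" for t
          using cf[OF v, of "fst ij" t "snd ij" "snd z"] that z by (simp add: mem_Times_iff)
      qed (use t in auto)
      then show ?thesis using G.cell_not_node[OF t] False by (simp add: slope_def DERIV_imp_deriv)
    qed (simp add: slope_def)
  qed (rule cell_borel)
  ultimately show ?thesis unfolding bounded_borel_def by blast
qed

lemma trace_bounded_borel:
  assumes v: "v \<in> T" shows "bounded_borel (\<lambda>s. Lim (at_left (g i)) (\<lambda>t. v (t, s)))"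
proof -
  obtain M where M: "\<And>z. \<bar>v z\<bar> \<le> M" using T_bounded[OF v] by blast
  have lim: "((\<lambda>t. v (t, s)) \<longlongrightarrow> Lim (at_left (g i)) (\<lambda>t. v (t, s))) (at_left (g i))" for s
    by (rule G.left_tendsto[OF slice_x[OF v]])
  have "\<bar>Lim (at_left (g i)) (\<lambda>t. v (t, s))\<bar> \<le> M" for s
    using Lim_norm_ubound[OF _ lim, of s M] M by simp
  moreover have "(\<lambda>s. Lim (at_left (g i)) (\<lambda>t. v (t, s))) \<in> borel_measurable borel"
  proof (rule borel_measurable_cells[OF _ Y.UN_cells])
    show "(\<lambda>s. \<Sum>p\<le>k. \<Sum>q\<le>k. cf v (i - 1) j p q * g i ^ p * s ^ q) \<in> borel_measurable borel" for j
      by (intro borel_measurable_continuous_onI continuous_intros)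
    fix j s assume s: "s \<in> {y j..<y (j + 1)}"
    have "eventually (\<lambda>t. (\<Sum>p\<le>k. \<Sum>q\<le>k. cf v (i - 1) j p q * t ^ p * s ^ q) = v (t, s)) (at_left (g i))"
      unfolding eventually_at_left_field
      using G.g_less[of "i - 1"] cf[OF v, of "i - 1" _ j s] s by (intro exI[of _ "g (i - 1)"]) auto
    then have "((\<lambda>t. v (t, s)) \<longlongrightarrow> (\<Sum>p\<le>k. \<Sum>q\<le>k. cf v (i - 1) j p q * g i ^ p * s ^ q)) (at_left (g i))"
      by (rule Lim_transform_eventually[rotated]) (intro tendsto_intros)
    then show "Lim (at_left (g i)) (\<lambda>t. v (t, s)) = (\<Sum>p\<le>k. \<Sum>q\<le>k. cf v (i - 1) j p q * g i ^ p * s ^ q)"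
      by (intro tendsto_Lim) auto
  qed simp
  ultimately show ?thesis unfolding bounded_borel_def by blast
qed

text \<open>The one-dimensional bound used twice: in the second variable at fixed \<open>t\<close>,
  then in the first one under the integral sign.\<close>

lemma T_pointwise:
  assumes v: "v \<in> T" and \<delta>: "0 < \<delta>" "\<And>i. \<delta> \<le> g (i + 1) - g i" and \<delta>': "0 < \<delta>'" "\<And>i. \<delta>' \<le> y (i + 1) - y i"
  shows "(v z)\<^sup>2 \<le> inv_const k / \<delta>' * (inv_const k / \<delta>) * integral (cbox (a, a') (a + P, a' + P')) (\<lambda>z. (v z)\<^sup>2)"
proof -
  note C = inv_const(1)[of k]
  have bv: "bounded_borel (\<lambda>z. (v z)\<^sup>2)" by (intro bounded_borel_intros T_bounded_borel v)
  obtain t s where z: "z = (t, s)" by (cases z)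
  have "(v (t, s))\<^sup>2 \<le> inv_const k / \<delta>' * integral {a'..a' + P'} (\<lambda>s. (v (t, s))\<^sup>2)"
    by (rule Y.V_pointwise[OF slice_y[OF v] \<delta>'])
  also have "\<dots> \<le> inv_const k / \<delta>' * integral {a'..a' + P'} (\<lambda>s. inv_const k / \<delta> * integral {a..a + P} (\<lambda>t. (v (t, s))\<^sup>2))"
  proof (intro mult_left_mono integral_le)
    show "(\<lambda>s. (v (t, s))\<^sup>2) integrable_on {a'..a' + P'}"
      by (intro bounded_borel_integrable_real bounded_borel_slice(2)[OF bv])
    show "(\<lambda>s. inv_const k / \<delta> * integral {a..a + P} (\<lambda>t. (v (t, s))\<^sup>2)) integrable_on {a'..a' + P'}"
      by (intro bounded_borel_integrable_real bounded_borel_mult bounded_borel_const bounded_borel_integral_fst(1)[OF bv])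
    show "(v (t, s))\<^sup>2 \<le> inv_const k / \<delta> * integral {a..a + P} (\<lambda>t. (v (t, s))\<^sup>2)" for s
      by (rule G.V_pointwise[OF slice_x[OF v] \<delta>])
    show "0 \<le> inv_const k / \<delta>'" using C \<delta>' by simp
  qed
  also have "\<dots> = inv_const k / \<delta>' * (inv_const k / \<delta>) * integral (cbox (a, a') (a + P, a' + P')) (\<lambda>z. (v z)\<^sup>2)"
    unfolding bounded_borel_integral_fst(2)[OF bv] by simp
  finally show ?thesis by (simp add: z)
qed

end

locale interlaced2 = interlaced k N P g x + Y: pmesh k N' P' y
  for k N :: nat and P :: real and g x :: "int \<Rightarrow> real" and N' :: nat and P' :: real and y :: "int \<Rightarrow> real"
begin

sublocale GY: pmesh2 k N P g N' P' y ..

text \<open>What a trial function must satisfy. In the second variable only periodicity is asked,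
  because trial and test functions are piecewise polynomial there on different meshes.\<close>

definition adm :: "(real \<times> real \<Rightarrow> real) \<Rightarrow> bool" where
  "adm w \<longleftrightarrow> bounded_borel w \<and> (\<forall>s. (\<lambda>t. w (t, s)) \<in> X.V) \<and> (\<forall>t s. w (t, s + P') = w (t, s))"

lemma bounded_borel_parts:
  assumes v: "v \<in> GY.T" and w: "bounded_borel w"
  shows "bounded_borel (\<lambda>s. integral {a..a + P} (\<lambda>t. w (t, s) * slope g (\<lambda>t. v (t, s)) t))"
    and "bounded_borel (\<lambda>s. w (g (i + 1), s) * Lim (at_left (g (i + 1))) (\<lambda>t. v (t, s)))"
    and "bounded_borel (\<lambda>s. w (g i, s) * Lim (at_right (g i)) (\<lambda>t. v (t, s)))"
proof -
  have f: "bounded_borel (\<lambda>z. w z * slope g (\<lambda>t. v (t, snd z)) (fst z))"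
    by (intro bounded_borel_mult w GY.slope2_bounded_borel v)
  show "bounded_borel (\<lambda>s. integral {a..a + P} (\<lambda>t. w (t, s) * slope g (\<lambda>t. v (t, s)) t))"
    using bounded_borel_integral_fst(1)[OF f] by simp
  show "bounded_borel (\<lambda>s. w (g (i + 1), s) * Lim (at_left (g (i + 1))) (\<lambda>t. v (t, s)))"
    by (intro bounded_borel_mult bounded_borel_slice(2)[OF w] GY.trace_bounded_borel v)
  show "bounded_borel (\<lambda>s. w (g i, s) * Lim (at_right (g i)) (\<lambda>t. v (t, s)))"
    unfolding G.Lim_right[OF GY.slice_x[OF v]]
    by (intro bounded_borel_mult bounded_borel_slice(2)[OF w] bounded_borel_slice(2)[OF GY.T_bounded_borel[OF v]])
qed

lemma advform_slice_bounded_borel: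
  assumes v: "v \<in> GY.T" and w: "bounded_borel w"
  shows "bounded_borel (\<lambda>s. advform a P N g (\<lambda>t. w (t, s)) (\<lambda>t. v (t, s)))"
  unfolding advform_slope
  by (intro bounded_borel_diff bounded_borel_sum bounded_borel_parts[OF v w])

text \<open>Splits the integral over the second variable at the nodes \<open>y j\<close>, so that
  the form matches the cell-by-cell edge integrals of \<open>H2\<close>. Periodicity of both
  functions lets the period start at a node instead of \<open>a'\<close>.\<close>

lemma xform_expand:
  assumes v: "v \<in> GY.T" and w: "adm w"
  shows "xform a P a' P' N g w v
    = integral (cbox (a, a') (a + P, a' + P')) (\<lambda>z. w z * slope g (\<lambda>t. v (t, snd z)) (fst z))
    - (\<Sum>i\<in>{0..<int N}. \<Sum>j\<in>{0..<int N'}.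
        integral {y j..y (j + 1)} (\<lambda>s. w (g (i + 1), s) * Lim (at_left (g (i + 1))) (\<lambda>t. v (t, s)))
      - integral {y j..y (j + 1)} (\<lambda>s. w (g i, s) * Lim (at_right (g i)) (\<lambda>t. v (t, s))))"
proof -
  have bw: "bounded_borel w" and per: "w (t, s + P') = w (t, s)" for t s using w by (auto simp: adm_def)
  note bb = bounded_borel_parts[OF v bw]
  have vper: "(\<lambda>t. v (t, s + P')) = (\<lambda>t. v (t, s))" for s using GY.T_periodic(2)[OF v] by simp
  let ?L = "\<lambda>i s. w (g (i + 1), s) * Lim (at_left (g (i + 1))) (\<lambda>t. v (t, s))"
  let ?R = "\<lambda>i s. w (g i, s) * Lim (at_right (g i)) (\<lambda>t. v (t, s))"
  have f: "bounded_borel (\<lambda>z. w z * slope g (\<lambda>t. v (t, snd z)) (fst z))"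
    by (intro bounded_borel_mult bw GY.slope2_bounded_borel v)
  have "xform a P a' P' N g w v = integral {a'..a' + P'} (\<lambda>s. integral {a..a + P} (\<lambda>t. w (t, s) * slope g (\<lambda>t. v (t, s)) t))
      - integral {a'..a' + P'} (\<lambda>s. \<Sum>i\<in>{0..<int N}. ?L i s - ?R i s)"
    unfolding xform_def advform_slope
    by (intro hk_integral_diff bounded_borel_integrable_real bounded_borel_diff bounded_borel_sum bb)
  also have "integral {a'..a' + P'} (\<lambda>s. integral {a..a + P} (\<lambda>t. w (t, s) * slope g (\<lambda>t. v (t, s)) t))
      = integral (cbox (a, a') (a + P, a' + P')) (\<lambda>z. w z * slope g (\<lambda>t. v (t, snd z)) (fst z))"
    using bounded_borel_integral_fst(2)[OF f, of a a' "a + P" "a' + P'"] by simp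
  also have "integral {a'..a' + P'} (\<lambda>s. \<Sum>i\<in>{0..<int N}. ?L i s - ?R i s)
      = (\<Sum>i\<in>{0..<int N}. integral {a'..a' + P'} (\<lambda>s. ?L i s - ?R i s))"
    by (intro hk_integral_sum bounded_borel_integrable_real bounded_borel_diff bb finite_atLeastLessThan_int)
  also have "\<dots> = (\<Sum>i\<in>{0..<int N}. \<Sum>j\<in>{0..<int N'}. integral {y j..y (j + 1)} (?L i) - integral {y j..y (j + 1)} (?R i))"
  proof (intro sum.cong refl)
    fix i
    have "integral {a'..a' + P'} (\<lambda>s. ?L i s - ?R i s) = integral {a'..a' + P'} (?L i) - integral {a'..a' + P'} (?R i)"
      by (intro hk_integral_diff bounded_borel_integrable_real bb)
    also have "integral {a'..a' + P'} (?L i) = (\<Sum>j\<in>{0..<int N'}. integral {y (j + 0)..y (j + 0 + 1)} (?L i))"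
      by (rule Y.integral_cells[symmetric, OF bb(2)]) (simp only: per vper)
    also have "integral {a'..a' + P'} (?R i) = (\<Sum>j\<in>{0..<int N'}. integral {y (j + 0)..y (j + 0 + 1)} (?R i))"
      by (rule Y.integral_cells[symmetric, OF bb(3)]) (simp only: per vper)
    finally show "integral {a'..a' + P'} (\<lambda>s. ?L i s - ?R i s)
        = (\<Sum>j\<in>{0..<int N'}. integral {y j..y (j + 1)} (?L i) - integral {y j..y (j + 1)} (?R i))"
      by (simp add: sum_subtractf)
  qed
  finally show ?thesis .
qed

lemma xform_bound:
  assumes v: "v \<in> GY.T" and w: "adm w"
    and \<delta>: "0 < \<delta>" "\<And>i. \<delta> \<le> g (i + 1) - g i" "\<And>i. \<delta> \<le> x (i + 1) - x i"
  shows "\<bar>xform a P a' P' N g w v\<bar> \<le> (3 * inv_const k + 1) / \<delta> *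
    (integral (cbox (a, a') (a + P, a' + P')) (\<lambda>z. (w z)\<^sup>2) + integral (cbox (a, a') (a + P, a' + P')) (\<lambda>z. (v z)\<^sup>2))"
proof -
  define c where "c = (3 * inv_const k + 1) / \<delta>"
  have bw: "bounded_borel w" and wX: "(\<lambda>t. w (t, s)) \<in> X.V" for s using w by (auto simp: adm_def)
  have bw2: "bounded_borel (\<lambda>z. (w z)\<^sup>2)" and bv2: "bounded_borel (\<lambda>z. (v z)\<^sup>2)"
    using bounded_borel_power2[OF bw] bounded_borel_power2[OF GY.T_bounded_borel[OF v]] .
  note iw = bounded_borel_integral_fst[OF bw2] and iv = bounded_borel_integral_fst[OF bv2]
  have "norm (xform a P a' P' N g w v) \<le> integral {a'..a' + P'} (\<lambda>s. c * (integral {a..a + P} (\<lambda>t. (w (t, s))\<^sup>2) + integral {a..a + P} (\<lambda>t. (v (t, s))\<^sup>2)))"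
    unfolding xform_def
  proof (rule integral_norm_bound_integral)
    show "norm (advform a P N g (\<lambda>t. w (t, s)) (\<lambda>t. v (t, s)))
        \<le> c * (integral {a..a + P} (\<lambda>t. (w (t, s))\<^sup>2) + integral {a..a + P} (\<lambda>t. (v (t, s))\<^sup>2))" for s
      using advform_bound[OF GY.slice_x[OF v] wX \<delta>] by (simp add: c_def)
    show "(\<lambda>s. advform a P N g (\<lambda>t. w (t, s)) (\<lambda>t. v (t, s))) integrable_on {a'..a' + P'}"
      by (intro bounded_borel_integrable_real advform_slice_bounded_borel v bw)
    show "(\<lambda>s. c * (integral {a..a + P} (\<lambda>t. (w (t, s))\<^sup>2) + integral {a..a + P} (\<lambda>t. (v (t, s))\<^sup>2))) integrable_on {a'..a' + P'}"
      by (intro bounded_borel_integrable_real bounded_borel_mult bounded_borel_const bounded_borel_add iw(1) iv(1))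
  qed
  also have "\<dots> = c * (integral {a'..a' + P'} (\<lambda>s. integral {a..a + P} (\<lambda>t. (w (t, s))\<^sup>2)) + integral {a'..a' + P'} (\<lambda>s. integral {a..a + P} (\<lambda>t. (v (t, s))\<^sup>2)))"
    by (subst hk_integral_add[symmetric])
      (simp_all only: bounded_borel_integrable_real iw(1) iv(1) hk_integral_mult_right)
  finally show ?thesis unfolding iw(2) iv(2) c_def by simp
qed

lemma xform_comb_left:
  assumes v: "v \<in> GY.T" and w: "bounded_borel w1" "bounded_borel w2"
  shows "xform a P a' P' N g (\<lambda>z. w1 z + c * w2 z) v = xform a P a' P' N g w1 v + c * xform a P a' P' N g w2 v"
proof -
  note F = advform_slice_bounded_borel[OF v w(1)] advform_slice_bounded_borel[OF v w(2)]
  have "xform a P a' P' N g (\<lambda>z. w1 z + c * w2 z) v = integral {a'..a' + P'}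
      (\<lambda>s. advform a P N g (\<lambda>t. w1 (t, s)) (\<lambda>t. v (t, s)) + c * advform a P N g (\<lambda>t. w2 (t, s)) (\<lambda>t. v (t, s)))"
    unfolding xform_def
    by (simp only: advform_comb_left[OF GY.slice_x[OF v] bounded_borel_slice(1)[OF w(1)] bounded_borel_slice(1)[OF w(2)]])
  also have "\<dots> = xform a P a' P' N g w1 v + integral {a'..a' + P'} (\<lambda>s. c * advform a P N g (\<lambda>t. w2 (t, s)) (\<lambda>t. v (t, s)))"
    unfolding xform_def
    by (intro hk_integral_add bounded_borel_integrable_real bounded_borel_mult bounded_borel_const F)
  finally show ?thesis by (simp add: xform_def)
qed

lemma xform_comb_right:
  assumes w: "bounded_borel w" and v: "v1 \<in> GY.T" "v2 \<in> GY.T"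
  shows "xform a P a' P' N g w (\<lambda>z. v1 z + c * v2 z) = xform a P a' P' N g w v1 + c * xform a P a' P' N g w v2"
proof -
  note F = advform_slice_bounded_borel[OF v(1) w] advform_slice_bounded_borel[OF v(2) w]
  have "xform a P a' P' N g w (\<lambda>z. v1 z + c * v2 z) = integral {a'..a' + P'}
      (\<lambda>s. advform a P N g (\<lambda>t. w (t, s)) (\<lambda>t. v1 (t, s)) + c * advform a P N g (\<lambda>t. w (t, s)) (\<lambda>t. v2 (t, s)))"
    unfolding xform_def
    by (simp only: advform_comb_right[OF bounded_borel_slice(1)[OF w] GY.slice_x[OF v(1)] GY.slice_x[OF v(2)]])
  also have "\<dots> = xform a P a' P' N g w v1 + integral {a'..a' + P'} (\<lambda>s. c * advform a P N g (\<lambda>t. w (t, s)) (\<lambda>t. v2 (t, s)))"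
    unfolding xform_def
    by (intro hk_integral_add bounded_borel_integrable_real bounded_borel_mult bounded_borel_const F)
  finally show ?thesis by (simp add: xform_def)
qed

lemma negligible_lines: "negligible {z :: real \<times> real. fst z \<in> range g}" "negligible {z :: real \<times> real. snd z \<in> range g}"
proof -
  have "negligible {z :: real \<times> real. z \<bullet> (1, 0) = c}" "negligible {z :: real \<times> real. z \<bullet> (0, 1) = c}" for c
    by (rule negligible_standard_hyperplane; simp add: Basis_prod_def)+
  then have n: "negligible {z :: real \<times> real. fst z = c}" "negligible {z :: real \<times> real. snd z = c}" for c
    by (simp_all add: inner_prod_def)
  have "negligible (\<Union> (range (\<lambda>i. {z :: real \<times> real. fst z = g i})))" "negligible (\<Union> (range (\<lambda>i. {z :: real \<times> real. snd z = g i})))"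
    by (rule negligible_countable_Union; use n in auto)+
  moreover have "\<Union> (range (\<lambda>i. {z :: real \<times> real. fst z = g i})) = {z. fst z \<in> range g}"
    "\<Union> (range (\<lambda>i. {z :: real \<times> real. snd z = g i})) = {z. snd z \<in> range g}" by auto
  ultimately show "negligible {z :: real \<times> real. fst z \<in> range g}" "negligible {z :: real \<times> real. snd z \<in> range g}" by simp_all
qed

lemma dx2_integral:
  assumes v: "v \<in> GY.T" and w: "bounded_borel w"
  shows "(\<lambda>z. w z * dx2 v z) integrable_on cbox c d"
    and "integral (cbox c d) (\<lambda>z. w z * dx2 v z) = integral (cbox c d) (\<lambda>z. w z * slope g (\<lambda>t. v (t, snd z)) (fst z))"
proof -
  have i: "(\<lambda>z. w z * slope g (\<lambda>t. v (t, snd z)) (fst z)) integrable_on cbox c d"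
    by (intro bounded_borel_integrable bounded_borel_mult w GY.slope2_bounded_borel v)
  have e: "w z * dx2 v z = w z * slope g (\<lambda>t. v (t, snd z)) (fst z)" if "z \<in> cbox c d - {z. fst z \<in> range g}" for z
    using that by (simp add: slope_def dx2_def)
  show "(\<lambda>z. w z * dx2 v z) integrable_on cbox c d"
    by (rule integrable_spike[OF i negligible_lines(1)]) (rule e)
  show "integral (cbox c d) (\<lambda>z. w z * dx2 v z) = integral (cbox c d) (\<lambda>z. w z * slope g (\<lambda>t. v (t, snd z)) (fst z))"
    by (rule integral_spike[OF negligible_lines(1)]) (rule e[symmetric])
qed

text \<open>The integral is moved to swapped coordinates, where differentiation is in the first
  variable and the slice forms apply.\<close>

lemma dy2_integral:
  assumes v: "(\<lambda>z. v (snd z, fst z)) \<in> GY.T" and w: "bounded_borel w"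
  shows "(\<lambda>z. w z * dy2 v z) integrable_on cbox (c, d) (c', d')"
    and "integral (cbox (c, d) (c', d')) (\<lambda>z. w z * dy2 v z)
      = integral (cbox (d, c) (d', c')) (\<lambda>z. w (snd z, fst z) * slope g (\<lambda>t. v (snd z, t)) (fst z))"
proof -
  have b: "bounded_borel (\<lambda>z. w z * slope g (\<lambda>t. v (fst z, t)) (snd z))"
    using bounded_borel_swap[OF GY.slope2_bounded_borel[OF v]] by (intro bounded_borel_mult w) simp
  have e: "w z * dy2 v z = w z * slope g (\<lambda>t. v (fst z, t)) (snd z)" if "z \<in> cbox (c, d) (c', d') - {z. snd z \<in> range g}" for z
    using that by (simp add: slope_def dy2_def)
  show "(\<lambda>z. w z * dy2 v z) integrable_on cbox (c, d) (c', d')"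
    by (rule integrable_spike[OF bounded_borel_integrable[OF b] negligible_lines(2)]) (rule e)
  have "integral (cbox (c, d) (c', d')) (\<lambda>z. w z * dy2 v z) = integral (cbox (c, d) (c', d')) (\<lambda>z. w z * slope g (\<lambda>t. v (fst z, t)) (snd z))"
    by (rule integral_spike[OF negligible_lines(2)]) (rule e[symmetric])
  also have "\<dots> = integral (cbox (d, c) (d', c')) (\<lambda>z. w (snd z, fst z) * slope g (\<lambda>t. v (snd z, t)) (fst z))"
    using integral_swap_cbox[OF b] by simp
  finally show "integral (cbox (c, d) (c', d')) (\<lambda>z. w z * dy2 v z)
      = integral (cbox (d, c) (d', c')) (\<lambda>z. w (snd z, fst z) * slope g (\<lambda>t. v (snd z, t)) (fst z))" .
qed

end

text \<open>\<open>g\<close>, \<open>x\<close> are primal and dual nodes in the direction of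
  advection, \<open>y\<close>, \<open>z\<close> those in the other direction. Advection in the
  second direction is covered by another instance with the two roles exchanged.\<close>

locale staggered2 = I: interlaced k N P g x + J: interlaced k N' P' y z
  for k N :: nat and P :: real and g x :: "int \<Rightarrow> real" and N' :: nat and P' :: real and y z :: "int \<Rightarrow> real"
begin

sublocale A: interlaced2 k N P g x N' P' y ..

sublocale D: interlaced k N P x "\<lambda>i. g (i + 1)" by (rule I.dual)

sublocale B: interlaced2 k N P x "\<lambda>i. g (i + 1)" N' P' z ..

abbreviation "Tp \<equiv> tensor_space k P P' g y"
abbreviation "Td \<equiv> tensor_space k P P' x z"

lemma Td_adm: "w \<in> Td \<Longrightarrow> A.adm w"
  unfolding A.adm_def using B.GY.T_bounded_borel B.GY.slice_x B.GY.T_periodic(2) by blast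

text \<open>For dual test functions the companion mesh is \<open>g\<close> shifted by one index; by
  \<open>shifted_space\<close> it carries the same functions.\<close>

lemma Tp_adm: "v \<in> Tp \<Longrightarrow> B.adm v"
  unfolding B.adm_def I.G.shifted_space using A.GY.T_bounded_borel A.GY.slice_x A.GY.T_periodic(2) by blast

definition XF :: "real \<Rightarrow> real \<Rightarrow> (real \<times> real \<Rightarrow> real) \<times> (real \<times> real \<Rightarrow> real) \<Rightarrow> (real \<times> real \<Rightarrow> real) \<times> (real \<times> real \<Rightarrow> real) \<Rightarrow> real" where
  "XF a a' u \<phi> = xform a P a' P' N g (snd u) (fst \<phi>) + xform a P a' P' N x (fst u) (snd \<phi>)"

lemma XF_comb_left:
  assumes "u \<in> Tp \<times> Td" "v \<in> Tp \<times> Td" "w \<in> Tp \<times> Td"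
  shows "XF a a' (pcomb c u v) w = XF a a' u w + c * XF a a' v w"
proof -
  have V: "fst w \<in> Tp" "snd w \<in> Td" "fst u \<in> Tp" "snd u \<in> Td" "fst v \<in> Tp" "snd v \<in> Td"
    using assms unfolding mem_Times_iff by blast+
  note bp = A.GY.T_bounded_borel and bd = B.GY.T_bounded_borel
  show ?thesis
    unfolding XF_def pcomb_def fst_conv snd_conv A.xform_comb_left[OF V(1) bd[OF V(4)] bd[OF V(6)]] B.xform_comb_left[OF V(2) bp[OF V(3)] bp[OF V(5)]]
    by (simp only: distrib_left add_ac)
qed

lemma XF_comb_right:
  assumes "u \<in> Tp \<times> Td" "v \<in> Tp \<times> Td" "w \<in> Tp \<times> Td"
  shows "XF a a' w (pcomb c u v) = XF a a' w u + c * XF a a' w v"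
proof -
  have V: "fst w \<in> Tp" "snd w \<in> Td" "fst u \<in> Tp" "snd u \<in> Td" "fst v \<in> Tp" "snd v \<in> Td"
    using assms unfolding mem_Times_iff by blast+
  note bp = A.GY.T_bounded_borel and bd = B.GY.T_bounded_borel
  show ?thesis
    unfolding XF_def pcomb_def fst_conv snd_conv A.xform_comb_right[OF bd[OF V(2)] V(3,5)] B.xform_comb_right[OF bp[OF V(1)] V(4,6)]
    by (simp only: distrib_left add_ac)
qed

lemma XF_skew:
  assumes "u \<in> Tp \<times> Td"
  shows "XF a a' u u = 0"
proof -
  have V: "fst u \<in> Tp" "snd u \<in> Td" using assms unfolding mem_Times_iff by blast+
  note bb = A.advform_slice_bounded_borel[OF V(1) B.GY.T_bounded_borel[OF V(2)]] B.advform_slice_bounded_borel[OF V(2) A.GY.T_bounded_borel[OF V(1)]]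
  have "XF a a' u u = integral {a'..a' + P'} (\<lambda>s. advform a P N g (\<lambda>t. snd u (t, s)) (\<lambda>t. fst u (t, s)) + advform a P N x (\<lambda>t. fst u (t, s)) (\<lambda>t. snd u (t, s)))"
    unfolding XF_def xform_def
    by (intro hk_integral_add[symmetric] bounded_borel_integrable_real bb)
  also have "\<dots> = integral {a'..a' + P'} (\<lambda>s. 0)"
    by (simp only: I.advform_skew[OF A.GY.slice_x[OF V(1)] B.GY.slice_x[OF V(2)]])
  finally show ?thesis by simp
qed

lemma XF_bound:
  assumes "u \<in> Tp \<times> Td" "v \<in> Tp \<times> Td"
    and \<delta>: "0 < \<delta>" "\<And>i. \<delta> \<le> g (i + 1) - g i" "\<And>i. \<delta> \<le> x (i + 1) - x i"
  shows "\<bar>XF a a' u v\<bar> \<le> (3 * inv_const k + 1) / \<delta> * (pip (cbox (a, a') (a + P, a' + P')) u u + pip (cbox (a, a') (a + P, a' + P')) v v)"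
proof -
  have V: "fst u \<in> Tp" "snd u \<in> Td" "fst v \<in> Tp" "snd v \<in> Td" using assms(1,2) unfolding mem_Times_iff by blast+
  note bp = A.GY.T_bounded_borel and bd = B.GY.T_bounded_borel
  note 1 = A.xform_bound[OF V(3) Td_adm[OF V(2)] \<delta>, of a a']
  note 2 = B.xform_bound[OF V(4) Tp_adm[OF V(1)] \<delta>(1,3) \<delta>(2), of a a']
  show ?thesis
    unfolding XF_def pip_split[OF bp[OF V(1)] bd[OF V(2)]] pip_split[OF bp[OF V(3)] bd[OF V(4)]]
    using 1 2 unfolding distrib_left by linarith
qed

end

lemma grid_pmesh:
  assumes "0 < P" "0 < n" shows "pmesh n P (grid a (P / real n))"
proof
  show "strict_mono (grid a (P / real n))"
    using assms by (intro strict_monoI) (simp add: grid_def divide_strict_right_mono)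
  show "grid a (P / real n) (i + int n) = grid a (P / real n) i + P" for i
    using assms by (simp add: grid_def field_simps)
qed (use assms in simp)

text \<open>Sorts the edges by direction and exchanges the sums for the horizontal ones, so that
  each part has the shape produced by \<open>xform_expand\<close> in its own direction.\<close>

lemma sum_cell_flux:
  "(\<Sum>i\<in>I. \<Sum>j\<in>J. cell_flux \<beta>1 \<beta>2 (g i) (g (i + 1)) (y j) (y (j + 1)) w \<phi>)
    = \<beta>1 * (\<Sum>i\<in>I. \<Sum>j\<in>J. integral {y j..y (j + 1)} (\<lambda>s. w (g (i + 1), s) * Lim (at_left (g (i + 1))) (\<lambda>t. \<phi> (t, s)))
        - integral {y j..y (j + 1)} (\<lambda>s. w (g i, s) * Lim (at_right (g i)) (\<lambda>t. \<phi> (t, s))))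
    + \<beta>2 * (\<Sum>j\<in>J. \<Sum>i\<in>I. integral {g i..g (i + 1)} (\<lambda>x. w (x, y (j + 1)) * Lim (at_left (y (j + 1))) (\<lambda>t. \<phi> (x, t)))
        - integral {g i..g (i + 1)} (\<lambda>x. w (x, y j) * Lim (at_right (y j)) (\<lambda>t. \<phi> (x, t))))"
proof -
  have "b * p - b * q + c * r - c * s = b * (p - q) + c * (r - s)" for b c p q r s :: real by (simp add: algebra_simps)
  then show ?thesis
    unfolding cell_flux_def sum.swap[of _ I J] by (simp only: sum.distrib sum_distrib_left)
qed

definition pswap :: "(real \<times> real \<Rightarrow> real) \<times> (real \<times> real \<Rightarrow> real) \<Rightarrow> (real \<times> real \<Rightarrow> real) \<times> (real \<times> real \<Rightarrow> real)" where
  "pswap u = ((\<lambda>z. fst u (snd z, fst z)), (\<lambda>z. snd u (snd z, fst z)))"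

lemma pswap_pcomb: "pswap (pcomb c u v) = pcomb c (pswap u) (pswap v)"
  by (simp add: pswap_def pcomb_def)

lemma pip_pswap:
  assumes "bounded_borel (fst u)" "bounded_borel (snd u)"
  shows "pip (cbox (c, a) (d, b)) (pswap u) (pswap u) = pip (cbox (a, c) (b, d)) u u"
  unfolding pip_split[OF assms] pip_split[of "pswap u", unfolded pswap_def fst_conv snd_conv, OF bounded_borel_swap[OF assms(1)] bounded_borel_swap[OF assms(2)], folded pswap_def]
    integral_swap_cbox[OF bounded_borel_power2[OF assms(1)]] integral_swap_cbox[OF bounded_borel_power2[OF assms(2)]]
  by simp

text \<open>As in one dimension, with the two velocity components added. Both step sizes are at
  least \<sigma> h, which bounds 1/\<tau>max by a multiple of 1/h and explains \<sigma> in the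
  second denominator of \<open>K\<close>.\<close>

lemma energy_space_2d:
  fixes \<beta>1 \<beta>2 Ccfl a1 a2 P1 P2 \<sigma> :: real and k :: nat
  assumes \<beta>: "(\<beta>1, \<beta>2) \<noteq> (0, 0)" and Ccfl: "0 < Ccfl" and P: "0 < P1" "0 < P2" and \<sigma>: "0 < \<sigma>"
  defines "K \<equiv> (\<bar>\<beta>1\<bar> + \<bar>\<beta>2\<bar>) * (3 * inv_const k + 1) / \<sigma> + (\<bar>\<beta>1\<bar> + \<bar>\<beta>2\<bar>) / (\<sigma> * Ccfl)"
  assumes \<mu>: "\<mu> \<in> uniform_meshes2 P1 P2 \<sigma>"
  shows "0 < hmax2 P1 P2 \<mu>"
    and "energy_space (S2 k a1 a2 P1 P2 \<mu>) pcomb (ip2 a1 a2 P1 P2) (H2 \<beta>1 \<beta>2 Ccfl a1 a2 P1 P2 \<mu>) (K / hmax2 P1 P2 \<mu>)"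
proof -
  define Nx where "Nx = fst \<mu>"
  define Ny where "Ny = snd \<mu>"
  define hx where "hx = P1 / real Nx"
  define hy where "hy = P2 / real Ny"
  define gx where "gx = grid a1 hx"
  define gy where "gy = grid a2 hy"
  define cx where "cx = centres gx"
  define cy where "cy = centres gy"
  define h where "h = hmax2 P1 P2 \<mu>"
  define \<delta> where "\<delta> = \<sigma> * h"
  define \<Omega> where "\<Omega> = cbox (a1, a2) (a1 + P1, a2 + P2)"
  have N: "0 < Nx" "0 < Ny" and qu: "\<delta> \<le> hx" "\<delta> \<le> hy"
    using \<mu> by (auto simp: uniform_meshes2_def Nx_def Ny_def hx_def hy_def \<delta>_def h_def)
  have hxy: "0 < hx" "0 < hy" using P N by (auto simp: hx_def hy_def)
  then have h: "0 < h" by (simp add: h_def hmax2_def Nx_def Ny_def hx_def hy_def)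
  then show "0 < hmax2 P1 P2 \<mu>" by (simp add: h_def)
  have \<delta>: "0 < \<delta>" using h \<sigma> by (simp add: \<delta>_def)
  interpret MX: pmesh k Nx P1 gx unfolding gx_def hx_def by (rule grid_pmesh[OF P(1) N(1)])
  interpret MY: pmesh k Ny P2 gy unfolding gy_def hy_def by (rule grid_pmesh[OF P(2) N(2)])
  interpret IX: interlaced k Nx P1 gx cx unfolding cx_def by (rule MX.centres_interlaced)
  interpret IY: interlaced k Ny P2 gy cy unfolding cy_def by (rule MY.centres_interlaced)
  interpret X: staggered2 k Nx P1 gx cx Ny P2 gy cy ..
  interpret Y: staggered2 k Ny P2 gy cy Nx P1 gx cx ..
  have \<delta>gx: "\<delta> \<le> gx (i + 1) - gx i" for i using qu by (simp add: gx_def grid_def algebra_simps)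
  have \<delta>gy: "\<delta> \<le> gy (i + 1) - gy i" for i using qu by (simp add: gy_def grid_def algebra_simps)
  have \<delta>cx: "\<delta> \<le> cx (i + 1) - cx i" for i unfolding cx_def by (rule MX.centres_width[OF \<delta>gx])
  have \<delta>cy: "\<delta> \<le> cy (i + 1) - cy i" for i unfolding cy_def by (rule MY.centres_width[OF \<delta>gy])
  have S: "S2 k a1 a2 P1 P2 \<mu> = dg_space2 k P1 P2 gx gy \<times> dg_space2 k P1 P2 cx cy"
    by (simp add: S2_def Let_def gx_def gy_def cx_def cy_def hx_def hy_def Nx_def Ny_def)
  have SD: "fst u \<in> dg_space2 k P1 P2 gx gy" "snd u \<in> dg_space2 k P1 P2 cx cy" if "u \<in> S2 k a1 a2 P1 P2 \<mu>" for u
    using that unfolding S mem_Times_iff by blast+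
  have ST: "fst u \<in> tensor_space k P1 P2 gx gy" "snd u \<in> tensor_space k P1 P2 cx cy" if "u \<in> S2 k a1 a2 P1 P2 \<mu>" for u
    using SD[OF that] dg_space2_tensor by blast+
  have SX: "u \<in> tensor_space k P1 P2 gx gy \<times> tensor_space k P1 P2 cx cy" if "u \<in> S2 k a1 a2 P1 P2 \<mu>" for u
    using ST[OF that] unfolding mem_Times_iff by blast
  have SY: "pswap u \<in> tensor_space k P2 P1 gy gx \<times> tensor_space k P2 P1 cy cx" if "u \<in> S2 k a1 a2 P1 P2 \<mu>" for u
    using ST[OF that] tensor_space_swap unfolding mem_Times_iff pswap_def fst_conv snd_conv by blast
  have ip: "ip2 a1 a2 P1 P2 = pip \<Omega>" by (simp add: ip2_def pip_def fun_eq_iff \<Omega>_def)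
  note C0 = inv_const(1)[of k]
  interpret pair_space "S2 k a1 a2 P1 P2 \<mu>" "(a1, a2)" "(a1 + P1, a2 + P2)" "inv_const k / \<delta> * (inv_const k / \<delta>)"
  proof
    show bb: "bounded_borel (fst u)" "bounded_borel (snd u)" if "u \<in> S2 k a1 a2 P1 P2 \<mu>" for u
      using ST[OF that] X.A.GY.T_bounded_borel X.B.GY.T_bounded_borel by blast+
    show "pcomb c u v \<in> S2 k a1 a2 P1 P2 \<mu>" if "u \<in> S2 k a1 a2 P1 P2 \<mu>" "v \<in> S2 k a1 a2 P1 P2 \<mu>" for u v c
      using SD[OF that(1)] SD[OF that(2)] dg_space2_comb unfolding S mem_Times_iff pcomb_def fst_conv snd_conv by blast
    show "(fst u z)\<^sup>2 + (snd u z)\<^sup>2 \<le> inv_const k / \<delta> * (inv_const k / \<delta>) * pip (cbox (a1, a2) (a1 + P1, a2 + P2)) u u"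
      if "u \<in> S2 k a1 a2 P1 P2 \<mu>" for u z
      unfolding pip_split[OF bb[OF that]]
      using X.A.GY.T_pointwise[OF ST(1)[OF that] \<delta> \<delta>gx \<delta> \<delta>gy, of z a1 a2] X.B.GY.T_pointwise[OF ST(2)[OF that] \<delta> \<delta>cx \<delta> \<delta>cy, of z a1 a2]
      unfolding distrib_left by linarith
    show "0 \<le> inv_const k / \<delta> * (inv_const k / \<delta>)" using C0 \<delta> by simp
  qed
  \<comment> \<open>Transport in the second direction is evaluated at swapped functions on the
    instance with exchanged directions; \<open>pip_pswap\<close> returns its bound to the original
    norms.\<close>
  define A where "A u \<phi> = \<beta>1 * X.XF a1 a2 u \<phi> + \<beta>2 * Y.XF a2 a1 (pswap u) (pswap \<phi>)" for u \<phi>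
  define c where "c = (3 * inv_const k + 1) / \<delta>"
  define \<theta> where "\<theta> = 1 / (Ccfl / (\<bar>\<beta>1\<bar> / hx + \<bar>\<beta>2\<bar> / hy))"
  show "energy_space (S2 k a1 a2 P1 P2 \<mu>) pcomb (ip2 a1 a2 P1 P2) (H2 \<beta>1 \<beta>2 Ccfl a1 a2 P1 P2 \<mu>) (K / hmax2 P1 P2 \<mu>)"
    unfolding ip h_def[symmetric] \<Omega>_def
  proof (rule energy_space_of_split[where A = A and \<theta> = \<theta> and K' = "(\<bar>\<beta>1\<bar> + \<bar>\<beta>2\<bar>) * c"])
    fix u \<phi> assume uS: "u \<in> S2 k a1 a2 P1 P2 \<mu>" and \<phi>S: "\<phi> \<in> S2 k a1 a2 P1 P2 \<mu>"
    note bu = S_fst[OF uS] S_snd[OF uS]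
    note u = ST[OF uS] and \<phi> = ST[OF \<phi>S]
    note us = tensor_space_swap[OF u(1)] tensor_space_swap[OF u(2)] and \<phi>s = tensor_space_swap[OF \<phi>(1)] tensor_space_swap[OF \<phi>(2)]
    note x1 = X.A.dx2_integral[OF \<phi>(1) bu(2)] and x2 = X.B.dx2_integral[OF \<phi>(2) bu(1)]
    note y1 = Y.A.dy2_integral[OF \<phi>s(1) bu(2)] and y2 = Y.B.dy2_integral[OF \<phi>s(2) bu(1)]
    have E: "integral \<Omega> (\<lambda>z. \<beta>1 * snd u z * dx2 (fst \<phi>) z + \<beta>2 * snd u z * dy2 (fst \<phi>) z
          + \<beta>1 * fst u z * dx2 (snd \<phi>) z + \<beta>2 * fst u z * dy2 (snd \<phi>) z)
        = \<beta>1 * integral \<Omega> (\<lambda>z. snd u z * dx2 (fst \<phi>) z) + \<beta>2 * integral \<Omega> (\<lambda>z. snd u z * dy2 (fst \<phi>) z)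
          + \<beta>1 * integral \<Omega> (\<lambda>z. fst u z * dx2 (snd \<phi>) z) + \<beta>2 * integral \<Omega> (\<lambda>z. fst u z * dy2 (snd \<phi>) z)"
      unfolding mult.assoc \<Omega>_def
      by (simp only: hk_integral_add integrable_add integrable_on_mult_right
          x1(1) x2(1) y1(1) y2(1) hk_integral_mult_right)
    note f1 = sum_cell_flux[of \<beta>1 \<beta>2 gx gy "snd u" "fst \<phi>" "{0..<int Ny}" "{0..<int Nx}"]
    note f2 = sum_cell_flux[of \<beta>1 \<beta>2 cx cy "fst u" "snd \<phi>" "{0..<int Ny}" "{0..<int Nx}"]
    note e1 = X.A.xform_expand[OF \<phi>(1) X.Td_adm[OF u(2)], of a1 a2] and e2 = X.B.xform_expand[OF \<phi>(2) X.Tp_adm[OF u(1)], of a1 a2]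
    note e3 = Y.A.xform_expand[OF \<phi>s(1) Y.Td_adm[OF us(2)], of a2 a1] and e4 = Y.B.xform_expand[OF \<phi>s(2) Y.Tp_adm[OF us(1)], of a2 a1]
    have gen: "- q * J + (\<beta>1 * i1 + \<beta>2 * i2 + \<beta>1 * i3 + \<beta>2 * i4) - (\<beta>1 * s1 + \<beta>2 * s2) - (\<beta>1 * s3 + \<beta>2 * s4)
        = (\<beta>1 * ((i1 - s1) + (i3 - s3)) + \<beta>2 * ((i2 - s2) + (i4 - s4))) - q * J" for q J i1 i2 i3 i4 s1 s2 s3 s4 :: real
      by (simp add: algebra_simps)
    show "H2 \<beta>1 \<beta>2 Ccfl a1 a2 P1 P2 \<mu> u \<phi> = A u \<phi> - \<theta> * integral (cbox (a1, a2) (a1 + P1, a2 + P2)) (\<lambda>z. (fst u z - snd u z) * (fst \<phi> z - snd \<phi> z))"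
      unfolding H2_def Let_def Nx_def[symmetric] Ny_def[symmetric] hx_def[symmetric] hy_def[symmetric] gx_def[symmetric] gy_def[symmetric]
        cx_def[symmetric] cy_def[symmetric] \<theta>_def[symmetric] \<Omega>_def[symmetric] A_def X.XF_def Y.XF_def pswap_def fst_conv snd_conv E f1 f2
      unfolding \<Omega>_def e1 e2 e3 e4 x1(2) x2(2) y1(2) y2(2) fst_conv snd_conv
      by (rule gen)
    show "\<bar>A u \<phi>\<bar> \<le> (\<bar>\<beta>1\<bar> + \<bar>\<beta>2\<bar>) * c * (pip (cbox (a1, a2) (a1 + P1, a2 + P2)) u u + pip (cbox (a1, a2) (a1 + P1, a2 + P2)) \<phi> \<phi>)"
    proof -
      define I where "I = pip (cbox (a1, a2) (a1 + P1, a2 + P2)) u u + pip (cbox (a1, a2) (a1 + P1, a2 + P2)) \<phi> \<phi>"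
      have 1: "\<bar>X.XF a1 a2 u \<phi>\<bar> \<le> c * I"
        unfolding c_def I_def by (rule X.XF_bound[OF SX[OF uS] SX[OF \<phi>S] \<delta> \<delta>gx \<delta>cx])
      have 2: "\<bar>Y.XF a2 a1 (pswap u) (pswap \<phi>)\<bar> \<le> c * I"
        using Y.XF_bound[OF SY[OF uS] SY[OF \<phi>S] \<delta> \<delta>gy \<delta>cy, of a2 a1]
        unfolding c_def I_def pip_pswap[OF S_fst[OF uS] S_snd[OF uS]] pip_pswap[OF S_fst[OF \<phi>S] S_snd[OF \<phi>S]] .
      have "\<bar>A u \<phi>\<bar> \<le> \<bar>\<beta>1\<bar> * \<bar>X.XF a1 a2 u \<phi>\<bar> + \<bar>\<beta>2\<bar> * \<bar>Y.XF a2 a1 (pswap u) (pswap \<phi>)\<bar>"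
        unfolding A_def by (rule order_trans[OF abs_triangle_ineq]) (simp add: abs_mult)
      also have "\<dots> \<le> \<bar>\<beta>1\<bar> * (c * I) + \<bar>\<beta>2\<bar> * (c * I)"
        using 1 2 by (intro add_mono mult_left_mono) auto
      finally show ?thesis unfolding I_def[symmetric] by (simp add: algebra_simps)
    qed
  next
    fix u assume u: "u \<in> S2 k a1 a2 P1 P2 \<mu>"
    show "A u u = 0" unfolding A_def X.XF_skew[OF SX[OF u]] Y.XF_skew[OF SY[OF u]] by simp
  next
    fix u v w and c' :: real assume *: "u \<in> S2 k a1 a2 P1 P2 \<mu>" "v \<in> S2 k a1 a2 P1 P2 \<mu>" "w \<in> S2 k a1 a2 P1 P2 \<mu>"
    have lin: "\<beta>1 * (p + c' * q) + \<beta>2 * (r + c' * t) = (\<beta>1 * p + \<beta>2 * r) + c' * (\<beta>1 * q + \<beta>2 * t)" for p q r t :: real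
      by (simp add: algebra_simps)
    show "A (pcomb c' u v) w = A u w + c' * A v w"
      unfolding A_def pswap_pcomb X.XF_comb_left[OF SX[OF *(1)] SX[OF *(2)] SX[OF *(3)]] Y.XF_comb_left[OF SY[OF *(1)] SY[OF *(2)] SY[OF *(3)]]
      by (rule lin)
    show "A w (pcomb c' u v) = A w u + c' * A w v"
      unfolding A_def pswap_pcomb X.XF_comb_right[OF SX[OF *(1)] SX[OF *(2)] SX[OF *(3)]] Y.XF_comb_right[OF SY[OF *(1)] SY[OF *(2)] SY[OF *(3)]]
      by (rule lin)
  next
    have b: "0 < \<bar>\<beta>1\<bar> + \<bar>\<beta>2\<bar>" using \<beta> by auto
    show "0 \<le> \<theta>" unfolding \<theta>_def using Ccfl hxy by simp
    show "0 < K / h" 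
    proof -
      have "0 < (B * q / \<sigma> + B / (\<sigma> * Ccfl)) / h" if "0 < B" "0 < q" for B q
        using that \<sigma> Ccfl h by (intro divide_pos_pos add_pos_pos mult_pos_pos)
      then show ?thesis unfolding K_def using b C0 by simp
    qed
    have "\<theta> = (\<bar>\<beta>1\<bar> / hx + \<bar>\<beta>2\<bar> / hy) / Ccfl" by (simp add: \<theta>_def)
    also have "\<dots> \<le> (\<bar>\<beta>1\<bar> / \<delta> + \<bar>\<beta>2\<bar> / \<delta>) / Ccfl"
      using qu hxy \<delta> Ccfl by (intro divide_right_mono add_mono divide_left_mono) auto
    also have "\<dots> = (\<bar>\<beta>1\<bar> + \<bar>\<beta>2\<bar>) / (\<delta> * Ccfl)" by (simp add: add_divide_distrib)
    finally have \<theta>: "\<theta> \<le> (\<bar>\<beta>1\<bar> + \<bar>\<beta>2\<bar>) / (\<delta> * Ccfl)" .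
    have "b * (q / (\<sigma> * h)) + b / (\<sigma> * h * Ccfl) = (b * q / \<sigma> + b / (\<sigma> * Ccfl)) / h" for b q
      by (simp add: add_divide_distrib mult_ac)
    then have "K / h = (\<bar>\<beta>1\<bar> + \<bar>\<beta>2\<bar>) * c + (\<bar>\<beta>1\<bar> + \<bar>\<beta>2\<bar>) / (\<delta> * Ccfl)" unfolding K_def c_def \<delta>_def by simp
    then show "(\<bar>\<beta>1\<bar> + \<bar>\<beta>2\<bar>) * c + \<theta> \<le> K / h" using \<theta> by simp
  qed
qed

theorem theorem3p5:
  fixes c d :: "nat \<Rightarrow> nat \<Rightarrow> real" and s r m \<zeta> :: nat
    and \<beta> Ccfl a P \<sigma> :: real and k :: nat
    and \<beta>1 \<beta>2 a1 a2 P1 P2 :: real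
  assumes "1 \<le> s" and "1 \<le> r" and "1 \<le> m"
    and rk_order: "\<forall>j\<le>r. coeff (rk_stab_poly c d s) j = 1 / fact j"
    and term_idx: "is_termination_index (rk_alpha c d s m) (m * s) \<zeta>"
    and "\<beta> \<noteq> 0" and "0 < Ccfl" and "0 < P" and "0 < \<sigma>"
    and "(\<beta>1, \<beta>2) \<noteq> (0, 0)" and "0 < P1" and "0 < P2"
  shows
   "(let \<alpha> = rk_alpha c d s m;
         \<rho> = contribution_index \<alpha> (m * s) \<zeta>;
         a\<zeta> = fst (mt_AB \<alpha> (m * s) \<zeta>) \<zeta> \<zeta>;
         M1 = quasi_uniform_meshes1 a P \<sigma>; S1' = S1 k P; ip1' = (\<lambda>\<mu>. ip1 a P);
         H1' = H1 \<beta> Ccfl a P;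
         M2 = uniform_meshes2 P1 P2 \<sigma>; h2 = hmax2 P1 P2; S2' = S2 k a1 a2 P1 P2;
         ip2' = (\<lambda>\<mu>. ip2 a1 a2 P1 P2); H2' = H2 \<beta>1 \<beta>2 Ccfl a1 a2 P1 P2
     in
     (\<rho> = \<zeta> \<and> a\<zeta> < 0 \<longrightarrow>
        monotonically_stable M1 hmax1 S1' ip1' H1' c d s m \<and>
        monotonically_stable M2 h2 S2' ip2' H2' c d s m) \<and>
     (\<rho> = \<zeta> \<and> a\<zeta> > 0 \<longrightarrow>
        weak_stable (2 * \<zeta>) M1 hmax1 S1' ip1' H1' c d s m \<and>
        weak_stable (2 * \<zeta>) M2 h2 S2' ip2' H2' c d s m) \<and>
     (\<rho> < \<zeta> \<longrightarrow>
        weak_stable (2 * \<rho> + 1) M1 hmax1 S1' ip1' H1' c d s m \<and>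
        weak_stable (2 * \<rho> + 1) M2 h2 S2' ip2' H2' c d s m))"
proof -
  \<comment> \<open>Both constants depend on the degree, \<sigma>, the CFL number and the velocity,
    but on no mesh; this uniformity yields one stability constant per family.\<close>
  define K1 where "K1 = \<bar>\<beta>\<bar> * (3 * inv_const k + 1) / \<sigma> + \<bar>\<beta>\<bar> / Ccfl"
  define K2 where "K2 = (\<bar>\<beta>1\<bar> + \<bar>\<beta>2\<bar>) * (3 * inv_const k + 1) / \<sigma> + (\<bar>\<beta>1\<bar> + \<bar>\<beta>2\<bar>) / (\<sigma> * Ccfl)"
  have pos: "0 < B * (3 * inv_const k + 1) / \<sigma> + B / D" if "0 < B" "0 < D" for B D
    using that \<open>0 < \<sigma>\<close> inv_const(1)[of k] by (intro add_pos_pos divide_pos_pos mult_pos_pos) auto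
  have K1: "0 < K1" unfolding K1_def using \<open>\<beta> \<noteq> 0\<close> \<open>0 < Ccfl\<close> by (intro pos) auto
  have "0 < \<bar>\<beta>1\<bar> + \<bar>\<beta>2\<bar>" using \<open>(\<beta>1, \<beta>2) \<noteq> (0, 0)\<close> by auto
  then have K2: "0 < K2" unfolding K2_def using \<open>0 < Ccfl\<close> \<open>0 < \<sigma>\<close> by (intro pos) auto
  note h1 = energy_space_1d(1)[OF \<open>\<beta> \<noteq> 0\<close> \<open>0 < Ccfl\<close> \<open>0 < \<sigma>\<close>, where a = a and P = P]
  note e1 = energy_space_1d(2)[OF \<open>\<beta> \<noteq> 0\<close> \<open>0 < Ccfl\<close> \<open>0 < \<sigma>\<close>, where a = a and P = P and k = k, folded K1_def]
  note h2 = energy_space_2d(1)[OF \<open>(\<beta>1, \<beta>2) \<noteq> (0, 0)\<close> \<open>0 < Ccfl\<close> \<open>0 < P1\<close> \<open>0 < P2\<close> \<open>0 < \<sigma>\<close>]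
  note e2 = energy_space_2d(2)[OF \<open>(\<beta>1, \<beta>2) \<noteq> (0, 0)\<close> \<open>0 < Ccfl\<close> \<open>0 < P1\<close> \<open>0 < P2\<close> \<open>0 < \<sigma>\<close>,
      where ?a1.0 = a1 and ?a2.0 = a2 and k = k, folded K2_def]
  have E1: "\<exists>comb. energy_space (S1 k P \<mu>) comb (ip1 a P) (H1 \<beta> Ccfl a P \<mu>) (K1 / hmax1 \<mu>)"
    if "\<mu> \<in> quasi_uniform_meshes1 a P \<sigma>" for \<mu>
    using e1[OF that] by blast
  have E2: "\<exists>comb. energy_space (S2 k a1 a2 P1 P2 \<mu>) comb (ip2 a1 a2 P1 P2) (H2 \<beta>1 \<beta>2 Ccfl a1 a2 P1 P2 \<mu>) (K2 / hmax2 P1 P2 \<mu>)"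
    if "\<mu> \<in> uniform_meshes2 P1 P2 \<sigma>" for \<mu>
    using e2[OF that] by blast
  note s1 = stability_of_energy_spaces[where h = hmax1 and S = "S1 k P" and ip = "\<lambda>\<mu>. ip1 a P"
      and H = "H1 \<beta> Ccfl a P", OF assms(1-3) rk_order term_idx K1 h1 E1]
  note s2 = stability_of_energy_spaces[where h = "hmax2 P1 P2" and S = "S2 k a1 a2 P1 P2" and ip = "\<lambda>\<mu>. ip2 a1 a2 P1 P2"
      and H = "H2 \<beta>1 \<beta>2 Ccfl a1 a2 P1 P2", OF assms(1-3) rk_order term_idx K2 h2 E2]
  show ?thesis
    unfolding Let_def
    by (intro conjI impI; (elim conjE)?;
        (rule s1(1) s2(1), assumption, assumption | rule s1(2) s2(2), assumption | rule s1(3) s2(3), assumption))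
qed

end
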